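(* Let $\kappa\in\mathbb{Z}$ and let $L$ be an even lattice of even rank with discriminant form $D=L'/L$ and odd level $N$. The diagram with lower row $\mathcal{L}_{\rho_D}:S_\kappa(\Gamma_0(N),\chi_D)\to S_\kappa(\rho_D)$, upper row $\mathcal{L}_\omega:A_\kappa(K_0(N)\cap G(\mathbb{A}),\xi_D|_{G(\mathbb{A})})\to A_\kappa(\omega_f)$, left vertical arrow $\mathscr{A}_{\xi_D}:S_\kappa(\Gamma_0(N),\chi_D)\to A_\kappa(K_0(N)\cap G(\mathbb{A}),\xi_D|_{G(\mathbb{A})})$ (adelization followed by restriction to $G(\mathbb{A})$) and right vertical arrow $\mathscr{A}_\omega:S_\kappa(\rho_D)\to A_\kappa(\omega_f)$ is commutative, i.e. $$(\mathscr{A}_\omega\circ\mathcal{L}_{\rho_D})(f)=(\mathcal{L}_\omega\circ\mathscr{A}_{\xi_D})(f)\qquad\text{for all } f\in S_\kappa(\Gamma_0(N),\chi_D).$$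
   Context: Groups. $\mathbb{A}$ is the adele ring of $\mathbb{Q}$, $\mathbb{A}_f$ the finite adeles, $\widehat{\mathbb{Z}}=\prod_{p<\infty}\mathbb{Z}_p$, $e(x)=e^{2\pi i x}$, $\Gamma=\mathrm{SL}_2(\mathbb{Z})$, $\mathbb{H}$ the upper half plane. For a commutative ring $R$ with 1: $G(R)=\{g\in\mathrm{GL}_2(R):\det g\in(R^\times)^2\}$, $\mathcal{G}(R)=\{(g,r)\in\mathrm{GL}_2(R)\times R^\times:\det g=r^2\}$, $Z(R)=\{\mathrm{diag}(r,r):r\in R^\times\}$, $\mathcal{Z}(R)=\{(z,r)\in Z(R)\times R^\times:\det z=r^2\}$, $\overline{G}(R)=Z(R)\backslash G(R)$, $\overline{\mathcal{G}}(R)=\mathcal{Z}(R)\backslash\mathcal{G}(R)$. $G(\mathbb{A})$, $\mathcal{G}(\mathbb{A})$ are the restricted products over all places $p\le\infty$; $\mathrm{GL}_2(\mathbb{R})^+$ is embedded in $\mathcal{G}(\mathbb{R})$ by $g\mapsto(g,\sqrt{\det g})$; $p:\mathcal{G}(\mathbb{A})\to G(\mathbb{A})$ is $p(g,t)=g$. $N(R)$ is the group of matrices $\begin{pmatrix}1&t\\0&1\end{pmatrix}$, and $N_{\mathcal{G}}(R)=N(R)\times\{1\}\subset\mathcal{G}(R)$. $\mathcal{K}=\prod_{p<\infty}\mathcal{G}(\mathbb{Z}_p)$. $K_0(N)\subset\mathrm{GL}_2(\widehat{\mathbb{Z}})$ is the subgroup of matrices whose $p$-components have lower left entry $\equiv0\bmod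 N$ for all $p\mid N$, and $\mathcal{K}_0(N)=\{(k,t)\in\mathcal{K}:k\in K_0(N)\}$; these are regarded as subgroups of adelic groups with trivial component at $\infty$. One has $\mathrm{GL}_2(\mathbb{A})=\mathrm{GL}_2(\mathbb{Q})(\mathrm{GL}_2(\mathbb{R})^+\times K_0(N))$ and $\mathcal{G}(\mathbb{A})=\mathcal{G}(\mathbb{Q})(\mathrm{GL}_2(\mathbb{R})^+\times\mathcal{K})$. Lattice and Weil representation. $L$ is a non-degenerate lattice of even rank with $\mathbb{Z}$-valued bilinear form $(\cdot,\cdot)$ of type $(b^+,b^-)$, $q(x)=\frac12(x,x)\in\mathbb{Z}$ on $L$, $\mathrm{sig}(L)=b^+-b^-$ (even). $L'$ is the dual lattice, $D=L'/L$ with induced $\mathbb{Q}/\mathbb{Z}$-valued $q$ and $(\cdot,\cdot)$. The level $N$ is the smallest positive integer with $Nq(\lambda)\in\mathbb{Z}$ for all $\lambda\in L'$; $N$ (hence $|D|$) is odd. For $\mu\in D$ let $\varphi_\mu$ be the characteristic function of $\mu+\widehat{L}$, $\widehat L=L\otimes\widehat{\mathbb{Z}}$, on $L\otimes\mathbb{A}_f$, $S_L=\bigoplus_{\mu\in D}\mathbb{C}\varphi_\mu$ with Hermitian inner product $\langle\cdot,\cdot\rangle$ making $\{\varphi_\mu\}$ orthonormal. $S_L$ is identified with the group algebra $\mathbb{C}[D]$, with basis $\{\mathfrak{e}_\mu\}$, by $\varphi_\mu\leftrightarrow\mathfrak{e}_\mu$. The Weil representation $\rho_D$ of $\Gamma$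 on $\mathbb{C}[D]$ is the unitary representation with $\rho_D\begin{pmatrix}1&1\\0&1\end{pmatrix}\mathfrak{e}_\lambda=e(-q(\lambda))\mathfrak{e}_\lambda$, $\rho_D\begin{pmatrix}0&-1\\1&0\end{pmatrix}\mathfrak{e}_\lambda=\frac{e(\mathrm{sig}(L)/8)}{\sqrt{|D|}}\sum_{\mu\in D}e((\lambda,\mu))\mathfrak{e}_\mu$; it factors through $\mathrm{SL}_2(\mathbb{Z}/N\mathbb{Z})$. It extends to $Q(N)=\{(A,r)\in\mathrm{GL}_2(\mathbb{Z}/N\mathbb{Z})\times(\mathbb{Z}/N\mathbb{Z})^\times:\det A=r^2\}$ by $\rho_D(A,r)=\frac{g(D)}{g_r(D)}\rho_D(r^{-1}A)$ with $g_r(D)=\sum_{\lambda\in D}e(rq(\lambda))$, $g(D)=g_1(D)$. Let $\sigma_N:\mathcal{K}\to Q(N)$ be reduction modulo $N$ (of the components at $p\mid N$). For $k\in\mathcal{K}$ put $\omega_f(k)=\rho_D(\sigma_N(k))$, acting on $S_L$. Character. $\chi_D(a)=\left(\frac{a}{|D|}\right)$ (Jacobi symbol). $\xi_D:\mathbb{Q}^\times\backslash\mathbb{A}^\times\to\mathbb{C}^\times$ is the induced Hecke character: $\xi_D(q(x\times u))=\chi_D(u\bmod N)$ for $q\in\mathbb{Q}^\times$, $x\in\mathbb{R}_{>0}$, $u\in\widehat{\mathbb{Z}}^\times$. For $z=\mathrm{diag}(r,r)\in Z(\mathbb{A})$, $\xi_D(z)=\xi_D(r)$; for $k=\begin{pmatrix}a&b\\c&d\end{pmatrix}\in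 K_0(N)$, $\xi_D(k)=\chi_D(d\bmod N)$. Classical forms. $j(A,\tau)=c\tau+d$ and $(f\mid_\kappa A)(\tau)=\det(A)^{\kappa/2}j(A,\tau)^{-\kappa}f(A\tau)$ for $A=\begin{pmatrix}a&b\\c&d\end{pmatrix}$ of positive determinant. $S_\kappa(\Gamma_0(N),\chi_D)$ is the space of holomorphic cusp forms $f$ of weight $\kappa$ with $f\mid_\kappa\gamma=\chi_D(d)f$ for $\gamma=\begin{pmatrix}a&b\\c&d\end{pmatrix}\in\Gamma_0(N)$. $S_\kappa(\rho_D)$ is the space of holomorphic cusp forms $f:\mathbb{H}\to\mathbb{C}[D]$ with $f(\gamma\tau)=j(\gamma,\tau)^\kappa\rho_D(\gamma)f(\tau)$ for all $\gamma\in\Gamma$. Differential operator. $r_\theta=\begin{pmatrix}\cos\theta&\sin\theta\\-\sin\theta&\cos\theta\end{pmatrix}$ at the infinite place; $\mathbf{L}=e^{-2i\theta}\left(-2iy\frac{\partial}{\partial x}+2y\frac{\partial}{\partial y}+i\frac{\partial}{\partial\theta}\right)$ in Iwasawa coordinates $g_\infty=\lambda\begin{pmatrix}1&x\\0&1\end{pmatrix}\begin{pmatrix}y^{1/2}&0\\0&y^{-1/2}\end{pmatrix}r_\theta$ ($\lambda,y>0$, $x\in\mathbb{R}$) of $\mathrm{GL}_2(\mathbb{R})^+$. Scalar-valued adelic forms. $A_\kappa(K_0(N)\cap G(\mathbb{A}),\xi_D|_{G(\mathbb{A})})$ is the space of measurable, left $G(\mathbb{Q})$-invariant $\phi:G(\mathbb{A})\to\mathbb{C}$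 with: $\phi(zg)=\xi_D(z)\phi(g)$ for $z\in Z(\mathbb{A})$; $\int_{\overline{G}(\mathbb{Q})\backslash\overline{G}(\mathbb{A})}|\phi|^2dg<\infty$; $\int_{N(\mathbb{Q})\backslash N(\mathbb{A})}\phi(ng)dn=0$ for almost every $g$; $\phi(gk)=\xi_D(k)\phi(g)$ for all $k\in K_0(N)\cap G(\mathbb{A})$; $\phi(gr_\theta)=e^{i\kappa\theta}\phi(g)$ for all $\theta$; and $\mathbf{L}\phi=0$ as a function of $g_\infty\in\mathrm{GL}_2(\mathbb{R})^+$ alone. Vector-valued adelic forms. $A_\kappa(\omega_f)$ is the space of left $\mathcal{G}(\mathbb{Q})$-invariant functions $F=\sum_{\mu\in D}F_\mu\varphi_\mu:\mathcal{G}(\mathbb{A})\to S_L$ with all $F_\mu$ measurable and: $F(zg)=\omega_f(z_f)^{-1}F(g)$ for all $z\in\mathcal{Z}(\mathbb{A})$, where $z=z_{\mathbb{Q}}(z_\infty\times z_f)$ with $z_{\mathbb{Q}}\in\mathcal{Z}(\mathbb{Q})$, $z_\infty=(\mathrm{diag}(r,r),r)$ for some $r>0$, and $z_f\in\mathcal{Z}(\mathbb{A}_f)\cap\mathcal{K}$; $\int_{\overline{\mathcal{G}}(\mathbb{Q})\backslash\overline{\mathcal{G}}(\mathbb{A})}\langle F(g),F(g)\rangle dg<\infty$; $\int_{N_{\mathcal{G}}(\mathbb{Q})\backslash N_{\mathcal{G}}(\mathbb{A})}F_\mu(ng)dn=0$ for all $\mu$ and almost every $g$; $F(gk)=\omega_f(k)^{-1}F(g)$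 for all $k\in\mathcal{K}$; $F(gr_\theta)=e^{i\kappa\theta}F(g)$ for all $\theta$; and each $F_\mu$ satisfies $\mathbf{L}F_\mu=0$ as a function of $g_\infty\in\mathrm{GL}_2(\mathbb{R})^+$ alone. The four maps. $\mathcal{L}_{\rho_D}(f)=\sum_{\gamma\in\Gamma_0(N)\backslash\Gamma}(f\mid_\kappa\gamma)\,\rho_D(\gamma)^{-1}\mathfrak{e}_0$. $\mathcal{L}_\omega(F)(g)=\sum_{k\in\mathcal{K}/\mathcal{K}_0(N)}F(p(gk))\,\omega_f(k)\varphi_0$ for $g\in\mathcal{G}(\mathbb{A})$. $\mathscr{A}_{\xi_D}(f)$ is the restriction to $G(\mathbb{A})$ of the function on $\mathrm{GL}_2(\mathbb{A})$ given by $g_{\mathbb{Q}}(g_\infty\times k)\mapsto\xi_D(k)\det(g_\infty)^{\kappa/2}j(g_\infty,i)^{-\kappa}f(g_\infty i)$, where $g_{\mathbb{Q}}\in\mathrm{GL}_2(\mathbb{Q})$, $g_\infty\in\mathrm{GL}_2(\mathbb{R})^+$, $k\in K_0(N)$. $\mathscr{A}_\omega(f)(g_{\mathbb{Q}}(g_\infty\times k))=\omega_f(k)^{-1}\det(g_\infty)^{\kappa/2}j(g_\infty,i)^{-\kappa}f(g_\infty i)$, where $g_{\mathbb{Q}}\in\mathcal{G}(\mathbb{Q})$, $g_\infty\in\mathrm{GL}_2(\mathbb{R})^+$, $k\in\mathcal{K}$. *)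

theory Defs
  imports
    "HOL-Analysis.Analysis"
    "HOL-Number_Theory.Number_Theory"
    "HOL-Algebra.QuotRing"
    "HOL-Algebra.Left_Coset"
begin

section \<open>The fields of p-adic numbers\<close>

definition padic_val :: "nat \<Rightarrow> rat \<Rightarrow> int" where
  "padic_val p q = int (multiplicity (int p) (fst (quotient_of q)))
                 - int (multiplicity (int p) (snd (quotient_of q)))"

definition padic_abs :: "nat \<Rightarrow> rat \<Rightarrow> real" where
  "padic_abs p q = (if q = 0 then 0 else real p powi (- padic_val p q))"

definition padic_cauchy :: "nat \<Rightarrow> (nat \<Rightarrow> rat) \<Rightarrow> bool" where
  "padic_cauchy p s \<longleftrightarrow> (\<forall>\<epsilon>>0. \<exists>M. \<forall>m\<ge>M. \<forall>n\<ge>M. padic_abs p (s m - s n) < \<epsilon>)"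

definition padic_cauchy_ring :: "nat \<Rightarrow> (nat \<Rightarrow> rat) ring" where
  "padic_cauchy_ring p =
     \<lparr>carrier = {s. padic_cauchy p s}, mult = (\<lambda>s t n. s n * t n), one = (\<lambda>_. 1),
      zero = (\<lambda>_. 0), add = (\<lambda>s t n. s n + t n)\<rparr>"

definition padic_null :: "nat \<Rightarrow> (nat \<Rightarrow> rat) set" where
  "padic_null p = {s. (\<lambda>n. padic_abs p (s n)) \<longlonglongrightarrow> 0}"

text \<open>\<open>\<rat>\<^sub>p\<close> as the completion of \<open>\<rat>\<close>: Cauchy sequences modulo null sequences.\<close>

definition padic_field :: "nat \<Rightarrow> (nat \<Rightarrow> rat) set ring" where
  "padic_field p = padic_cauchy_ring p Quot padic_null p"

text \<open>\<open>\<int>\<^sub>p = {x. |x|\<^sub>p \<le> 1}\<close>: as the absolute value of a Cauchy sequence is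
  eventually constant or tends to 0, \<open>|x|\<^sub>p \<le> 1\<close> means that \<open>x\<close> is
  the class of a sequence of rationals of absolute value at most 1.\<close>

definition padic_integers :: "nat \<Rightarrow> (nat \<Rightarrow> rat) set set" where
  "padic_integers p = {x \<in> carrier (padic_field p). \<exists>s\<in>x. \<forall>n. padic_abs p (s n) \<le> 1}"

definition padic_of_rat :: "nat \<Rightarrow> rat \<Rightarrow> (nat \<Rightarrow> rat) set" where
  "padic_of_rat p q = padic_null p +>\<^bsub>padic_cauchy_ring p\<^esub> (\<lambda>_. q)"

lemma padic_val_frac:
  assumes p: "prime p" and "a \<noteq> 0" "b \<noteq> 0"
  shows "padic_val p (of_int a / of_int b)
       = int (multiplicity (int p) a) - int (multiplicity (int p) b)"
proof -
  define c d where "c = fst (quotient_of (of_int a / of_int b))"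
    and "d = snd (quotient_of (of_int a / of_int b))"
  have q: "quotient_of (of_int a / of_int b) = (c, d)"
    by (simp add: c_def d_def)
  have d0: "d > 0"
    using quotient_of_denom_pos[OF q] .
  have "(of_int a / of_int b :: rat) = of_int c / of_int d"
    using quotient_of_div[OF q] .
  hence "(of_int (a * d) :: rat) = of_int (c * b)"
    using assms d0 by (simp add: field_simps)
  hence eq: "a * d = c * b"
    by (simp only: of_int_eq_iff)
  have c0: "c \<noteq> 0"
    using eq assms d0 by auto
  have pe: "prime_elem (int p)"
    using p by simp
  have "multiplicity (int p) a + multiplicity (int p) d
      = multiplicity (int p) c + multiplicity (int p) b"
    using arg_cong[OF eq, of "multiplicity (int p)"] assms d0 c0
    by (simp add: prime_elem_multiplicity_mult_distrib[OF pe])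
  thus ?thesis
    by (simp add: padic_val_def c_def[symmetric] d_def[symmetric])
qed

lemma rat_frac: obtains a b :: int where "b \<noteq> 0" "(q :: rat) = of_int a / of_int b"
proof -
  obtain a b where ab: "quotient_of q = (a, b)" by force
  show ?thesis
    using that[of b a] quotient_of_denom_pos[OF ab] quotient_of_div[OF ab] by simp
qed

lemma padic_abs_nonneg [simp]: "padic_abs p q \<ge> 0"
  by (simp add: padic_abs_def)

lemma padic_abs_0 [simp]: "padic_abs p 0 = 0"
  by (simp add: padic_abs_def)

lemma padic_abs_1 [simp]: "padic_abs p 1 = 1"
  by (simp add: padic_abs_def padic_val_def)

lemma padic_abs_mult:
  assumes p: "prime p"
  shows "padic_abs p (x * y) = padic_abs p x * padic_abs p y"
proof (cases "x = 0 \<or> y = 0")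
  case False
  obtain a b where ab: "b \<noteq> 0" "x = of_int a / of_int b" by (rule rat_frac)
  obtain c d where cd: "d \<noteq> 0" "y = of_int c / of_int d" by (rule rat_frac)
  have nz: "a \<noteq> 0" "c \<noteq> 0" using False ab cd by auto
  have xy: "x * y = of_int (a * c) / of_int (b * d)" using ab cd by simp
  have pe: "prime_elem (int p)" using p by simp
  have v: "padic_val p (x * y) = padic_val p x + padic_val p y"
    unfolding xy unfolding ab(2) cd(2) using nz ab(1) cd(1)
    by (simp add: padic_val_frac[OF p] prime_elem_multiplicity_mult_distrib[OF pe]
        del: of_int_mult)
  have "real p \<noteq> 0" using p by auto
  thus ?thesis using False by (simp add: padic_abs_def v power_int_add[symmetric])
qed (auto simp: padic_abs_def)

lemma padic_abs_minus [simp]: "padic_abs p (- x) = padic_abs p x"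
proof -
  have "multiplicity (int p) (- a) = multiplicity (int p) a" for a
    by (simp add: multiplicity_def)
  thus ?thesis
    by (simp add: padic_abs_def padic_val_def rat_uminus_code case_prod_beta Let_def)
qed

lemma padic_abs_add:
  assumes p: "prime p"
  shows "padic_abs p (x + y) \<le> max (padic_abs p x) (padic_abs p y)"
proof (cases "x = 0 \<or> y = 0 \<or> x + y = 0")
  case True
  thus ?thesis by (elim disjE) (auto simp: le_max_iff_disj)
next
  case False
  obtain a b where ab: "b \<noteq> 0" "x = of_int a / of_int b" by (rule rat_frac)
  obtain c d where cd: "d \<noteq> 0" "y = of_int c / of_int d" by (rule rat_frac)
  define a' c' e where "a' = a * d" and "c' = c * b" and "e = b * d"
  have e0: "e \<noteq> 0" using ab cd by (simp add: e_def)
  have x: "x = of_int a' / of_int e" and y: "y = of_int c' / of_int e"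
    using ab cd by (simp_all add: a'_def c'_def e_def)
  have xy: "x + y = of_int (a' + c') / of_int e" by (simp add: x y add_divide_distrib)
  have nz: "a' \<noteq> 0" "c' \<noteq> 0" "a' + c' \<noteq> 0"
    using False x y xy by auto
  let ?m = "\<lambda>z. multiplicity (int p) z"
  have np: "\<not> is_unit (int p)" using p by (auto dest: prime_gt_1_nat)
  have "int p ^ min (?m a') (?m c') dvd a' + c'"
    by (intro dvd_add multiplicity_dvd') auto
  hence m: "min (?m a') (?m c') \<le> ?m (a' + c')"
    using nz np by (intro multiplicity_geI) auto
  have v: "padic_val p x = int (?m a') - int (?m e)"
          "padic_val p y = int (?m c') - int (?m e)"
          "padic_val p (x + y) = int (?m (a' + c')) - int (?m e)"
    unfolding xy unfolding x y using padic_val_frac[OF p _ e0] nz by blast+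
  have "min (padic_val p x) (padic_val p y) \<le> padic_val p (x + y)"
    using m v by linarith
  moreover have p1: "real p \<ge> 1" using prime_ge_1_nat[OF p] by simp
  ultimately have "real p powi (- padic_val p (x + y)) \<le> real p powi (- padic_val p x)
      \<or> real p powi (- padic_val p (x + y)) \<le> real p powi (- padic_val p y)"
    by (cases "padic_val p x \<le> padic_val p y") (auto intro!: power_int_increasing)
  thus ?thesis using False by (auto simp: padic_abs_def le_max_iff_disj)
qed

lemma padic_abs_add_le:
  "prime p \<Longrightarrow> padic_abs p (x + y) \<le> padic_abs p x + padic_abs p y"
  using padic_abs_add[of p x y] padic_abs_nonneg[of p x] padic_abs_nonneg[of p y] by linarith

lemma padic_abs_diff_le:
  "prime p \<Longrightarrow> padic_abs p (x - y) \<le> padic_abs p x + padic_abs p y"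
  using padic_abs_add_le[of p x "- y"] by simp

lemma padic_cauchy_const [simp]: "padic_cauchy p (\<lambda>_. c)"
  by (simp add: padic_cauchy_def)

lemma padic_cauchy_minus: "padic_cauchy p s \<Longrightarrow> padic_cauchy p (\<lambda>n. - s n)"
  unfolding padic_cauchy_def
  by (metis (no_types, lifting) minus_diff_minus padic_abs_minus)

lemma padic_cauchy_add:
  assumes p: "prime p" and "padic_cauchy p s" "padic_cauchy p t"
  shows "padic_cauchy p (\<lambda>n. s n + t n)"
  unfolding padic_cauchy_def
proof (intro allI impI)
  fix \<epsilon> :: real assume e: "\<epsilon> > 0"
  obtain M where M: "\<And>m n. m \<ge> M \<Longrightarrow> n \<ge> M \<Longrightarrow> padic_abs p (s m - s n) < \<epsilon> / 2"
    using assms(2) e unfolding padic_cauchy_def by (meson half_gt_zero)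
  obtain K where K: "\<And>m n. m \<ge> K \<Longrightarrow> n \<ge> K \<Longrightarrow> padic_abs p (t m - t n) < \<epsilon> / 2"
    using assms(3) e unfolding padic_cauchy_def by (meson half_gt_zero)
  have "padic_abs p (s m + t m - (s n + t n)) < \<epsilon>" if "m \<ge> max M K" "n \<ge> max M K" for m n
    using padic_abs_add_le[OF p, of "s m - s n" "t m - t n"] M[of m n] K[of m n] that
    by (simp add: algebra_simps)
  thus "\<exists>M. \<forall>m\<ge>M. \<forall>n\<ge>M. padic_abs p (s m + t m - (s n + t n)) < \<epsilon>" by blast
qed

lemma padic_cauchy_bounded:
  assumes p: "prime p" and "padic_cauchy p s"
  obtains C where "C > 0" "\<And>n. padic_abs p (s n) \<le> C"
proof -
  obtain M where M: "\<And>m n. m \<ge> M \<Longrightarrow> n \<ge> M \<Longrightarrow> padic_abs p (s m - s n) < 1"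
    using assms(2) unfolding padic_cauchy_def by (meson zero_less_one)
  define C where "C = 1 + (\<Sum>i\<le>M. padic_abs p (s i))"
  have sum: "padic_abs p (s i) \<le> (\<Sum>i\<le>M. padic_abs p (s i))" if "i \<le> M" for i
    using that by (intro member_le_sum) auto
  have "padic_abs p (s n) \<le> C" for n
  proof (cases "n \<le> M")
    case True
    thus ?thesis using sum[of n] by (simp add: C_def)
  next
    case False
    have "padic_abs p (s n) \<le> padic_abs p (s n - s M) + padic_abs p (s M)"
      using padic_abs_add_le[OF p, of "s n - s M" "s M"] by simp
    thus ?thesis using M[of n M] sum[of M] False by (simp add: C_def)
  qed
  moreover have "C > 0" by (simp add: C_def sum_nonneg add_pos_nonneg)
  ultimately show ?thesis using that by blast
qed

lemma padic_cauchy_mult: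
  assumes p: "prime p" and s: "padic_cauchy p s" and t: "padic_cauchy p t"
  shows "padic_cauchy p (\<lambda>n. s n * t n)"
  unfolding padic_cauchy_def
proof (intro allI impI)
  fix \<epsilon> :: real assume e: "\<epsilon> > 0"
  obtain C where C: "C > 0" "\<And>n. padic_abs p (s n) \<le> C"
    using padic_cauchy_bounded[OF p s] by blast
  obtain D where D: "D > 0" "\<And>n. padic_abs p (t n) \<le> D"
    using padic_cauchy_bounded[OF p t] by blast
  have "\<epsilon> / (2 * D) > 0" "\<epsilon> / (2 * C) > 0" using e C D by auto
  then obtain M K where
    M: "\<And>m n. m \<ge> M \<Longrightarrow> n \<ge> M \<Longrightarrow> padic_abs p (s m - s n) < \<epsilon> / (2 * D)" and
    K: "\<And>m n. m \<ge> K \<Longrightarrow> n \<ge> K \<Longrightarrow> padic_abs p (t m - t n) < \<epsilon> / (2 * C)"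
    using s t unfolding padic_cauchy_def by meson
  have "padic_abs p (s m * t m - s n * t n) < \<epsilon>" if mn: "m \<ge> max M K" "n \<ge> max M K" for m n
  proof -
    have "s m * t m - s n * t n = (s m - s n) * t m + s n * (t m - t n)"
      by (simp add: algebra_simps)
    hence "padic_abs p (s m * t m - s n * t n)
        \<le> padic_abs p (s m - s n) * padic_abs p (t m) + padic_abs p (s n) * padic_abs p (t m - t n)"
      using padic_abs_add_le[OF p] by (simp add: padic_abs_mult[OF p, symmetric])
    also have "\<dots> \<le> padic_abs p (s m - s n) * D + C * padic_abs p (t m - t n)"
      using C D by (intro add_mono mult_left_mono mult_right_mono) auto
    also have "\<dots> < \<epsilon> / (2 * D) * D + C * (\<epsilon> / (2 * C))"
      using M[of m n] K[of m n] mn C(1) D(1)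
      by (intro add_strict_mono mult_strict_right_mono mult_strict_left_mono) auto
    also have "\<dots> = \<epsilon>" using C(1) D(1) by (simp add: field_simps)
    finally show ?thesis .
  qed
  thus "\<exists>M. \<forall>m\<ge>M. \<forall>n\<ge>M. padic_abs p (s m * t m - s n * t n) < \<epsilon>" by blast
qed

lemma padic_cauchy_ring_cring:
  assumes p: "prime p"
  shows "cring (padic_cauchy_ring p)"
proof (rule cringI)
  show "abelian_group (padic_cauchy_ring p)"
  proof (rule abelian_groupI)
    fix s assume "s \<in> carrier (padic_cauchy_ring p)"
    thus "\<exists>t\<in>carrier (padic_cauchy_ring p).
        t \<oplus>\<^bsub>padic_cauchy_ring p\<^esub> s = \<zero>\<^bsub>padic_cauchy_ring p\<^esub>"
      by (intro bexI[of _ "\<lambda>n. - s n"])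
        (auto simp: padic_cauchy_ring_def intro: padic_cauchy_minus)
  qed (simp_all add: padic_cauchy_ring_def padic_cauchy_add[OF p] add.assoc add.commute add.left_commute)
  show "comm_monoid (padic_cauchy_ring p)"
    by (rule comm_monoidI)
      (simp_all add: padic_cauchy_ring_def padic_cauchy_mult[OF p] mult.assoc mult.commute mult.left_commute)
qed (simp add: padic_cauchy_ring_def distrib_right)

lemma padic_null_cauchy:
  assumes p: "prime p" and s: "s \<in> padic_null p"
  shows "padic_cauchy p s"
  unfolding padic_cauchy_def
proof (intro allI impI)
  fix \<epsilon> :: real assume e: "\<epsilon> > 0"
  obtain M where M: "\<And>n. n \<ge> M \<Longrightarrow> padic_abs p (s n) < \<epsilon> / 2"
    using LIMSEQ_D[of "\<lambda>n. padic_abs p (s n)" 0 "\<epsilon> / 2"] s e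
    by (simp add: padic_null_def) blast
  have "padic_abs p (s m - s n) < \<epsilon>" if "m \<ge> M" "n \<ge> M" for m n
    using padic_abs_diff_le[OF p, of "s m" "s n"] M[of m] M[of n] that by simp
  thus "\<exists>M. \<forall>m\<ge>M. \<forall>n\<ge>M. padic_abs p (s m - s n) < \<epsilon>" by blast
qed

lemma padic_null_add:
  assumes p: "prime p" and s: "s \<in> padic_null p" and t: "t \<in> padic_null p"
  shows "(\<lambda>n. s n + t n) \<in> padic_null p"
proof -
  have "(\<lambda>n. padic_abs p (s n) + padic_abs p (t n)) \<longlonglongrightarrow> 0 + 0"
    using s t unfolding padic_null_def by (intro tendsto_add) auto
  hence "(\<lambda>n. padic_abs p (s n) + padic_abs p (t n)) \<longlonglongrightarrow> 0" by simp
  hence "(\<lambda>n. padic_abs p (s n + t n)) \<longlonglongrightarrow> 0"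
    by (rule tendsto_sandwich[OF _ _ tendsto_const, rotated 2])
       (auto simp: padic_abs_add_le[OF p])
  thus ?thesis by (simp add: padic_null_def)
qed

lemma padic_null_mult:
  assumes p: "prime p" and s: "padic_cauchy p s" and t: "t \<in> padic_null p"
  shows "(\<lambda>n. s n * t n) \<in> padic_null p"
proof -
  obtain C where C: "C > 0" "\<And>n. padic_abs p (s n) \<le> C"
    using padic_cauchy_bounded[OF p s] by blast
  have "(\<lambda>n. C * padic_abs p (t n)) \<longlonglongrightarrow> C * 0"
    using t unfolding padic_null_def by (intro tendsto_mult) auto
  hence "(\<lambda>n. C * padic_abs p (t n)) \<longlonglongrightarrow> 0" by simp
  hence "(\<lambda>n. padic_abs p (s n * t n)) \<longlonglongrightarrow> 0"
    by (rule tendsto_sandwich[OF _ _ tendsto_const, rotated 2])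
       (auto simp: padic_abs_mult[OF p] intro!: always_eventually mult_right_mono C)
  thus ?thesis by (simp add: padic_null_def)
qed

lemma padic_null_ideal:
  assumes p: "prime p"
  shows "ideal (padic_null p) (padic_cauchy_ring p)"
proof -
  interpret R: cring "padic_cauchy_ring p" by (rule padic_cauchy_ring_cring[OF p])
  have minus: "\<ominus>\<^bsub>padic_cauchy_ring p\<^esub> s = (\<lambda>n. - s n)" if "padic_cauchy p s" for s
    using that padic_cauchy_minus[OF that]
    by (intro R.minus_equality) (auto simp: padic_cauchy_ring_def)
  show ?thesis
  proof (rule idealI)
    show "ring (padic_cauchy_ring p)" by (rule R.ring_axioms)
    show "subgroup (padic_null p) (add_monoid (padic_cauchy_ring p))"
    proof (rule R.add.subgroupI)
      show "padic_null p \<subseteq> carrier (padic_cauchy_ring p)"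
        using padic_null_cauchy[OF p] by (auto simp: padic_cauchy_ring_def)
      show "padic_null p \<noteq> {}"
        by (auto simp: padic_null_def intro!: exI[of _ "\<lambda>_. 0"])
      show "\<ominus>\<^bsub>padic_cauchy_ring p\<^esub> a \<in> padic_null p" if "a \<in> padic_null p" for a
        using that minus[OF padic_null_cauchy[OF p that]] by (simp add: padic_null_def)
      show "a \<oplus>\<^bsub>padic_cauchy_ring p\<^esub> b \<in> padic_null p"
        if "a \<in> padic_null p" "b \<in> padic_null p" for a b
        using padic_null_add[OF p that] by (simp add: padic_cauchy_ring_def)
    qed
    show "x \<otimes>\<^bsub>padic_cauchy_ring p\<^esub> a \<in> padic_null p"
      if "a \<in> padic_null p" "x \<in> carrier (padic_cauchy_ring p)" for a x
      using that padic_null_mult[OF p] by (auto simp: padic_cauchy_ring_def)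
    show "a \<otimes>\<^bsub>padic_cauchy_ring p\<^esub> x \<in> padic_null p"
      if "a \<in> padic_null p" "x \<in> carrier (padic_cauchy_ring p)" for a x
      using that padic_null_mult[OF p, of x a] by (auto simp: padic_cauchy_ring_def mult.commute)
  qed
qed

lemma padic_field_cring: "prime p \<Longrightarrow> cring (padic_field p)"
  unfolding padic_field_def
  by (rule ideal.quotient_is_cring[OF padic_null_ideal padic_cauchy_ring_cring])

abbreviation padic_class :: "nat \<Rightarrow> (nat \<Rightarrow> rat) \<Rightarrow> (nat \<Rightarrow> rat) set" where
  "padic_class p s \<equiv> padic_null p +>\<^bsub>padic_cauchy_ring p\<^esub> s"

lemma padic_field_carrier:
  "carrier (padic_field p) = padic_class p ` {s. padic_cauchy p s}"
proof -
  have "carrier (padic_cauchy_ring p) = {s. padic_cauchy p s}"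
    by (simp add: padic_cauchy_ring_def)
  thus ?thesis by (auto simp: padic_field_def FactRing_def A_RCOSETS_def')
qed

lemma padic_field_simps:
  assumes p: "prime p" and "padic_cauchy p s" "padic_cauchy p t"
  shows "padic_class p s \<oplus>\<^bsub>padic_field p\<^esub> padic_class p t = padic_class p (\<lambda>n. s n + t n)"
    and "padic_class p s \<otimes>\<^bsub>padic_field p\<^esub> padic_class p t = padic_class p (\<lambda>n. s n * t n)"
    and "\<one>\<^bsub>padic_field p\<^esub> = padic_class p (\<lambda>_. 1)"
    and "\<zero>\<^bsub>padic_field p\<^esub> = padic_class p (\<lambda>_. 0)"
proof -
  interpret ideal "padic_null p" "padic_cauchy_ring p" by (rule padic_null_ideal[OF p])
  have c: "s \<in> carrier (padic_cauchy_ring p)" "t \<in> carrier (padic_cauchy_ring p)"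
    using assms by (auto simp: padic_cauchy_ring_def)
  show "padic_class p s \<oplus>\<^bsub>padic_field p\<^esub> padic_class p t = padic_class p (\<lambda>n. s n + t n)"
    using a_rcos_sum[OF c] by (simp add: padic_field_def FactRing_def padic_cauchy_ring_def)
  show "padic_class p s \<otimes>\<^bsub>padic_field p\<^esub> padic_class p t = padic_class p (\<lambda>n. s n * t n)"
    using rcoset_mult_add[OF c] by (simp add: padic_field_def FactRing_def padic_cauchy_ring_def)
  show "\<one>\<^bsub>padic_field p\<^esub> = padic_class p (\<lambda>_. 1)"
    by (simp add: padic_field_def FactRing_def padic_cauchy_ring_def)
  have "padic_class p \<zero>\<^bsub>padic_cauchy_ring p\<^esub> = padic_null p"
    by (rule a_rcos_zero[OF is_ideal]) simp
  thus "\<zero>\<^bsub>padic_field p\<^esub> = padic_class p (\<lambda>_. 0)"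
    by (simp add: padic_field_def FactRing_def padic_cauchy_ring_def)
qed

lemma padic_integers_iff:
  assumes p: "prime p"
  shows "x \<in> padic_integers p \<longleftrightarrow>
    (\<exists>s. padic_cauchy p s \<and> (\<forall>n. padic_abs p (s n) \<le> 1) \<and> x = padic_class p s)"
proof -
  interpret ideal "padic_null p" "padic_cauchy_ring p" by (rule padic_null_ideal[OF p])
  have self: "s \<in> padic_class p s" if "padic_cauchy p s" for s
    using a_rcos_self that by (simp add: padic_cauchy_ring_def)
  have rep: "padic_cauchy p t \<and> padic_class p s = padic_class p t"
    if "padic_cauchy p s" "t \<in> padic_class p s" for s t
  proof -
    have s: "s \<in> carrier (padic_cauchy_ring p)" using that by (simp add: padic_cauchy_ring_def)
    show ?thesis
      using a_repr_independence'[OF that(2) s] a_elemrcos_carrier[OF s that(2)]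
      by (auto simp: padic_cauchy_ring_def[THEN arg_cong[of _ _ carrier]])
  qed
  show ?thesis
    unfolding padic_integers_def padic_field_carrier using self rep by blast
qed

lemma padic_integers_closed:
  assumes p: "prime p"
  shows "\<one>\<^bsub>padic_field p\<^esub> \<in> padic_integers p" "\<zero>\<^bsub>padic_field p\<^esub> \<in> padic_integers p"
    and "x \<in> padic_integers p \<Longrightarrow> y \<in> padic_integers p \<Longrightarrow> x \<oplus>\<^bsub>padic_field p\<^esub> y \<in> padic_integers p"
    and "x \<in> padic_integers p \<Longrightarrow> y \<in> padic_integers p \<Longrightarrow> x \<otimes>\<^bsub>padic_field p\<^esub> y \<in> padic_integers p"
    and "x \<in> padic_integers p \<Longrightarrow> \<ominus>\<^bsub>padic_field p\<^esub> x \<in> padic_integers p"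
proof -
  interpret Q: cring "padic_field p" by (rule padic_field_cring[OF p])
  note simps = padic_field_simps[OF p]
  note const = padic_cauchy_const
  show "\<one>\<^bsub>padic_field p\<^esub> \<in> padic_integers p"
    unfolding padic_integers_iff[OF p] simps(3)[OF const const]
    by (intro exI[of _ "\<lambda>_. 1"]) simp
  show "\<zero>\<^bsub>padic_field p\<^esub> \<in> padic_integers p"
    unfolding padic_integers_iff[OF p] simps(4)[OF const const]
    by (intro exI[of _ "\<lambda>_. 0"]) simp
  show "x \<oplus>\<^bsub>padic_field p\<^esub> y \<in> padic_integers p"
    if "x \<in> padic_integers p" "y \<in> padic_integers p"
  proof -
    from that obtain s t where st: "padic_cauchy p s" "padic_cauchy p t"
      "\<And>n. padic_abs p (s n) \<le> 1" "\<And>n. padic_abs p (t n) \<le> 1"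
      "x = padic_class p s" "y = padic_class p t"
      unfolding padic_integers_iff[OF p] by blast
    have "padic_abs p (s n + t n) \<le> 1" for n
      using padic_abs_add[OF p, of "s n" "t n"] st(3)[of n] st(4)[of n] by linarith
    thus ?thesis
      unfolding padic_integers_iff[OF p] st(5,6) simps(1)[OF st(1,2)]
      using padic_cauchy_add[OF p st(1,2)] by blast
  qed
  show "x \<otimes>\<^bsub>padic_field p\<^esub> y \<in> padic_integers p"
    if "x \<in> padic_integers p" "y \<in> padic_integers p"
  proof -
    from that obtain s t where st: "padic_cauchy p s" "padic_cauchy p t"
      "\<And>n. padic_abs p (s n) \<le> 1" "\<And>n. padic_abs p (t n) \<le> 1"
      "x = padic_class p s" "y = padic_class p t"
      unfolding padic_integers_iff[OF p] by blast
    have "padic_abs p (s n * t n) \<le> 1" for n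
      using st(3)[of n] st(4)[of n] by (simp add: padic_abs_mult[OF p] mult_le_one)
    thus ?thesis
      unfolding padic_integers_iff[OF p] st(5,6) simps(2)[OF st(1,2)]
      using padic_cauchy_mult[OF p st(1,2)] by blast
  qed
  show "\<ominus>\<^bsub>padic_field p\<^esub> x \<in> padic_integers p" if "x \<in> padic_integers p"
  proof -
    from that obtain s where s: "padic_cauchy p s"
      "\<And>n. padic_abs p (s n) \<le> 1" "x = padic_class p s"
      unfolding padic_integers_iff[OF p] by blast
    have m: "padic_cauchy p (\<lambda>n. - s n)" by (rule padic_cauchy_minus[OF s(1)])
    have "\<ominus>\<^bsub>padic_field p\<^esub> x = padic_class p (\<lambda>n. - s n)"
    proof (rule Q.minus_equality)
      show "padic_class p (\<lambda>n. - s n) \<oplus>\<^bsub>padic_field p\<^esub> x = \<zero>\<^bsub>padic_field p\<^esub>"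
        unfolding s(3) simps(1)[OF m s(1)] simps(4)[OF const const] by simp
    qed (use s(1,3) m in \<open>auto simp: padic_field_carrier\<close>)
    thus ?thesis
      unfolding padic_integers_iff[OF p] using m s(2) by (intro exI[of _ "\<lambda>n. - s n"]) auto
  qed
qed


section \<open>The adele ring of the rationals\<close>

typedef finite_adele =
  "{x \<in> (\<Pi>\<^sub>E p\<in>{p. prime p}. carrier (padic_field p)). finite {p. prime p \<and> x p \<notin> padic_integers p}}"
  morphisms local_component Abs_finite_adele
proof
  show "(\<lambda>p\<in>{p. prime p}. \<zero>\<^bsub>padic_field p\<^esub>) \<in>
    {x \<in> (\<Pi>\<^sub>E p\<in>{p. prime p}. carrier (padic_field p)). finite {p. prime p \<and> x p \<notin> padic_integers p}}"
  proof -
    have "{p. prime p \<and> (\<lambda>p\<in>{p. prime p}. \<zero>\<^bsub>padic_field p\<^esub>) p \<notin> padic_integers p} = {}"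
      using padic_integers_closed(2) by auto
    moreover have "\<zero>\<^bsub>padic_field p\<^esub> \<in> carrier (padic_field p)" if "prime p" for p
      using padic_integers_closed(2)[OF that] by (simp add: padic_integers_def)
    ultimately show ?thesis by (simp only: mem_Collect_eq) simp
  qed
qed

lemma local_component_carrier: "prime p \<Longrightarrow> local_component x p \<in> carrier (padic_field p)"
  using local_component[of x] by auto

lemma local_component_integral:
  "finite {p. prime p \<and> local_component x p \<notin> padic_integers p}"
  using local_component[of x] by auto

lemma finite_adele_eqI:
  "(\<And>p. prime p \<Longrightarrow> local_component x p = local_component y p) \<Longrightarrow> x = y"
  using local_component[of x] local_component[of y]
  by (intro local_component_inject[THEN iffD1] PiE_ext[of _ "{p. prime p}"]) auto

lemma local_component_Abs:
  assumes "prime p" and "\<And>p. prime p \<Longrightarrow> x p \<in> carrier (padic_field p)"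
    and "finite {p. prime p \<and> x p \<notin> padic_integers p}"
  shows "local_component (Abs_finite_adele (\<lambda>p\<in>{p. prime p}. x p)) p = x p"
proof -
  have "{p. prime p \<and> (\<lambda>p\<in>{p. prime p}. x p) p \<notin> padic_integers p}
      = {p. prime p \<and> x p \<notin> padic_integers p}"
    by auto
  thus ?thesis using assms by (subst Abs_finite_adele_inverse) auto
qed

instantiation finite_adele :: comm_ring_1
begin

definition zero_finite_adele :: finite_adele where
  "0 = Abs_finite_adele (\<lambda>p\<in>{p. prime p}. \<zero>\<^bsub>padic_field p\<^esub>)"

definition one_finite_adele :: finite_adele where
  "1 = Abs_finite_adele (\<lambda>p\<in>{p. prime p}. \<one>\<^bsub>padic_field p\<^esub>)"

definition plus_finite_adele :: "finite_adele \<Rightarrow> finite_adele \<Rightarrow> finite_adele" where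
  "x + y = Abs_finite_adele
     (\<lambda>p\<in>{p. prime p}. local_component x p \<oplus>\<^bsub>padic_field p\<^esub> local_component y p)"

definition times_finite_adele :: "finite_adele \<Rightarrow> finite_adele \<Rightarrow> finite_adele" where
  "x * y = Abs_finite_adele
     (\<lambda>p\<in>{p. prime p}. local_component x p \<otimes>\<^bsub>padic_field p\<^esub> local_component y p)"

definition uminus_finite_adele :: "finite_adele \<Rightarrow> finite_adele" where
  "- x = Abs_finite_adele (\<lambda>p\<in>{p. prime p}. \<ominus>\<^bsub>padic_field p\<^esub> local_component x p)"

definition minus_finite_adele :: "finite_adele \<Rightarrow> finite_adele \<Rightarrow> finite_adele" where
  "x - y = x + - (y :: finite_adele)"

lemma local_component_simps [simp]:
  assumes p: "prime p"
  shows "local_component 0 p = \<zero>\<^bsub>padic_field p\<^esub>"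
    and "local_component 1 p = \<one>\<^bsub>padic_field p\<^esub>"
    and "local_component (x + y) p = local_component x p \<oplus>\<^bsub>padic_field p\<^esub> local_component y p"
    and "local_component (x * y) p = local_component x p \<otimes>\<^bsub>padic_field p\<^esub> local_component y p"
    and "local_component (- x) p = \<ominus>\<^bsub>padic_field p\<^esub> local_component x p"
proof -
  note cr = padic_field_cring and lc = local_component_carrier
  let ?bad = "\<lambda>x. {p. prime p \<and> local_component x p \<notin> padic_integers p}"
  have fin: "finite (?bad x \<union> ?bad y)" by (simp add: local_component_integral)
  show "local_component 0 p = \<zero>\<^bsub>padic_field p\<^esub>"
    unfolding zero_finite_adele_def using padic_integers_closed(2)
    by (intro local_component_Abs p) (auto simp: padic_integers_def cong: conj_cong)
  show "local_component 1 p = \<one>\<^bsub>padic_field p\<^esub>"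
    unfolding one_finite_adele_def using padic_integers_closed(1)
    by (intro local_component_Abs p) (auto simp: padic_integers_def cong: conj_cong)
  show "local_component (x + y) p = local_component x p \<oplus>\<^bsub>padic_field p\<^esub> local_component y p"
    unfolding plus_finite_adele_def
  proof (intro local_component_Abs p)
    show "finite {p. prime p \<and>
        local_component x p \<oplus>\<^bsub>padic_field p\<^esub> local_component y p \<notin> padic_integers p}"
      by (rule finite_subset[OF _ fin]) (auto dest: padic_integers_closed(3))
  next
    fix q :: nat assume q: "prime q"
    interpret cring "padic_field q" by (rule cr[OF q])
    show "local_component x q \<oplus>\<^bsub>padic_field q\<^esub> local_component y q \<in> carrier (padic_field q)"
      using lc[OF q] by simp
  qed
  show "local_component (x * y) p = local_component x p \<otimes>\<^bsub>padic_field p\<^esub> local_component y p"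
    unfolding times_finite_adele_def
  proof (intro local_component_Abs p)
    show "finite {p. prime p \<and>
        local_component x p \<otimes>\<^bsub>padic_field p\<^esub> local_component y p \<notin> padic_integers p}"
      by (rule finite_subset[OF _ fin]) (auto dest: padic_integers_closed(4))
  next
    fix q :: nat assume q: "prime q"
    interpret cring "padic_field q" by (rule cr[OF q])
    show "local_component x q \<otimes>\<^bsub>padic_field q\<^esub> local_component y q \<in> carrier (padic_field q)"
      using lc[OF q] by simp
  qed
  show "local_component (- x) p = \<ominus>\<^bsub>padic_field p\<^esub> local_component x p"
    unfolding uminus_finite_adele_def
  proof (intro local_component_Abs p)
    show "finite {p. prime p \<and> \<ominus>\<^bsub>padic_field p\<^esub> local_component x p \<notin> padic_integers p}"
      by (rule finite_subset[OF _ fin]) (auto dest: padic_integers_closed(5))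
  next
    fix q :: nat assume q: "prime q"
    interpret cring "padic_field q" by (rule cr[OF q])
    show "\<ominus>\<^bsub>padic_field q\<^esub> local_component x q \<in> carrier (padic_field q)"
      using lc[OF q] by simp
  qed
qed

instance
proof
  fix x y z :: finite_adele
  have c: "cring (padic_field p)" if "prime p" for p using padic_field_cring[OF that] .
  note lc = local_component_carrier
  show "x * y * z = x * (y * z)"
  proof (rule finite_adele_eqI)
    fix p :: nat assume p: "prime p"
    interpret cring "padic_field p" by (rule c[OF p])
    show "local_component (x * y * z) p = local_component (x * (y * z)) p"
      using p lc[OF p] by (simp add: m_assoc)
  qed
  show "x * y = y * x"
  proof (rule finite_adele_eqI)
    fix p :: nat assume p: "prime p"
    interpret cring "padic_field p" by (rule c[OF p])
    show "local_component (x * y) p = local_component (y * x) p"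
      using p lc[OF p] by (simp add: m_comm)
  qed
  show "1 * x = x"
  proof (rule finite_adele_eqI)
    fix p :: nat assume p: "prime p"
    interpret cring "padic_field p" by (rule c[OF p])
    show "local_component (1 * x) p = local_component x p"
      using p lc[OF p] by simp
  qed
  show "x + y + z = x + (y + z)"
  proof (rule finite_adele_eqI)
    fix p :: nat assume p: "prime p"
    interpret cring "padic_field p" by (rule c[OF p])
    show "local_component (x + y + z) p = local_component (x + (y + z)) p"
      using p lc[OF p] by (simp add: a_assoc)
  qed
  show "x + y = y + x"
  proof (rule finite_adele_eqI)
    fix p :: nat assume p: "prime p"
    interpret cring "padic_field p" by (rule c[OF p])
    show "local_component (x + y) p = local_component (y + x) p"
      using p lc[OF p] by (simp add: a_comm)
  qed
  show "0 + x = x"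
  proof (rule finite_adele_eqI)
    fix p :: nat assume p: "prime p"
    interpret cring "padic_field p" by (rule c[OF p])
    show "local_component (0 + x) p = local_component x p"
      using p lc[OF p] by simp
  qed
  show "- x + x = 0"
  proof (rule finite_adele_eqI)
    fix p :: nat assume p: "prime p"
    interpret cring "padic_field p" by (rule c[OF p])
    show "local_component (- x + x) p = local_component 0 p"
      using p lc[OF p] by (simp add: l_neg)
  qed
  show "x - y = x + - y"
    by (rule minus_finite_adele_def)
  show "(x + y) * z = x * z + y * z"
  proof (rule finite_adele_eqI)
    fix p :: nat assume p: "prime p"
    interpret cring "padic_field p" by (rule c[OF p])
    show "local_component ((x + y) * z) p = local_component (x * z + y * z) p"
      using p lc[OF p] by (simp add: l_distr)
  qed
  show "(0 :: finite_adele) \<noteq> 1"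
  proof
    assume eq: "(0 :: finite_adele) = 1"
    have p: "prime (2 :: nat)" by simp
    interpret ideal "padic_null 2" "padic_cauchy_ring 2" by (rule padic_null_ideal[OF p])
    have c1: "(\<lambda>_. 1) \<in> carrier (padic_cauchy_ring 2)" by (simp add: padic_cauchy_ring_def)
    have "\<zero>\<^bsub>padic_field 2\<^esub> = \<one>\<^bsub>padic_field 2\<^esub>"
      using arg_cong[OF eq, of "\<lambda>x. local_component x 2"] p by simp
    hence "padic_null 2 = padic_class 2 (\<lambda>_. 1)"
      by (simp add: padic_field_def FactRing_def padic_cauchy_ring_def)
    hence "(\<lambda>_. 1) \<in> padic_null 2" using a_rcos_self[OF c1] by simp
    hence "(\<lambda>n :: nat. 1 :: real) \<longlonglongrightarrow> 0" by (simp add: padic_null_def)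
    thus False using LIMSEQ_unique[OF tendsto_const] by force
  qed
qed

end

definition Zhat :: "finite_adele set" where
  "Zhat = {x. \<forall>p. prime p \<longrightarrow> local_component x p \<in> padic_integers p}"

definition finite_adele_of_rat :: "rat \<Rightarrow> finite_adele" where
  "finite_adele_of_rat q = Abs_finite_adele (\<lambda>p\<in>{p. prime p}. padic_of_rat p q)"

datatype adele = Adele (infinite_part: real) (finite_part: finite_adele)

instantiation adele :: comm_ring_1
begin

definition zero_adele :: adele where "0 = Adele 0 0"
definition one_adele :: adele where "1 = Adele 1 1"
definition plus_adele :: "adele \<Rightarrow> adele \<Rightarrow> adele" where
  "x + y = Adele (infinite_part x + infinite_part y) (finite_part x + finite_part y)"
definition times_adele :: "adele \<Rightarrow> adele \<Rightarrow> adele" where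
  "x * y = Adele (infinite_part x * infinite_part y) (finite_part x * finite_part y)"
definition uminus_adele :: "adele \<Rightarrow> adele" where
  "- x = Adele (- infinite_part x) (- finite_part x)"
definition minus_adele :: "adele \<Rightarrow> adele \<Rightarrow> adele" where
  "x - y = Adele (infinite_part x - infinite_part y) (finite_part x - finite_part y)"

instance
  by standard
    (auto simp: zero_adele_def one_adele_def plus_adele_def times_adele_def uminus_adele_def
      minus_adele_def algebra_simps)

end

definition adele_of_rat :: "rat \<Rightarrow> adele" where
  "adele_of_rat q = Adele (of_rat q) (finite_adele_of_rat q)"


section \<open>The groups\<close>

definition mat2 :: "'a \<Rightarrow> 'a \<Rightarrow> 'a \<Rightarrow> 'a \<Rightarrow> 'a::zero^2^2" where
  "mat2 a b c d = vector [vector [a, b], vector [c, d]]"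

text \<open>\<open>GL2_sq\<close> is \<open>G(R)\<close>. For \<open>R\<close> the adele ring, \<open>GL2_sq\<close> and \<open>calG\<close> are the restricted products
  of the local groups with respect to their \<open>\<int>\<^sub>p\<close>-points.\<close>

definition GL2_sq :: "('a::comm_ring_1^2^2) set" where
  "GL2_sq = {g. invertible g \<and> (\<exists>r. r dvd 1 \<and> det g = r\<^sup>2)}"

definition calG :: "(('a::comm_ring_1^2^2) \<times> 'a) set" where
  "calG = {(g, r). invertible g \<and> r dvd 1 \<and> det g = r\<^sup>2}"

definition pair_mult ::
    "(('a::comm_ring_1^2^2) \<times> 'a) \<Rightarrow> (('a^2^2) \<times> 'a) \<Rightarrow> (('a^2^2) \<times> 'a)" where
  "pair_mult x y = (fst x ** fst y, snd x * snd y)"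

definition GL2_real_pos :: "(real^2^2) set" where
  "GL2_real_pos = {g. det g > 0}"

definition SL2Z :: "(int^2^2) monoid" where
  "SL2Z = \<lparr>carrier = {\<gamma>. det \<gamma> = 1}, mult = (**), one = mat 1\<rparr>"

definition Gamma0 :: "nat \<Rightarrow> (int^2^2) set" where
  "Gamma0 N = {\<gamma> \<in> carrier SL2Z. int N dvd \<gamma> $ 2 $ 1}"

definition GL2_Zhat :: "(finite_adele^2^2) set" where
  "GL2_Zhat = {k. (\<forall>i j. k $ i $ j \<in> Zhat) \<and>
     (\<exists>l. (\<forall>i j. l $ i $ j \<in> Zhat) \<and> k ** l = mat 1 \<and> l ** k = mat 1)}"

definition Zhat_units :: "finite_adele set" where
  "Zhat_units = {u \<in> Zhat. \<exists>v\<in>Zhat. u * v = 1}"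

definition calK :: "((finite_adele^2^2) \<times> finite_adele) monoid" where
  "calK = \<lparr>carrier = {(k, t). k \<in> GL2_Zhat \<and> t \<in> Zhat_units \<and> det k = t\<^sup>2},
           mult = pair_mult, one = (mat 1, 1)\<rparr>"

text \<open>Congruences in \<open>Zhat\<close> modulo \<open>N Zhat\<close> only concern the components at
  the primes \<open>p\<close> dividing \<open>N\<close>, since \<open>N\<close> is a unit of \<open>\<int>\<^sub>p\<close> at all other \<open>p\<close>.\<close>

definition K0 :: "nat \<Rightarrow> (finite_adele^2^2) set" where
  "K0 N = {k \<in> GL2_Zhat. \<exists>w\<in>Zhat. k $ 2 $ 1 = of_nat N * w}"

definition calK0 :: "nat \<Rightarrow> ((finite_adele^2^2) \<times> finite_adele) set" where
  "calK0 N = {(k, t) \<in> carrier calK. k \<in> K0 N}"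

definition Zhat_mod :: "nat \<Rightarrow> finite_adele \<Rightarrow> int" where
  "Zhat_mod N u = (THE a. 0 \<le> a \<and> a < int N \<and> (\<exists>w\<in>Zhat. u - of_int a = of_nat N * w))"

text \<open>The residue class in \<open>Q(N)\<close> is represented by its entries in \<open>{0..<N}\<close>.\<close>

definition sigma_N :: "nat \<Rightarrow> ((finite_adele^2^2) \<times> finite_adele) \<Rightarrow> ((int^2^2) \<times> int)" where
  "sigma_N N x = ((\<chi> i j. Zhat_mod N (fst x $ i $ j)), Zhat_mod N (snd x))"

definition adele_matrix :: "real^2^2 \<Rightarrow> finite_adele^2^2 \<Rightarrow> adele^2^2" where
  "adele_matrix g k = (\<chi> i j. Adele (g $ i $ j) (k $ i $ j))"

definition adele_matrix_of_rat :: "rat^2^2 \<Rightarrow> adele^2^2" where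
  "adele_matrix_of_rat g = (\<chi> i j. adele_of_rat (g $ i $ j))"

definition calG_of_rat :: "((rat^2^2) \<times> rat) \<Rightarrow> ((adele^2^2) \<times> adele)" where
  "calG_of_rat x = (adele_matrix_of_rat (fst x), adele_of_rat (snd x))"

text \<open>\<open>g \<times> k\<close> for \<open>g \<in> GL\<^sub>2(\<real>)\<^sup>+\<close>, embedded in \<open>calG(\<real>)\<close> by \<open>g \<mapsto> (g, sqrt (det g))\<close>.\<close>

definition calG_inf_fin :: "real^2^2 \<Rightarrow> ((finite_adele^2^2) \<times> finite_adele) \<Rightarrow> ((adele^2^2) \<times> adele)" where
  "calG_inf_fin g x = (adele_matrix g (fst x), Adele (sqrt (det g)) (snd x))"


section \<open>Lattices and the Weil representation\<close>

definition is_lattice :: "'v::real_vector set \<Rightarrow> bool" where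
  "is_lattice L \<longleftrightarrow> (\<exists>E. finite E \<and> independent E \<and>
     L = {\<Sum>b\<in>E. real_of_int (c b) *\<^sub>R b | c :: 'v \<Rightarrow> int. True})"

definition even_lattice :: "'v::real_vector set \<Rightarrow> ('v \<Rightarrow> 'v \<Rightarrow> real) \<Rightarrow> bool" where
  "even_lattice L B \<longleftrightarrow> is_lattice L \<and> bilinear B \<and> (\<forall>x y. B x y = B y x) \<and>
     (\<forall>x\<in>L. \<forall>y\<in>L. B x y \<in> \<int>) \<and> (\<forall>x\<in>L. B x x / 2 \<in> \<int>) \<and>
     (\<forall>x\<in>span L. (\<forall>y\<in>span L. B x y = 0) \<longrightarrow> x = 0)"

text \<open>\<open>pos_index\<close> is \<open>b\<^sup>+\<close>; applied to \<open>-B\<close> it is \<open>b\<^sup>-\<close>.\<close>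

definition pos_index :: "'v::real_vector set \<Rightarrow> ('v \<Rightarrow> 'v \<Rightarrow> real) \<Rightarrow> nat" where
  "pos_index L B = Max {dim V | V. subspace V \<and> V \<subseteq> span L \<and> (\<forall>x\<in>V - {0}. B x x > 0)}"

definition lattice_sig :: "'v::real_vector set \<Rightarrow> ('v \<Rightarrow> 'v \<Rightarrow> real) \<Rightarrow> int" where
  "lattice_sig L B = int (pos_index L B) - int (pos_index L (\<lambda>x y. - B x y))"

definition dual_lattice :: "'v::real_vector set \<Rightarrow> ('v \<Rightarrow> 'v \<Rightarrow> real) \<Rightarrow> 'v set" where
  "dual_lattice L B = {x \<in> span L. \<forall>y\<in>L. B x y \<in> \<int>}"

text \<open>\<open>D = L'/L\<close> as a set of cosets; its zero element is \<open>L\<close>.\<close>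

definition disc :: "'v::real_vector set \<Rightarrow> ('v \<Rightarrow> 'v \<Rightarrow> real) \<Rightarrow> 'v set set" where
  "disc L B = {{x + l | l. l \<in> L} | x. x \<in> dual_lattice L B}"

definition level :: "'v::real_vector set \<Rightarrow> ('v \<Rightarrow> 'v \<Rightarrow> real) \<Rightarrow> nat" where
  "level L B = (LEAST n. n > 0 \<and> (\<forall>x\<in>dual_lattice L B. real n * (B x x / 2) \<in> \<int>))"

text \<open>The \<open>\<rat>/\<int>\<close>-valued forms on \<open>D\<close> are evaluated on representatives; they occur below
  only inside \<open>e2pi\<close>, so that the choice of representatives is immaterial.\<close>

definition disc_form :: "('v \<Rightarrow> 'v \<Rightarrow> real) \<Rightarrow> 'v set \<Rightarrow> 'v set \<Rightarrow> real" where
  "disc_form B \<mu> \<nu> = B (SOME x. x \<in> \<mu>) (SOME y. y \<in> \<nu>)"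

definition disc_q :: "('v \<Rightarrow> 'v \<Rightarrow> real) \<Rightarrow> 'v set \<Rightarrow> real" where
  "disc_q B \<mu> = disc_form B \<mu> \<mu> / 2"

definition e2pi :: "real \<Rightarrow> complex" where
  "e2pi x = exp (2 * of_real pi * \<i> * of_real x)"

text \<open>\<open>\<complex>[D]\<close>, identified with \<open>S\<^sub>L\<close> through \<open>\<phi>\<^sub>\<mu> \<leftrightarrow> \<e>\<^sub>\<mu>\<close>.\<close>

definition group_algebra :: "'v::real_vector set \<Rightarrow> ('v \<Rightarrow> 'v \<Rightarrow> real) \<Rightarrow> ('v set \<Rightarrow> complex) set" where
  "group_algebra L B = {u. \<forall>\<mu>. \<mu> \<notin> disc L B \<longrightarrow> u \<mu> = 0}"

definition basis_vec :: "'v set \<Rightarrow> 'v set \<Rightarrow> complex" where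
  "basis_vec \<mu> = (\<lambda>\<nu>. if \<nu> = \<mu> then 1 else 0)"

definition herm :: "'v::real_vector set \<Rightarrow> ('v \<Rightarrow> 'v \<Rightarrow> real)
    \<Rightarrow> ('v set \<Rightarrow> complex) \<Rightarrow> ('v set \<Rightarrow> complex) \<Rightarrow> complex" where
  "herm L B u v = (\<Sum>\<mu>\<in>disc L B. u \<mu> * cnj (v \<mu>))"

text \<open>\<open>\<rho>\<close> is the Weil representation of \<open>\<Gamma>\<close> on \<open>\<complex>[D]\<close>: the unitary representation with the
  given values on the two generators of \<open>\<Gamma>\<close>, which factors through \<open>SL\<^sub>2(\<int>/N\<int>)\<close>.\<close>

definition weil_representation :: "'v::real_vector set \<Rightarrow> ('v \<Rightarrow> 'v \<Rightarrow> real)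
    \<Rightarrow> (int^2^2 \<Rightarrow> ('v set \<Rightarrow> complex) \<Rightarrow> ('v set \<Rightarrow> complex)) \<Rightarrow> bool" where
  "weil_representation L B \<rho> \<longleftrightarrow>
     (\<forall>\<gamma>\<in>carrier SL2Z. \<forall>u\<in>group_algebra L B. \<rho> \<gamma> u \<in> group_algebra L B) \<and>
     (\<forall>\<gamma>\<in>carrier SL2Z. \<forall>u\<in>group_algebra L B. \<forall>v\<in>group_algebra L B. \<forall>a b.
        \<rho> \<gamma> (\<lambda>\<mu>. a * u \<mu> + b * v \<mu>) = (\<lambda>\<mu>. a * \<rho> \<gamma> u \<mu> + b * \<rho> \<gamma> v \<mu>)) \<and>
     (\<forall>u\<in>group_algebra L B. \<rho> (mat 1) u = u) \<and>
     (\<forall>\<gamma>\<in>carrier SL2Z. \<forall>\<delta>\<in>carrier SL2Z. \<forall>u\<in>group_algebra L B. \<rho> (\<gamma> ** \<delta>) u = \<rho> \<gamma> (\<rho> \<delta> u)) \<and>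
     (\<forall>\<gamma>\<in>carrier SL2Z. \<forall>u\<in>group_algebra L B. \<forall>v\<in>group_algebra L B.
        herm L B (\<rho> \<gamma> u) (\<rho> \<gamma> v) = herm L B u v) \<and>
     (\<forall>\<nu>\<in>disc L B. \<rho> (mat2 1 1 0 1) (basis_vec \<nu>) = (\<lambda>\<mu>. e2pi (- disc_q B \<nu>) * basis_vec \<nu> \<mu>)) \<and>
     (\<forall>\<nu>\<in>disc L B. \<rho> (mat2 0 (- 1) 1 0) (basis_vec \<nu>) =
        (\<lambda>\<eta>. e2pi (of_int (lattice_sig L B) / 8) / of_real (sqrt (real (card (disc L B)))) *
              (\<Sum>\<mu>\<in>disc L B. e2pi (disc_form B \<nu> \<mu>) * basis_vec \<mu> \<eta>))) \<and>
     (\<forall>\<gamma>\<in>carrier SL2Z. \<forall>\<delta>\<in>carrier SL2Z.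
        (\<forall>i j. [\<gamma> $ i $ j = \<delta> $ i $ j] (mod int (level L B))) \<longrightarrow>
        (\<forall>u\<in>group_algebra L B. \<rho> \<gamma> u = \<rho> \<delta> u))"

definition gauss_sum :: "'v::real_vector set \<Rightarrow> ('v \<Rightarrow> 'v \<Rightarrow> real) \<Rightarrow> int \<Rightarrow> complex" where
  "gauss_sum L B r = (\<Sum>\<mu>\<in>disc L B. e2pi (of_int r * disc_q B \<mu>))"

text \<open>The extension to \<open>Q(N)\<close>; \<open>\<gamma>\<close> is a lift of \<open>r\<^sup>-\<^sup>1 A \<in> SL\<^sub>2(\<int>/N\<int>)\<close>
  to \<open>\<Gamma>\<close>, and the result does not depend on it.\<close>

definition weil_ext :: "'v::real_vector set \<Rightarrow> ('v \<Rightarrow> 'v \<Rightarrow> real)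
    \<Rightarrow> (int^2^2 \<Rightarrow> ('v set \<Rightarrow> complex) \<Rightarrow> ('v set \<Rightarrow> complex))
    \<Rightarrow> ((int^2^2) \<times> int) \<Rightarrow> ('v set \<Rightarrow> complex) \<Rightarrow> ('v set \<Rightarrow> complex)" where
  "weil_ext L B \<rho> = (\<lambda>(A, r) u \<mu>. gauss_sum L B 1 / gauss_sum L B r *
     \<rho> (SOME \<gamma>. \<gamma> \<in> carrier SL2Z \<and> (\<forall>i j. [r * \<gamma> $ i $ j = A $ i $ j] (mod int (level L B)))) u \<mu>)"

definition omega_f :: "'v::real_vector set \<Rightarrow> ('v \<Rightarrow> 'v \<Rightarrow> real)
    \<Rightarrow> (int^2^2 \<Rightarrow> ('v set \<Rightarrow> complex) \<Rightarrow> ('v set \<Rightarrow> complex))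
    \<Rightarrow> ((finite_adele^2^2) \<times> finite_adele) \<Rightarrow> ('v set \<Rightarrow> complex) \<Rightarrow> ('v set \<Rightarrow> complex)" where
  "omega_f L B \<rho> k = weil_ext L B \<rho> (sigma_N (level L B) k)"

definition jacobi :: "int \<Rightarrow> nat \<Rightarrow> int" where
  "jacobi a n = (\<Prod>p\<in>#prime_factorization n. Legendre a (int p))"

definition chi_D :: "'v::real_vector set \<Rightarrow> ('v \<Rightarrow> 'v \<Rightarrow> real) \<Rightarrow> int \<Rightarrow> complex" where
  "chi_D L B a = of_int (jacobi a (card (disc L B)))"

definition xi_D :: "'v::real_vector set \<Rightarrow> ('v \<Rightarrow> 'v \<Rightarrow> real) \<Rightarrow> finite_adele^2^2 \<Rightarrow> complex" where
  "xi_D L B k = chi_D L B (Zhat_mod (level L B) (k $ 2 $ 2))"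


section \<open>Cusp forms\<close>

definition upper_half_plane :: "complex set" where
  "upper_half_plane = {\<tau>. Im \<tau> > 0}"

definition j_factor :: "real^2^2 \<Rightarrow> complex \<Rightarrow> complex" where
  "j_factor A \<tau> = of_real (A $ 2 $ 1) * \<tau> + of_real (A $ 2 $ 2)"

definition moebius :: "real^2^2 \<Rightarrow> complex \<Rightarrow> complex" where
  "moebius A \<tau> = (of_real (A $ 1 $ 1) * \<tau> + of_real (A $ 1 $ 2)) / j_factor A \<tau>"

definition slash :: "int \<Rightarrow> (complex \<Rightarrow> complex) \<Rightarrow> real^2^2 \<Rightarrow> complex \<Rightarrow> complex" where
  "slash \<kappa> f A \<tau> = of_real (det A powr (of_int \<kappa> / 2)) * j_factor A \<tau> powi (- \<kappa>) * f (moebius A \<tau>)"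

definition real_matrix :: "int^2^2 \<Rightarrow> real^2^2" where
  "real_matrix \<gamma> = (\<chi> i j. of_int (\<gamma> $ i $ j))"

text \<open>The last condition is vanishing at all cusps: as \<open>f|\<^sub>\<kappa>\<gamma>\<close> is periodic, it says that
  only positive powers of \<open>q\<close> occur in its Fourier expansion. Values of \<open>f\<close> outside the upper
  half plane are irrelevant.\<close>

definition cusp_forms :: "int \<Rightarrow> nat \<Rightarrow> (int \<Rightarrow> complex) \<Rightarrow> (complex \<Rightarrow> complex) set" where
  "cusp_forms \<kappa> N \<psi> = {f. f holomorphic_on upper_half_plane \<and>
     (\<forall>\<gamma>\<in>Gamma0 N. \<forall>\<tau>\<in>upper_half_plane.
        slash \<kappa> f (real_matrix \<gamma>) \<tau> = \<psi> (\<gamma> $ 2 $ 2) * f \<tau>) \<and>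
     (\<forall>\<gamma>\<in>carrier SL2Z. (slash \<kappa> f (real_matrix \<gamma>) \<longlongrightarrow> 0) (filtercomap Im at_top))}"


section \<open>The four maps\<close>

text \<open>In the two sums the summand does not depend on the chosen representative of the coset,
  and in the two adelizations the value does not depend on the decomposition of \<open>g\<close>.\<close>

definition L_rho :: "'v::real_vector set \<Rightarrow> ('v \<Rightarrow> 'v \<Rightarrow> real)
    \<Rightarrow> (int^2^2 \<Rightarrow> ('v set \<Rightarrow> complex) \<Rightarrow> ('v set \<Rightarrow> complex)) \<Rightarrow> int
    \<Rightarrow> (complex \<Rightarrow> complex) \<Rightarrow> complex \<Rightarrow> ('v set \<Rightarrow> complex)" where
  "L_rho L B \<rho> \<kappa> f = (\<lambda>\<tau> \<mu>. \<Sum>C\<in>rcosets\<^bsub>SL2Z\<^esub> (Gamma0 (level L B)).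
     let \<gamma> = (SOME \<gamma>. \<gamma> \<in> C)
     in slash \<kappa> f (real_matrix \<gamma>) \<tau> * inv_into (group_algebra L B) (\<rho> \<gamma>) (basis_vec L) \<mu>)"

definition L_omega :: "'v::real_vector set \<Rightarrow> ('v \<Rightarrow> 'v \<Rightarrow> real)
    \<Rightarrow> (int^2^2 \<Rightarrow> ('v set \<Rightarrow> complex) \<Rightarrow> ('v set \<Rightarrow> complex))
    \<Rightarrow> (adele^2^2 \<Rightarrow> complex) \<Rightarrow> ((adele^2^2) \<times> adele) \<Rightarrow> ('v set \<Rightarrow> complex)" where
  "L_omega L B \<rho> F = (\<lambda>g\<in>calG. \<lambda>\<mu>. \<Sum>C\<in>lcosets\<^bsub>calK\<^esub> (calK0 (level L B)).
     let k = (SOME k. k \<in> C)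
     in F (fst (pair_mult g (calG_inf_fin (mat 1) k))) * omega_f L B \<rho> k (basis_vec L) \<mu>)"

definition A_xi :: "'v::real_vector set \<Rightarrow> ('v \<Rightarrow> 'v \<Rightarrow> real) \<Rightarrow> int
    \<Rightarrow> (complex \<Rightarrow> complex) \<Rightarrow> adele^2^2 \<Rightarrow> complex" where
  "A_xi L B \<kappa> f = (\<lambda>g\<in>GL2_sq. THE v. \<exists>q h k.
     invertible q \<and> h \<in> GL2_real_pos \<and> k \<in> K0 (level L B) \<and>
     g = adele_matrix_of_rat q ** adele_matrix h k \<and>
     v = xi_D L B k * of_real (det h powr (of_int \<kappa> / 2)) * j_factor h \<i> powi (- \<kappa>)
           * f (moebius h \<i>))"

definition A_omega :: "'v::real_vector set \<Rightarrow> ('v \<Rightarrow> 'v \<Rightarrow> real)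
    \<Rightarrow> (int^2^2 \<Rightarrow> ('v set \<Rightarrow> complex) \<Rightarrow> ('v set \<Rightarrow> complex)) \<Rightarrow> int
    \<Rightarrow> (complex \<Rightarrow> ('v set \<Rightarrow> complex)) \<Rightarrow> ((adele^2^2) \<times> adele) \<Rightarrow> ('v set \<Rightarrow> complex)" where
  "A_omega L B \<rho> \<kappa> f = (\<lambda>g\<in>calG. THE v. \<exists>q h k.
     q \<in> calG \<and> h \<in> GL2_real_pos \<and> k \<in> carrier calK \<and>
     g = pair_mult (calG_of_rat q) (calG_inf_fin h k) \<and>
     v = inv_into (group_algebra L B) (omega_f L B \<rho> k)
           (\<lambda>\<mu>. of_real (det h powr (of_int \<kappa> / 2)) * j_factor h \<i> powi (- \<kappa>)
                  * f (moebius h \<i>) \<mu>))"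

end

theory Submission
  imports Defs "HOL-Algebra.Sylow"
begin

text \<open>
  Evaluate both sides at \<open>g = q (h \<times> k\<^sub>0)\<close> with \<open>q \<in> \<G>(\<rat>)\<close>, \<open>h \<in> GL\<^sub>2(\<real>)\<^sup>+\<close>, \<open>k\<^sub>0 \<in> \<K>\<close>. The map
  \<open>\<Gamma>\<^sub>0(N)\<gamma> \<mapsto> k\<^sub>0\<^sup>-\<^sup>1 \<gamma>\<^sup>-\<^sup>1 \<K>\<^sub>0(N)\<close> is a bijection from \<open>\<Gamma>\<^sub>0(N)\<backslash>\<Gamma>\<close> to \<open>\<K>/\<K>\<^sub>0(N)\<close> (\<open>coset_bijection\<close>), and it matches
  the two sums term by term (\<open>L_omega_summand\<close>). Indeed for \<open>k = k\<^sub>0\<^sup>-\<^sup>1 \<gamma>\<^sup>-\<^sup>1 x\<close> with \<open>x \<in> \<K>\<^sub>0(N)\<close> one has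
  \<open>g k = q \<gamma>\<^sup>-\<^sup>1 (\<gamma> h \<times> x)\<close>, so the scalar adelic form at \<open>g k\<close> is \<open>\<xi>\<^sub>D(x)\<close> times the automorphy factor of
  \<open>h\<close> times \<open>(f|\<gamma>)(h i)\<close>, while \<open>\<omega>\<^sub>f(k) \<phi>\<^sub>0 = \<omega>\<^sub>f(k\<^sub>0)\<^sup>-\<^sup>1 \<rho>(\<gamma>)\<^sup>-\<^sup>1 \<omega>\<^sub>f(x) \<phi>\<^sub>0 = \<xi>\<^sub>D(x) \<omega>\<^sub>f(k\<^sub>0)\<^sup>-\<^sup>1 \<rho>(\<gamma>)\<^sup>-\<^sup>1 \<phi>\<^sub>0\<close>,
  and \<open>\<xi>\<^sub>D(x)\<^sup>2 = 1\<close>. As this holds for every decomposition of \<open>g\<close>, it also shows that the value of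
  the vector-valued adelization does not depend on the decomposition.

  Two facts carry this argument. The first is strong approximation (\<open>calG_strong_approximation\<close>)
  together with the surjectivity of \<open>\<Gamma> \<rightarrow> SL\<^sub>2(\<int>/N)\<close>. All that is used about \<open>\<A>\<^sub>f\<close> is that it is a ring
  containing \<open>\<rat>\<close> and \<open>Zhat\<close>, that \<open>\<rat> \<inter> Zhat = \<int>\<close>, that every element has a positive integer multiple
  in \<open>Zhat\<close>, and that \<open>\<int>\<close> surjects onto \<open>Zhat/p\<close> for every prime \<open>p\<close>; the decompositions of ideles and
  of \<open>GL\<^sub>2(\<A>\<^sub>f)\<close> follow by induction on an integer whose prime factors are removed one at a time.

  The second is that \<open>\<omega>\<^sub>f\<close> is a homomorphism for which \<open>\<K>\<^sub>0(N)\<close> acts on \<open>\<phi>\<^sub>0\<close> through \<open>\<xi>\<^sub>D\<close>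
  (\<open>omega_mult\<close>, \<open>omega_calK0\<close>). The words \<open>T\<^sup>r S T\<^sup>s S T\<^sup>r S\<close> with \<open>r s \<equiv> 1\<close> are diagonal modulo \<open>N\<close>; applying them
  to \<open>\<e>\<^sub>0\<close> shows that a matrix congruent to \<open>diag(r, s)\<close> multiplies \<open>\<e>\<^sub>0\<close> by \<open>g\<^sub>r(D)/g(D)\<close>. This quotient
  is therefore a character of \<open>(\<int>/N)\<^sup>\<times>\<close>, with values \<open>\<plusminus>1\<close>, and it remains to see that it is the Jacobi
  symbol \<open>\<chi>\<^sub>D\<close> (\<open>gauss_sum_quotient_eq_jacobi\<close>). Put \<open>d = g(D)\<^sup>2\<close>. Then \<open>d = \<plusminus>|D|\<close>, and \<open>d \<equiv> 1\<close> modulo 4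
  because the non-zero elements of \<open>D\<close> come in pairs \<open>\<plusminus>\<mu>\<close>. For an odd prime \<open>l\<close> prime to \<open>N\<close>
  the congruence \<open>g(D)\<^sup>l \<equiv> g\<^sub>l(D)\<close> modulo \<open>l\<close> gives \<open>d\<^sup>(\<^sup>l\<^sup>-\<^sup>1\<^sup>)\<^sup>/\<^sup>2 \<equiv> g\<^sub>l(D)/g(D)\<close>, so by Euler's criterion the quotient
  is the Legendre symbol \<open>(d/l)\<close>, which quadratic reciprocity turns into \<open>\<chi>\<^sub>D(l)\<close>. Congruences in
  \<open>\<int>[\<zeta>]\<close> between integers are turned into congruences in \<open>\<int>\<close> by taking traces
  (\<open>rational_cyclotomic_integer\<close>). That the discriminant form is finite and non-degenerate
  is read off from the unitarity and invertibility of \<open>\<rho>(S)\<close>.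
\<close>

section \<open>Rational numbers inside the finite adeles\<close>

lemma padic_class_eqI:
  assumes p: "prime p" and s: "padic_cauchy p s" and t: "padic_cauchy p t"
    and null: "(\<lambda>n. s n - t n) \<in> padic_null p"
  shows "padic_class p s = padic_class p t"
proof -
  interpret ideal "padic_null p" "padic_cauchy_ring p" by (rule padic_null_ideal[OF p])
  have "s = (\<lambda>n. s n - t n) \<oplus>\<^bsub>padic_cauchy_ring p\<^esub> t"
    by (simp add: padic_cauchy_ring_def)
  hence "s \<in> padic_class p t"
    using null by (auto simp: a_r_coset_def' )
  thus ?thesis
    using a_repr_independence'[of s t] t by (simp add: padic_cauchy_ring_def)
qed

lemma padic_class_eqD:
  assumes p: "prime p" and s: "padic_cauchy p s"
    and eq: "padic_class p s = padic_class p t"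
  shows "(\<lambda>n. s n - t n) \<in> padic_null p"
proof -
  interpret ideal "padic_null p" "padic_cauchy_ring p" by (rule padic_null_ideal[OF p])
  have "s \<in> padic_class p s" using a_rcos_self s by (simp add: padic_cauchy_ring_def)
  hence "s \<in> padic_class p t" using eq by simp
  then obtain u where "u \<in> padic_null p" "s = (\<lambda>n. u n + t n)"
    by (auto simp: a_r_coset_def' padic_cauchy_ring_def)
  thus ?thesis by simp
qed

text \<open>Finitely many terms of a sequence do not affect its class, and a null difference cannot
  raise the absolute value above 1, by the ultrametric inequality.\<close>

lemma padic_class_integral_iff:
  assumes p: "prime p" and s: "padic_cauchy p s"
  shows "padic_class p s \<in> padic_integers p \<longleftrightarrow> (\<exists>M. \<forall>n\<ge>M. padic_abs p (s n) \<le> 1)"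
proof
  assume "padic_class p s \<in> padic_integers p"
  then obtain t where t: "padic_cauchy p t" "\<And>n. padic_abs p (t n) \<le> 1"
    "padic_class p s = padic_class p t"
    unfolding padic_integers_iff[OF p] by blast
  have "(\<lambda>n. padic_abs p (s n - t n)) \<longlonglongrightarrow> 0"
    using padic_class_eqD[OF p s t(3)] by (simp add: padic_null_def)
  then obtain M where M: "\<And>n. n \<ge> M \<Longrightarrow> padic_abs p (s n - t n) < 1"
    using LIMSEQ_D[of "\<lambda>n. padic_abs p (s n - t n)" 0 1] by auto
  have "padic_abs p (s n) \<le> 1" if "n \<ge> M" for n
    using padic_abs_add[OF p, of "s n - t n" "t n"] M[OF that] t(2)[of n] by simp
  thus "\<exists>M. \<forall>n\<ge>M. padic_abs p (s n) \<le> 1" by blast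
next
  assume "\<exists>M. \<forall>n\<ge>M. padic_abs p (s n) \<le> 1"
  then obtain M where M: "\<And>n. n \<ge> M \<Longrightarrow> padic_abs p (s n) \<le> 1" by blast
  define t where "t n = (if n < M then 0 else s n)" for n
  have "eventually (\<lambda>n. padic_abs p (t n - s n) = 0) sequentially"
    by (rule eventually_sequentiallyI[of M]) (simp add: t_def)
  hence null: "(\<lambda>n. t n - s n) \<in> padic_null p"
    unfolding padic_null_def mem_Collect_eq by (rule tendsto_eventually)
  have "t = (\<lambda>n. (t n - s n) + s n)" by simp
  hence t: "padic_cauchy p t"
    using padic_cauchy_add[OF p padic_null_cauchy[OF p null] s] by simp
  have "padic_class p s = padic_class p t"
    using padic_class_eqI[OF p t s null] by simp
  thus "padic_class p s \<in> padic_integers p"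
    unfolding padic_integers_iff[OF p] using t M
    by (intro exI[of _ t]) (auto simp: t_def)
qed

lemma padic_of_rat_integral_iff:
  "prime p \<Longrightarrow> padic_of_rat p q \<in> padic_integers p \<longleftrightarrow> padic_abs p q \<le> 1"
  unfolding padic_of_rat_def by (subst padic_class_integral_iff) auto

lemma padic_of_rat_carrier: "prime p \<Longrightarrow> padic_of_rat p q \<in> carrier (padic_field p)"
  unfolding padic_of_rat_def padic_field_carrier by auto

lemma padic_abs_le_1_iff:
  assumes p: "prime p" and ab: "quotient_of q = (a, b)"
  shows "padic_abs p q \<le> 1 \<longleftrightarrow> \<not> int p dvd b"
proof (cases "q = 0")
  case True
  thus ?thesis using ab p by auto
next
  case False
  have b: "b > 0" using quotient_of_denom_pos[OF ab] .
  have q: "q = of_int a / of_int b" using quotient_of_div[OF ab] .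
  have a: "a \<noteq> 0" using False q by auto
  have cop: "coprime a b" using quotient_of_coprime[OF ab] .
  have v: "padic_val p q = int (multiplicity (int p) a) - int (multiplicity (int p) b)"
    unfolding q using padic_val_frac[OF p a, of b] b by simp
  have p1: "real p > 1" using prime_gt_1_nat[OF p] by simp
  have le: "padic_abs p q \<le> 1 \<longleftrightarrow> padic_val p q \<ge> 0"
  proof
    assume "padic_val p q \<ge> 0"
    hence "real p powi (- padic_val p q) \<le> real p powi 0"
      using p1 by (intro power_int_increasing) auto
    thus "padic_abs p q \<le> 1" using False by (simp add: padic_abs_def)
  next
    assume "padic_abs p q \<le> 1"
    show "padic_val p q \<ge> 0"
    proof (rule ccontr)
      assume "\<not> padic_val p q \<ge> 0"
      hence "real p powi 1 \<le> real p powi (- padic_val p q)"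
        using p1 by (intro power_int_increasing) auto
      with \<open>padic_abs p q \<le> 1\<close> p1 False show False by (simp add: padic_abs_def)
    qed
  qed
  have np: "\<not> is_unit (int p)" using p by (auto dest: prime_gt_1_nat)
  show ?thesis
  proof (cases "int p dvd b")
    case True
    hence "\<not> int p dvd a" using cop np by (meson coprime_common_divisor)
    hence "multiplicity (int p) a = 0" by (rule not_dvd_imp_multiplicity_0)
    moreover have "multiplicity (int p) b > 0"
      using True b np by (simp add: multiplicity_gt_zero_iff)
    ultimately show ?thesis using True le v by simp
  next
    case nb: False
    hence "multiplicity (int p) b = 0" by (rule not_dvd_imp_multiplicity_0)
    thus ?thesis using nb le v by simp
  qed
qed

lemma padic_abs_inverse_p:
  assumes p: "prime p" shows "padic_abs p (1 / of_nat p) = real p"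
proof -
  have "padic_val p (1 / of_nat p) = - 1"
    using padic_val_frac[OF p, of 1 "int p"] p by simp
  thus ?thesis using p by (auto simp: padic_abs_def)
qed

lemma padic_abs_div_p:
  assumes p: "prime p" and q: "padic_abs p q < 1"
  shows "padic_abs p (q / of_nat p) \<le> 1"
proof (cases "q = 0")
  case False
  have p1: "real p > 1" using prime_gt_1_nat[OF p] by simp
  have "padic_val p q \<ge> 1"
  proof (rule ccontr)
    assume "\<not> padic_val p q \<ge> 1"
    hence "real p powi 0 \<le> real p powi (- padic_val p q)"
      using p1 by (intro power_int_increasing) auto
    thus False using q False by (simp add: padic_abs_def)
  qed
  hence "real p powi (- padic_val p q) \<le> real p powi (- 1)"
    using p1 by (intro power_int_increasing) auto
  hence le: "padic_abs p q \<le> 1 / real p"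
    using False by (simp add: padic_abs_def power_int_minus inverse_eq_divide)
  have "padic_abs p (q / of_nat p) = padic_abs p q * real p"
    using padic_abs_mult[OF p, of q "1 / of_nat p"] by (simp add: padic_abs_inverse_p[OF p])
  thus ?thesis using le p1 by (simp add: field_simps)
qed simp

abbreviation fa :: "rat \<Rightarrow> finite_adele" where "fa \<equiv> finite_adele_of_rat"

lemma local_component_of_rat: "prime p \<Longrightarrow> local_component (fa q) p = padic_of_rat p q"
  unfolding finite_adele_of_rat_def
proof (rule local_component_Abs)
  obtain a b where ab: "quotient_of q = (a, b)" by force
  have b: "b > 0" using quotient_of_denom_pos[OF ab] .
  have "{p. prime p \<and> padic_of_rat p q \<notin> padic_integers p} \<subseteq> {p. p \<le> nat b}"
  proof
    fix p assume "p \<in> {p. prime p \<and> padic_of_rat p q \<notin> padic_integers p}"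
    hence "int p dvd b"
      using padic_abs_le_1_iff[OF _ ab] padic_of_rat_integral_iff by auto
    thus "p \<in> {p. p \<le> nat b}" using zdvd_imp_le[of "int p" b] b by simp
  qed
  thus "finite {p. prime p \<and> padic_of_rat p q \<notin> padic_integers p}"
    by (rule finite_subset) simp
qed (simp_all add: padic_of_rat_carrier)

lemma fa_hom [simp]:
  "fa (x + y) = fa x + fa y" "fa (x * y) = fa x * fa y" "fa 0 = 0" "fa 1 = 1"
  by (rule finite_adele_eqI;
      simp add: local_component_of_rat padic_of_rat_def padic_field_simps[where s = "\<lambda>_. x" and t = "\<lambda>_. y"])+

lemma fa_minus [simp]: "fa (- x) = - fa x"
  using fa_hom(1)[of "- x" x] by (simp add: eq_neg_iff_add_eq_0)

lemma fa_diff [simp]: "fa (x - y) = fa x - fa y"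
  using fa_hom(1)[of x "- y"] by simp

lemma fa_of_nat [simp]: "fa (of_nat n) = of_nat n"
  by (induction n) simp_all

lemma fa_of_int [simp]: "fa (of_int n) = of_int n"
  by (cases n rule: int_cases2) simp_all

lemma fa_mult_inverse: "q \<noteq> 0 \<Longrightarrow> fa q * fa (1 / q) = 1"
  by (simp flip: fa_hom(2))

lemma Zhat_closed [simp, intro]:
  "0 \<in> Zhat" "1 \<in> Zhat" "x \<in> Zhat \<Longrightarrow> y \<in> Zhat \<Longrightarrow> x + y \<in> Zhat"
  "x \<in> Zhat \<Longrightarrow> y \<in> Zhat \<Longrightarrow> x * y \<in> Zhat" "x \<in> Zhat \<Longrightarrow> - x \<in> Zhat"
  by (simp_all add: Zhat_def padic_integers_closed)

lemma Zhat_diff [simp, intro]: "x \<in> Zhat \<Longrightarrow> y \<in> Zhat \<Longrightarrow> x - y \<in> Zhat"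
  using Zhat_closed(3)[of x "- y"] by simp

lemma Zhat_of_nat [simp]: "of_nat n \<in> Zhat"
  by (induction n) simp_all

lemma Zhat_of_int [simp]: "of_int n \<in> Zhat"
  by (cases n rule: int_cases2) simp_all

lemma fa_in_Zhat_iff: "fa q \<in> Zhat \<longleftrightarrow> q \<in> \<int>"
proof
  assume q: "fa q \<in> Zhat"
  obtain a b where ab: "quotient_of q = (a, b)" by force
  have b: "b > 0" using quotient_of_denom_pos[OF ab] .
  have "\<not> int p dvd b" if "prime p" for p
    using q that padic_abs_le_1_iff[OF that ab]
    by (auto simp: Zhat_def local_component_of_rat padic_of_rat_integral_iff)
  hence "\<not> p dvd nat b" if "prime p" for p
    using that b by (metis int_dvd_int_iff int_nat_eq order_less_imp_le)
  hence "nat b = 1" using prime_factor_nat by blast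
  hence "b = 1" by simp
  thus "q \<in> \<int>" using quotient_of_div[OF ab] by simp
next
  assume "q \<in> \<int>"
  thus "fa q \<in> Zhat" by (auto elim: Ints_cases)
qed

lemma fa_eq_0_iff [simp]: "fa q = 0 \<longleftrightarrow> q = 0"
proof
  assume "fa q = 0"
  show "q = 0"
  proof (rule ccontr)
    assume "q \<noteq> 0"
    hence "fa q * fa (1 / q) = 1" by (rule fa_mult_inverse)
    thus False using \<open>fa q = 0\<close> by simp
  qed
qed simp

lemma fa_eq_iff [simp]: "fa q = fa r \<longleftrightarrow> q = r"
  using fa_eq_0_iff[of "q - r"] by (simp del: fa_eq_0_iff) 

text \<open>Clearing denominators, one bad prime at a time.\<close>

lemma finite_adele_denominator:
  obtains n :: nat where "n > 0" "of_nat n * x \<in> Zhat"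
proof -
  define bad where "bad x = {p. prime p \<and> local_component x p \<notin> padic_integers p}" for x
  have "finite A \<Longrightarrow> bad x \<subseteq> A \<Longrightarrow> \<exists>n>0. of_nat n * x \<in> Zhat" for A x
  proof (induction A arbitrary: x rule: finite_induct)
    case empty
    hence "x \<in> Zhat" by (auto simp: bad_def Zhat_def)
    thus ?case by (intro exI[of _ 1]) simp
  next
    case (insert p A)
    show ?case
    proof (cases "p \<in> bad x")
      case False
      thus ?thesis using insert by blast
    next
      case True
      hence p: "prime p" by (simp add: bad_def)
      obtain s where s: "padic_cauchy p s" "local_component x p = padic_class p s"
        using local_component_carrier[OF p, of x] by (auto simp: padic_field_carrier)
      obtain C where C: "C > 0" "\<And>n. padic_abs p (s n) \<le> C"
        using padic_cauchy_bounded[OF p s(1)] by blast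
      obtain k where k: "C < real p ^ k"
        using real_arch_pow[of "real p" C] prime_gt_1_nat[OF p] by auto
      have pk: "padic_abs p (of_nat p ^ k) = 1 / real p ^ k"
      proof (induction k)
        case (Suc k)
        have "padic_abs p (of_nat p) * padic_abs p (1 / of_nat p) = 1"
          using p by (simp flip: padic_abs_mult)
        thus ?case using Suc p
          by (simp add: padic_abs_mult padic_abs_inverse_p field_simps)
      qed simp
      let ?y = "of_nat (p ^ k) * x"
      have loc: "local_component (of_nat n) q = padic_class q (\<lambda>_. of_nat n)" if "prime q" for n q
        using local_component_of_rat[OF that, of "of_nat n"] by (simp add: padic_of_rat_def)
      have "local_component ?y p = padic_class p (\<lambda>n. of_nat (p ^ k) * s n)"
        using p s by (simp add: loc padic_field_simps del: of_nat_power)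
      also have "\<dots> \<in> padic_integers p"
      proof (subst padic_class_integral_iff[OF p padic_cauchy_mult[OF p padic_cauchy_const s(1)]],
          intro exI allI impI)
        fix n
        have "padic_abs p (s n) \<le> real p ^ k" using C(2)[of n] k by simp
        thus "padic_abs p (of_nat (p ^ k) * s n) \<le> 1"
          using p by (simp add: padic_abs_mult pk field_simps prime_gt_0_nat)
      qed
      finally have yp: "p \<notin> bad ?y" by (simp add: bad_def)
      have "bad ?y \<subseteq> bad x"
        using Zhat_of_nat[of "p ^ k"]
        by (auto simp: bad_def Zhat_def padic_integers_closed simp del: of_nat_power)
      hence "bad ?y \<subseteq> A" using yp insert.prems by auto
      then obtain n where n: "n > 0" "of_nat n * ?y \<in> Zhat" using insert.IH by blast
      thus ?thesis using p
        by (intro exI[of _ "n * p ^ k"]) (auto simp: mult.assoc prime_gt_0_nat)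
    qed
  qed
  moreover have "finite (bad x)" using local_component_integral by (simp add: bad_def)
  ultimately show ?thesis using that by blast
qed

text \<open>\<open>\<int>\<close> surjects onto \<open>\<int>\<^sub>p/p\<int>\<^sub>p\<close>: a \<open>p\<close>-adic integer is within distance less than 1 of a
  fraction with denominator prime to \<open>p\<close>, hence of an integer. At the other primes nothing is to be
  shown, because \<open>p\<close> is a unit there.\<close>

lemma Zhat_residue_prime:
  assumes p: "prime p" and x: "x \<in> Zhat"
  obtains c :: int and w where "w \<in> Zhat" "x - of_int c = of_nat p * w"
proof -
  obtain s where s: "padic_cauchy p s" "\<And>n. padic_abs p (s n) \<le> 1"
    "local_component x p = padic_class p s"
    using x p by (auto simp: Zhat_def padic_integers_iff)
  obtain M where M: "\<And>m n. m \<ge> M \<Longrightarrow> n \<ge> M \<Longrightarrow> padic_abs p (s m - s n) < 1"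
    using s(1) unfolding padic_cauchy_def by (meson zero_less_one)
  obtain a b where ab: "quotient_of (s M) = (a, b)" by force
  have b: "b > 0" using quotient_of_denom_pos[OF ab] .
  have pb: "\<not> int p dvd b" using s(2)[of M] padic_abs_le_1_iff[OF p ab] by simp
  hence "coprime b (int p)"
    using p by (metis coprime_commute prime_imp_coprime_int prime_nat_int_transfer)
  then obtain b' where b': "[b * b' = 1] (mod int p)"
    using cong_solve_coprime_int by auto
  define c where "c = a * b'"
  have "[a - b * c = 0] (mod int p)"
  proof -
    have "[b * c = a * 1] (mod int p)"
      using cong_mult[OF cong_refl[of a] b'] by (simp add: c_def ac_simps)
    thus ?thesis by (simp add: cong_diff_iff_cong_0 cong_sym)
  qed
  then obtain e where e: "a - b * c = int p * e" by (auto simp: cong_0_iff)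
  have "(s M - of_int c) / of_nat p = of_int e / of_int b"
  proof -
    have "(of_int a - of_int b * of_int c :: rat) = of_nat p * of_int e"
      using arg_cong[OF e, of of_int] by simp
    thus ?thesis using quotient_of_div[OF ab] b p by (simp add: field_simps prime_gt_0_nat)
  qed
  moreover have "padic_abs p (of_int e / of_int b) \<le> 1"
  proof -
    obtain e' d where ed: "quotient_of (of_int e / of_int b) = (e', d)" by force
    have "d > 0" using quotient_of_denom_pos[OF ed] .
    hence "(of_int (e * d) :: rat) = of_int (e' * b)"
      using quotient_of_div[OF ed] b by (simp add: field_simps)
    hence "e * d = e' * b" by (simp only: of_int_eq_iff)
    hence "d dvd b" using quotient_of_coprime[OF ed]
      by (metis coprime_commute coprime_dvd_mult_right_iff dvd_triv_right)
    thus ?thesis using pb dvd_trans padic_abs_le_1_iff[OF p ed] by blast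
  qed
  ultimately have one: "padic_abs p ((s M - of_int c) / of_nat p) \<le> 1" by simp
  define w where "w = (x - of_int c) * fa (1 / of_nat p)"
  have "local_component w q \<in> padic_integers q" if q: "prime q" for q
  proof (cases "q = p")
    case False
    have "padic_abs q (1 / of_nat p) \<le> 1"
    proof -
      have "\<not> int q dvd int p" using False p q by (auto dest: primes_dvd_imp_eq)
      hence "padic_val q (1 / of_nat p) = 0"
        using padic_val_frac[OF q, of 1 "int p"] p
        by (simp add: not_dvd_imp_multiplicity_0 prime_gt_0_nat)
      thus ?thesis using p by (simp add: padic_abs_def)
    qed
    moreover have "x - of_int c \<in> Zhat" using x by simp
    ultimately show ?thesis using q
      by (auto simp: w_def Zhat_def padic_integers_closed local_component_of_rat padic_of_rat_integral_iff)
  next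
    case True
    have xc: "local_component (x - of_int c) p = padic_class p (\<lambda>n. s n + - of_int c)"
      using local_component_of_rat[OF p, of "- of_int c"] p s(1)
      by (simp add: padic_of_rat_def s(3) padic_field_simps diff_conv_add_uminus
          del: add_uminus_conv_diff local_component_simps(5))
    have cau: "padic_cauchy p (\<lambda>n. s n + - of_int c)"
      by (rule padic_cauchy_add[OF p s(1) padic_cauchy_const])
    have "local_component w p = padic_class p (\<lambda>n. (s n + - of_int c) * (1 / of_nat p))"
      unfolding w_def using padic_field_simps(2)[OF p cau padic_cauchy_const, of "1 / of_nat p"]
      by (simp only: local_component_simps[OF p] xc local_component_of_rat[OF p] padic_of_rat_def)
    also have "\<dots> \<in> padic_integers p"
    proof (subst padic_class_integral_iff[OF p padic_cauchy_mult[OF p cau padic_cauchy_const]],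
        intro exI allI impI)
      fix n assume "n \<ge> M"
      hence "padic_abs p ((s n - s M) / of_nat p) \<le> 1"
        using M[of n M] by (intro padic_abs_div_p[OF p]) simp
      moreover have "(s n + - of_int c) * (1 / of_nat p)
          = (s n - s M) / of_nat p + (s M - of_int c) / of_nat p"
        by (simp add: diff_divide_distrib)
      ultimately show "padic_abs p ((s n + - of_int c) * (1 / of_nat p)) \<le> 1"
        using padic_abs_add[OF p, of "(s n - s M) / of_nat p" "(s M - of_int c) / of_nat p"] one
        by (metis (no_types, lifting) max.bounded_iff order_trans)
    qed
    finally show ?thesis using True by simp
  qed
  hence "w \<in> Zhat" by (simp add: Zhat_def)
  moreover have "of_nat p * w = (x - of_int c) * (fa (of_nat p) * fa (1 / of_nat p))"
    by (simp add: w_def mult.left_commute)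
  hence "x - of_int c = of_nat p * w"
    using p by (subst (asm) fa_mult_inverse) (simp_all add: prime_gt_0_nat)
  ultimately show ?thesis using that by blast
qed

section \<open>Two by two matrices\<close>

lemma mat2_nth [simp]:
  "mat2 a b c d $ 1 $ 1 = a" "mat2 a b c d $ 1 $ 2 = b"
  "mat2 a b c d $ 2 $ 1 = c" "mat2 a b c d $ 2 $ 2 = d"
  by (simp_all add: mat2_def vector_2)

lemma mat2_eta: "A = mat2 (A $ 1 $ 1) (A $ 1 $ 2) (A $ 2 $ 1) (A $ 2 $ 2)"
  by (simp add: vec_eq_iff forall_2)

lemma mat2_cases: obtains a b c d where "A = mat2 a b c d"
  using mat2_eta by blast

lemma mat2_eq_iff [simp]: "mat2 a b c d = mat2 a' b' c' d' \<longleftrightarrow> a = a' \<and> b = b' \<and> c = c' \<and> d = d'"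
  by (auto simp: vec_eq_iff forall_2)

lemma mat2_mult:
  fixes a :: "'a :: semiring_1"
  shows "mat2 a b c d ** mat2 a' b' c' d'
       = mat2 (a * a' + b * c') (a * b' + b * d') (c * a' + d * c') (c * b' + d * d')"
  by (simp add: vec_eq_iff forall_2 matrix_matrix_mult_def sum_2)

lemma mat_1_eq_mat2: "mat 1 = mat2 1 0 0 1"
  by (simp add: vec_eq_iff forall_2 mat_def)

lemma det_mat2: "det (mat2 a b c d) = a * d - b * (c :: 'a :: comm_ring_1)"
  by (simp add: det_2)

text \<open>The adjugate makes a matrix invertible as soon as its determinant is.\<close>

lemma invertible_2_iff:
  fixes A :: "'a::comm_ring_1^2^2"
  shows "invertible A \<longleftrightarrow> det A dvd 1"
proof
  assume "invertible A"
  then obtain B where "A ** B = mat 1" by (auto simp: invertible_def)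
  hence "det A * det B = 1" by (metis det_I det_mul)
  thus "det A dvd 1" by (metis dvd_triv_left)
next
  assume "det A dvd 1"
  then obtain e where e: "1 = det A * e" by (auto elim: dvdE)
  obtain a b c d where A: "A = mat2 a b c d" by (rule mat2_cases)
  let ?B = "mat2 (e * d) (- (e * b)) (- (e * c)) (e * a)"
  have e1: "a * d * e - b * c * e = 1" using e by (simp add: A det_mat2 algebra_simps)
  have "A ** ?B = mat 1" "?B ** A = mat 1"
    using e1 by (simp_all add: A mat2_mult mat_1_eq_mat2 algebra_simps)
  thus "invertible A" by (auto simp: invertible_def)
qed

section \<open>Reduction modulo an integer\<close>

lemma of_nat_finite_adele_cancel:
  assumes "n > 0" "of_nat n * x = of_nat n * (y :: finite_adele)"
  shows "x = y"
proof -
  have "fa (1 / of_nat n) * of_nat n = 1"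
    using fa_mult_inverse[of "of_nat n"] assms(1) by (simp add: mult.commute)
  thus ?thesis using arg_cong[OF assms(2), of "\<lambda>z. fa (1 / of_nat n) * z"]
    by (simp flip: mult.assoc)
qed

definition Zhat_cong :: "nat \<Rightarrow> finite_adele \<Rightarrow> finite_adele \<Rightarrow> bool" where
  "Zhat_cong N u v \<longleftrightarrow> (\<exists>w\<in>Zhat. u - v = of_nat N * w)"

lemma Zhat_cong_refl [simp]: "Zhat_cong N u u"
  by (auto simp: Zhat_cong_def intro: bexI[of _ 0])

lemma Zhat_cong_sym: "Zhat_cong N u v \<Longrightarrow> Zhat_cong N v u"
  unfolding Zhat_cong_def
  by (metis Zhat_closed(5) minus_diff_eq mult_minus_right)

lemma Zhat_cong_add:
  assumes "Zhat_cong N u v" "Zhat_cong N u' v'" shows "Zhat_cong N (u + u') (v + v')"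
proof -
  obtain w w' where "w \<in> Zhat" "w' \<in> Zhat" "u - v = of_nat N * w" "u' - v' = of_nat N * w'"
    using assms by (auto simp: Zhat_cong_def)
  thus ?thesis unfolding Zhat_cong_def
    by (intro bexI[of _ "w + w'"]) (auto simp: algebra_simps)
qed

lemma Zhat_cong_trans: "Zhat_cong N u v \<Longrightarrow> Zhat_cong N v w \<Longrightarrow> Zhat_cong N u w"
  using Zhat_cong_add[of N u v "v" w] Zhat_cong_add[of N "u + v" "v + w" "- v" "- v"] by simp

lemma Zhat_cong_mult:
  assumes "Zhat_cong N u v" "Zhat_cong N u' v'" "u' \<in> Zhat" "v \<in> Zhat"
  shows "Zhat_cong N (u * u') (v * v')"
proof -
  obtain w w' where w: "w \<in> Zhat" "w' \<in> Zhat" "u - v = of_nat N * w" "u' - v' = of_nat N * w'"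
    using assms by (auto simp: Zhat_cong_def)
  have "u * u' - v * v' = (u - v) * u' + v * (u' - v')" by (simp add: algebra_simps)
  also have "\<dots> = of_nat N * (w * u' + v * w')" by (simp add: w algebra_simps)
  finally show ?thesis unfolding Zhat_cong_def using w assms by (auto intro!: bexI)
qed

lemma Zhat_cong_of_int_iff:
  assumes "N > 0" shows "Zhat_cong N (of_int a) (of_int b) \<longleftrightarrow> [a = b] (mod int N)"
proof
  assume "Zhat_cong N (of_int a) (of_int b)"
  then obtain w where w: "w \<in> Zhat" "of_int a - of_int b = of_nat N * w"
    by (auto simp: Zhat_cong_def)
  let ?q = "(of_int (a - b) :: rat) / of_nat N"
  have "of_nat N * fa ?q = fa (of_int (a - b))"
    using assms by (metis fa_hom(2) fa_of_nat nonzero_mult_div_cancel_left of_nat_eq_0_iff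
        less_numeral_extra(3) times_divide_eq_right)
  also have "\<dots> = of_nat N * w" using w(2) unfolding fa_of_int by simp
  finally have "of_nat N * fa ?q = of_nat N * w" .
  hence "fa ?q = w" by (rule of_nat_finite_adele_cancel[OF assms])
  hence "?q \<in> \<int>" using w fa_in_Zhat_iff by blast
  then obtain z where "?q = of_int z" by (auto elim: Ints_cases)
  hence "(of_int (a - b) :: rat) = of_int (int N * z)" using assms by (simp add: field_simps)
  hence "a - b = int N * z" by (simp only: of_int_eq_iff)
  thus "[a = b] (mod int N)" by (simp add: cong_iff_dvd_diff)
next
  assume "[a = b] (mod int N)"
  then obtain z where "a - b = int N * z" by (auto simp: cong_iff_dvd_diff)
  hence "(of_int a - of_int b :: finite_adele) = of_nat N * of_int z"
    by (metis of_int_diff of_int_mult of_int_of_nat_eq)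
  thus "Zhat_cong N (of_int a) (of_int b)" unfolding Zhat_cong_def by auto
qed

text \<open>The prime factors of \<open>N\<close> are split off one at a time, as in a mixed radix expansion.\<close>

lemma Zhat_residue:
  assumes "x \<in> Zhat" "N > 0"
  shows "\<exists>c. Zhat_cong N x (of_int c)"
  using assms
proof (induction N arbitrary: x rule: less_induct)
  case (less N)
  show ?case
  proof (cases "N = 1")
    case True
    thus ?thesis using less.prems by (auto simp: Zhat_cong_def)
  next
    case False
    then obtain p where p: "prime p" "p dvd N" using prime_factor_nat by blast
    then obtain m where m: "N = p * m" by blast
    have m0: "m > 0" "m < N" using less.prems m prime_gt_1_nat[OF p(1)] by auto
    obtain c w where c: "w \<in> Zhat" "x - of_int c = of_nat p * w"
      using Zhat_residue_prime[OF p(1) less.prems(1)] by blast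
    obtain c' w' where c': "w' \<in> Zhat" "w - of_int c' = of_nat m * w'"
      using less.IH[OF m0(2) c(1) m0(1)] by (auto simp: Zhat_cong_def)
    have "x - of_int (c + int p * c') = of_nat N * w'"
    proof -
      have "x - of_int (c + int p * c') = of_nat p * (w - of_int c')"
        using c(2) by (simp add: algebra_simps)
      thus ?thesis by (simp add: c' m mult.assoc)
    qed
    thus ?thesis using c'(1) unfolding Zhat_cong_def by blast
  qed
qed

lemma Zhat_mod_cong:
  assumes "u \<in> Zhat" "N > 0"
  shows "Zhat_cong N u (of_int (Zhat_mod N u))" "Zhat_mod N u \<in> {0..<int N}"
proof -
  obtain c where c: "Zhat_cong N u (of_int c)" using Zhat_residue[OF assms] by blast
  have "\<exists>!a. 0 \<le> a \<and> a < int N \<and> (\<exists>w\<in>Zhat. u - of_int a = of_nat N * w)"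
  proof (rule ex1I)
    have "Zhat_cong N (of_int c) (of_int (c mod int N))"
      by (simp add: Zhat_cong_of_int_iff assms cong_def)
    from Zhat_cong_trans[OF c this] assms
    show "0 \<le> c mod int N \<and> c mod int N < int N \<and>
        (\<exists>w\<in>Zhat. u - of_int (c mod int N) = of_nat N * w)"
      by (simp add: Zhat_cong_def)
  next
    fix a assume a: "0 \<le> a \<and> a < int N \<and> (\<exists>w\<in>Zhat. u - of_int a = of_nat N * w)"
    hence "Zhat_cong N u (of_int a)" by (simp add: Zhat_cong_def)
    from Zhat_cong_trans[OF Zhat_cong_sym[OF this] c]
    have "[a = c] (mod int N)" using assms by (simp add: Zhat_cong_of_int_iff)
    thus "a = c mod int N" using a by (simp add: cong_def)
  qed
  from theI'[OF this]
  have "0 \<le> Zhat_mod N u \<and> Zhat_mod N u < int N \<and>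
      (\<exists>w\<in>Zhat. u - of_int (Zhat_mod N u) = of_nat N * w)"
    by (simp add: Zhat_mod_def)
  thus "Zhat_cong N u (of_int (Zhat_mod N u))" "Zhat_mod N u \<in> {0..<int N}"
    by (simp_all add: Zhat_cong_def)
qed

lemma Zhat_cong_iff_mod:
  assumes "u \<in> Zhat" "N > 0"
  shows "Zhat_cong N u (of_int a) \<longleftrightarrow> [Zhat_mod N u = a] (mod int N)"
  using Zhat_mod_cong(1)[OF assms] Zhat_cong_of_int_iff[OF assms(2)]
  by (meson Zhat_cong_sym Zhat_cong_trans)

lemma Zhat_mod_mult:
  assumes "u \<in> Zhat" "v \<in> Zhat" "N > 0"
  shows "[Zhat_mod N (u * v) = Zhat_mod N u * Zhat_mod N v] (mod int N)"
  using Zhat_cong_mult[OF Zhat_mod_cong(1)[OF assms(1,3)] Zhat_mod_cong(1)[OF assms(2,3)]] assms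
  by (simp flip: Zhat_cong_iff_mod)

lemma Zhat_mod_add:
  assumes "u \<in> Zhat" "v \<in> Zhat" "N > 0"
  shows "[Zhat_mod N (u + v) = Zhat_mod N u + Zhat_mod N v] (mod int N)"
  using Zhat_cong_add[OF Zhat_mod_cong(1)[OF assms(1,3)] Zhat_mod_cong(1)[OF assms(2,3)]] assms
  by (simp flip: Zhat_cong_iff_mod)

lemma Zhat_mod_of_int:
  assumes "N > 0" shows "[Zhat_mod N (of_int a) = a] (mod int N)"
  using Zhat_cong_iff_mod[of "of_int a" N a] assms by simp

lemma Zhat_units_iff: "u \<in> Zhat_units \<longleftrightarrow> u \<in> Zhat \<and> (\<exists>v\<in>Zhat. u * v = 1)"
  by (simp add: Zhat_units_def)

lemma Zhat_mod_unit:
  assumes "u \<in> Zhat_units" "N > 0"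
  shows "coprime (Zhat_mod N u) (int N)"
proof -
  obtain v where v: "u \<in> Zhat" "v \<in> Zhat" "u * v = 1" using assms(1) by (auto simp: Zhat_units_iff)
  have "[Zhat_mod N u * Zhat_mod N v = 1] (mod int N)"
    using Zhat_mod_mult[OF v(1,2) assms(2)] Zhat_mod_of_int[OF assms(2), of 1] v(3)
    by (metis cong_sym cong_trans of_int_1)
  thus ?thesis using coprime_iff_invertible_int by blast
qed

text \<open>\<open>Zhat/p = \<int>/p\<close> has no zero divisors.\<close>

lemma Zhat_prime_dvd_mult:
  assumes p: "prime p" and x: "x \<in> Zhat" and y: "y \<in> Zhat"
    and xy: "x * y = of_nat p * w" "w \<in> Zhat"
  shows "(\<exists>v\<in>Zhat. x = of_nat p * v) \<or> (\<exists>v\<in>Zhat. y = of_nat p * v)"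
proof -
  have p0: "p > 0" using p prime_gt_0_nat by blast
  have div: "(\<exists>v\<in>Zhat. z = of_nat p * v) \<longleftrightarrow> int p dvd Zhat_mod p z" if "z \<in> Zhat" for z
    using Zhat_cong_iff_mod[OF that p0, of 0] by (simp add: Zhat_cong_def cong_0_iff)
  have "int p dvd Zhat_mod p (x * y)" using div[of "x * y"] x y xy by auto
  hence "int p dvd Zhat_mod p x * Zhat_mod p y"
    using Zhat_mod_mult[OF x y p0] cong_dvd_iff by (metis cong_0_iff cong_sym cong_trans)
  hence "int p dvd Zhat_mod p x \<or> int p dvd Zhat_mod p y"
    using p by (simp add: prime_dvd_mult_iff)
  thus ?thesis using div x y by blast
qed

section \<open>Strong approximation\<close>

text \<open>The prime factors of \<open>n = t s\<close> are removed one after the other from \<open>t\<close> or from \<open>s\<close>; what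
  remains of \<open>t\<close> is a unit.\<close>

lemma Zhat_idele_decomposition:
  assumes "n > 0" "t \<in> Zhat" "s \<in> Zhat" "t * s = of_nat n"
  shows "\<exists>r>0. \<exists>u\<in>Zhat_units. t = of_nat r * u"
  using assms
proof (induction n arbitrary: t s rule: less_induct)
  case (less n)
  show ?case
  proof (cases "n = 1")
    case True
    thus ?thesis using less.prems by (intro exI[of _ 1]) (auto simp: Zhat_units_iff)
  next
    case False
    then obtain p where p: "prime p" "p dvd n" using prime_factor_nat by blast
    then obtain m where m: "n = p * m" by blast
    have p0: "p > 0" using p prime_gt_0_nat by blast
    have m0: "m > 0" "m < n" using less.prems m prime_gt_1_nat[OF p(1)] by auto
    have "t * s = of_nat p * of_nat m" using less.prems m by simp
    from Zhat_prime_dvd_mult[OF p(1) less.prems(2,3) this]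
    consider v where "v \<in> Zhat" "t = of_nat p * v" | v where "v \<in> Zhat" "s = of_nat p * v"
      by auto
    thus ?thesis
    proof cases
      case 1
      hence "of_nat p * (v * s) = of_nat p * of_nat m" using less.prems m by (simp add: mult.assoc)
      hence "v * s = of_nat m" by (rule of_nat_finite_adele_cancel[OF p0])
      then obtain r u where "r > 0" "u \<in> Zhat_units" "v = of_nat r * u"
        using less.IH[OF m0(2,1) 1(1) less.prems(3)] by blast
      thus ?thesis using 1 p0 by (intro exI[of _ "p * r"]) (auto simp: mult.assoc)
    next
      case 2
      hence "of_nat p * (t * v) = of_nat p * of_nat m"
        using less.prems m by (simp add: mult.left_commute)
      hence "t * v = of_nat m" by (rule of_nat_finite_adele_cancel[OF p0])
      thus ?thesis using less.IH[OF m0(2,1) less.prems(2) 2(1)] by blast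
    qed
  qed
qed

lemma fa_scale_inverse: "q \<noteq> 0 \<Longrightarrow> fa q * (fa (1 / q) * x) = x"
  using fa_mult_inverse[of q] by (simp flip: mult.assoc)

lemma finite_idele_decomposition:
  assumes "t dvd (1 :: finite_adele)"
  obtains r u where "r > 0" "u \<in> Zhat_units" "t = fa r * u"
proof -
  obtain s where s: "1 = t * s" using assms by (auto elim: dvdE)
  obtain m where m: "m > 0" "of_nat m * t \<in> Zhat" by (rule finite_adele_denominator)
  obtain n where n: "n > 0" "of_nat n * s \<in> Zhat" by (rule finite_adele_denominator)
  have "(of_nat m * t) * (of_nat n * s) = of_nat (m * n) * (t * s)" by simp
  also have "\<dots> = of_nat (m * n)" by (simp flip: s)
  finally obtain r u where r: "r > 0" "u \<in> Zhat_units" "of_nat m * t = of_nat r * u"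
    using Zhat_idele_decomposition[of "m * n", OF _ m(2) n(2)] m n by auto
  have "of_nat m * (fa (1 / of_nat m * of_nat r) * u) = of_nat m * t"
    using fa_scale_inverse[of "of_nat m" "of_nat r * u"] m(1)
    by (metis fa_hom(2) fa_of_nat mult.assoc of_nat_0_less_iff order_less_irrefl r(3))
  hence "t = fa (1 / of_nat m * of_nat r) * u" using of_nat_finite_adele_cancel[OF m(1)] by metis
  thus ?thesis using r m by (intro that[of "1 / of_nat m * of_nat r" u]) auto
qed

definition map_mat :: "('a \<Rightarrow> 'b) \<Rightarrow> 'a^2^2 \<Rightarrow> 'b^2^2" where
  "map_mat f A = (\<chi> i j. f (A $ i $ j))"

lemma map_mat_nth [simp]: "map_mat f A $ i $ j = f (A $ i $ j)"
  by (simp add: map_mat_def)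

lemma map_mat_mat2: "map_mat f (mat2 a b c d) = mat2 (f a) (f b) (f c) (f d)"
  by (simp add: vec_eq_iff forall_2)

lemma map_mat_fa_mult: "map_mat fa (A ** B) = map_mat fa A ** map_mat fa B"
  by (simp add: vec_eq_iff forall_2 matrix_matrix_mult_def sum_2)

lemma det_map_mat_fa: "det (map_mat fa A) = fa (det A)"
  by (simp add: det_2)

lemma GL2_Zhat_iff: "k \<in> GL2_Zhat \<longleftrightarrow> (\<forall>i j. k $ i $ j \<in> Zhat) \<and> det k \<in> Zhat_units"
proof
  assume "k \<in> GL2_Zhat"
  then obtain l where l: "\<forall>i j. k $ i $ j \<in> Zhat" "\<forall>i j. l $ i $ j \<in> Zhat" "k ** l = mat 1"
    by (auto simp: GL2_Zhat_def)
  have "det k * det l = 1" using l(3) by (metis det_I det_mul)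
  moreover have "det k \<in> Zhat" "det l \<in> Zhat" using l by (auto simp: det_2)
  ultimately show "(\<forall>i j. k $ i $ j \<in> Zhat) \<and> det k \<in> Zhat_units"
    using l by (auto simp: Zhat_units_iff)
next
  assume k: "(\<forall>i j. k $ i $ j \<in> Zhat) \<and> det k \<in> Zhat_units"
  obtain a b c d where A: "k = mat2 a b c d" by (rule mat2_cases)
  obtain e where e: "e \<in> Zhat" "det k * e = 1" using k by (auto simp: Zhat_units_iff)
  let ?B = "mat2 (e * d) (- (e * b)) (- (e * c)) (e * a)"
  have e1: "a * d * e - b * c * e = 1" using e by (simp add: A det_mat2 algebra_simps)
  have "k ** ?B = mat 1" "?B ** k = mat 1"
    using e1 by (simp_all add: A mat2_mult mat_1_eq_mat2 algebra_simps)
  moreover have "\<forall>i j. ?B $ i $ j \<in> Zhat"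
    using k e by (auto simp: A forall_2)
  ultimately show "k \<in> GL2_Zhat" using k unfolding GL2_Zhat_def by blast
qed

lemma mod_prime_proportional:
  fixes a b c d :: int
  assumes p: "prime p" "\<not> int p dvd a" and eq: "[a * d = b * c] (mod int p)"
  shows "\<exists>y. [c = y * a] (mod int p) \<and> [d = y * b] (mod int p)"
proof -
  have "coprime a (int p)"
    using p by (metis coprime_commute prime_imp_coprime prime_nat_int_transfer)
  then obtain i where i: "[a * i = 1] (mod int p)" using cong_solve_coprime_int by blast
  have "[c * i * a = c] (mod int p)" using cong_mult[OF cong_refl[of c] i] by (simp add: ac_simps)
  moreover have "[i * (a * d) = i * (b * c)] (mod int p)" using eq by (rule cong_scalar_left)
  hence "[1 * d = i * (b * c)] (mod int p)"
    using cong_scalar_right[OF i, of d] by (simp add: ac_simps) (metis cong_sym cong_trans)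
  hence "[c * i * b = d] (mod int p)" by (simp add: ac_simps cong_sym)
  ultimately show ?thesis using cong_sym by blast
qed

text \<open>If a prime factor \<open>p\<close> of \<open>n\<close> divides the determinant, the rows are dependent modulo \<open>p\<close>, so a rational
  row operation clears one row modulo \<open>p\<close> and divides it by \<open>p\<close>; otherwise \<open>p\<close> divides \<open>s\<close>. Either way \<open>n\<close>
  shrinks, until the determinant is a unit.\<close>

lemma Zhat_matrix_decomposition:
  assumes "n > 0" "\<forall>i j. g $ i $ j \<in> Zhat" "s \<in> Zhat" "det g * s = of_nat n"
  shows "\<exists>q k. invertible q \<and> k \<in> GL2_Zhat \<and> g = map_mat fa q ** k"
  using assms
proof (induction n arbitrary: g s rule: less_induct)
  case (less n)
  have det: "det g \<in> Zhat" using less.prems by (auto simp: det_2)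
  show ?case
  proof (cases "n = 1")
    case True
    hence "g \<in> GL2_Zhat" using less.prems det by (auto simp: GL2_Zhat_iff Zhat_units_iff)
    moreover have "map_mat fa (mat 1) = mat 1" by (simp add: vec_eq_iff mat_def)
    ultimately show ?thesis by (metis invertible_def matrix_mul_lid)
  next
    case False
    then obtain p where p: "prime p" "p dvd n" using prime_factor_nat by blast
    then obtain m where m: "n = p * m" by blast
    have p0: "p > 0" using p prime_gt_0_nat by blast
    have m0: "m > 0" "m < n" using less.prems m prime_gt_1_nat[OF p(1)] by auto
    \<comment> \<open>Splitting off a rational matrix of determinant \<open>p\<close> on the left reduces \<open>n\<close> to \<open>m\<close>.\<close>
    have step: ?thesis if "g = mat2 a b c d ** g'" "a * d - b * c = of_nat p"
        and g': "\<forall>i j. g' $ i $ j \<in> Zhat" and "a = fa a'" "b = fa b'" "c = fa c'" "d = fa d'"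
        for a b c d a' b' c' d' g'
    proof -
      have "of_nat p * (det g' * s) = of_nat p * of_nat m"
        using less.prems(4) that(2) m by (simp add: that(1) det_mul det_mat2 mult.assoc)
      hence "det g' * s = of_nat m" by (rule of_nat_finite_adele_cancel[OF p0])
      then obtain q k where qk: "invertible q" "k \<in> GL2_Zhat" "g' = map_mat fa q ** k"
        using less.IH[OF m0(2,1) g' less.prems(3)] by blast
      have "fa (a' * d' - b' * c') = fa (of_nat p)" using that by simp
      hence "a' * d' - b' * c' = of_nat p" by (simp only: fa_eq_iff)
      hence "invertible (mat2 a' b' c' d')"
        using p0 by (simp add: invertible_2_iff det_mat2 dvd_field_iff)
      hence "invertible (mat2 a' b' c' d' ** q)" using qk(1) by (rule invertible_mult)
      moreover have "g = map_mat fa (mat2 a' b' c' d' ** q) ** k"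
        by (simp add: that qk map_mat_fa_mult map_mat_mat2 matrix_mul_assoc)
      ultimately show ?thesis using qk by blast
    qed
    have "det g * s = of_nat p * of_nat m" using less.prems m by simp
    from Zhat_prime_dvd_mult[OF p(1) det less.prems(3) this]
    consider v where "v \<in> Zhat" "det g = of_nat p * v" | v where "v \<in> Zhat" "s = of_nat p * v"
      by auto
    thus ?thesis
    proof cases
      case 2
      hence "of_nat p * (det g * v) = of_nat p * of_nat m"
        using less.prems m by (simp add: mult.left_commute)
      hence "det g * v = of_nat m" by (rule of_nat_finite_adele_cancel[OF p0])
      thus ?thesis using less.IH[OF m0(2,1) less.prems(2) 2(1)] by blast
    next
      case 1
      obtain a b c d where g: "g = mat2 a b c d" by (rule mat2_cases)
      have z: "a \<in> Zhat" "b \<in> Zhat" "c \<in> Zhat" "d \<in> Zhat"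
        using less.prems(2) by (auto simp: g forall_2)
      obtain a0 b0 c0 d0 where r: "Zhat_cong p a (of_int a0)" "Zhat_cong p b (of_int b0)"
        "Zhat_cong p c (of_int c0)" "Zhat_cong p d (of_int d0)"
        using Zhat_residue z p0 by meson
      have "Zhat_cong p (a * d + - b * c) (of_int (a0 * d0 + - b0 * c0))"
        using Zhat_cong_add[OF Zhat_cong_mult[OF r(1,4)] Zhat_cong_mult[OF Zhat_cong_mult[OF
              Zhat_cong_refl[of p "- 1"] r(2)] r(3)]] z by simp
      moreover have "Zhat_cong p (a * d + - b * c) 0"
        using 1 by (auto simp: Zhat_cong_def g det_mat2)
      ultimately have "Zhat_cong p (of_int (a0 * d0 + - b0 * c0)) (of_int 0)"
        using Zhat_cong_trans Zhat_cong_sym by (metis of_int_0)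
      hence dep: "[a0 * d0 = b0 * c0] (mod int p)"
        by (simp only: Zhat_cong_of_int_iff[OF p0]) (simp add: cong_iff_dvd_diff cong_0_iff)
      show ?thesis
      proof (cases "int p dvd a0 \<and> int p dvd b0")
        case True
        hence "Zhat_cong p a 0" "Zhat_cong p b 0"
          using Zhat_cong_trans[OF r(1)] Zhat_cong_trans[OF r(2)] Zhat_cong_of_int_iff[OF p0, of _ 0]
          by (auto simp: cong_0_iff)
        then obtain a' b' where ab: "a' \<in> Zhat" "b' \<in> Zhat" "a = of_nat p * a'" "b = of_nat p * b'"
          by (auto simp: Zhat_cong_def)
        show ?thesis
          by (rule step[of "of_nat p" 0 0 1 "mat2 a' b' c d" "of_nat p" 0 0 1])
             (use z ab in \<open>auto simp: g mat2_mult forall_2\<close>)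
      next
        case False
        \<comment> \<open>The first row is non-zero modulo \<open>p\<close>, so the second one is \<open>y\<close> times it.\<close>
        obtain y where y: "[c0 = y * a0] (mod int p)" "[d0 = y * b0] (mod int p)"
          using mod_prime_proportional[OF p(1) _ dep] mod_prime_proportional[OF p(1) _ cong_sym[OF dep]]
            False by blast
        have lin: "Zhat_cong p x (of_int y * w)"
          if "Zhat_cong p x (of_int x0)" "Zhat_cong p w (of_int w0)" "[x0 = y * w0] (mod int p)"
             "w \<in> Zhat" for x x0 w w0
        proof -
          have "Zhat_cong p (of_int x0) (of_int (y * w0))"
            using that by (simp only: Zhat_cong_of_int_iff[OF p0])
          moreover have "Zhat_cong p (of_int y * w) (of_int y * of_int w0)"
            using that by (intro Zhat_cong_mult) auto
          ultimately show ?thesis using that(1) Zhat_cong_trans Zhat_cong_sym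
            by (metis of_int_mult)
        qed
        obtain c' d' where cd: "c' \<in> Zhat" "d' \<in> Zhat"
          "c - of_int y * a = of_nat p * c'" "d - of_int y * b = of_nat p * d'"
          using lin[OF r(3,1) y(1) z(1)] lin[OF r(4,2) y(2) z(2)] by (auto simp: Zhat_cong_def)
        show ?thesis
          by (rule step[of 1 0 "of_int y" "of_nat p" "mat2 a b c' d'" 1 0 "of_int y" "of_nat p"])
             (use z cd in \<open>auto simp: g mat2_mult forall_2 algebra_simps\<close>)
      qed
    qed
  qed
qed

theorem GL2_finite_adele_decomposition:
  assumes "invertible (g :: finite_adele^2^2)"
  obtains q k where "invertible q" "k \<in> GL2_Zhat" "g = map_mat fa q ** k"
proof -
  obtain a b c d where g: "g = mat2 a b c d" by (rule mat2_cases)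
  have den: "\<exists>n>0. of_nat n * x \<in> Zhat" for x
    using finite_adele_denominator[of x] by blast
  obtain na nb nc nd where n: "na > 0" "of_nat na * a \<in> Zhat" "nb > 0" "of_nat nb * b \<in> Zhat"
    "nc > 0" "of_nat nc * c \<in> Zhat" "nd > 0" "of_nat nd * d \<in> Zhat"
    using den by meson
  define n where "n = na * nb * nc * nd"
  have n0: "n > 0" using n by (simp add: n_def)
  have nz: "of_nat n * a \<in> Zhat" "of_nat n * b \<in> Zhat" "of_nat n * c \<in> Zhat" "of_nat n * d \<in> Zhat"
    using Zhat_closed(4)[OF Zhat_of_nat[of "nb * nc * nd"] n(2)]
      Zhat_closed(4)[OF Zhat_of_nat[of "na * nc * nd"] n(4)]
      Zhat_closed(4)[OF Zhat_of_nat[of "na * nb * nd"] n(6)]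
      Zhat_closed(4)[OF Zhat_of_nat[of "na * nb * nc"] n(8)]
    by (simp_all add: n_def ac_simps)
  define g' where "g' = mat2 (of_nat n * a) (of_nat n * b) (of_nat n * c) (of_nat n * d)"
  have det': "det g' = of_nat n * (of_nat n * det g)"
    by (simp add: g'_def g det_mat2 algebra_simps)
  obtain e where e: "1 = det g * e" using assms by (auto simp: invertible_2_iff elim: dvdE)
  obtain m where m: "m > 0" "of_nat m * e \<in> Zhat" by (rule finite_adele_denominator)
  have "det g' * (of_nat m * e) = of_nat (n * n * m) * (det g * e)"
    by (simp add: det' ac_simps)
  hence "det g' * (of_nat m * e) = of_nat (n * n * m)" by (simp flip: e)
  moreover have "\<forall>i j. g' $ i $ j \<in> Zhat" using nz by (simp add: g'_def forall_2)
  ultimately obtain q k where qk: "invertible q" "k \<in> GL2_Zhat" "g' = map_mat fa q ** k"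
    using Zhat_matrix_decomposition[of "n * n * m" g' "of_nat m * e"] m n0 by auto
  let ?s = "mat2 (1 / of_nat n) 0 0 (1 / of_nat n) :: rat^2^2"
  have inv: "invertible (?s ** q)"
    using n0 qk(1) by (intro invertible_mult) (auto simp: invertible_2_iff det_mat2 dvd_field_iff)
  have "fa (1 / of_nat n) * (of_nat n * x) = x" for x
    using fa_scale_inverse[of "1 / of_nat n" x] n0 by simp
  hence "g = map_mat fa ?s ** g'"
    by (simp add: g'_def g map_mat_mat2 mat2_mult)
  also have "\<dots> = map_mat fa (?s ** q) ** k"
    by (simp add: qk map_mat_fa_mult matrix_mul_assoc)
  finally show ?thesis using that inv qk by blast
qed

lemma adele_matrix_mult: "adele_matrix g k ** adele_matrix h l = adele_matrix (g ** h) (k ** l)"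
  by (simp add: vec_eq_iff forall_2 matrix_matrix_mult_def sum_2 adele_matrix_def
      plus_adele_def times_adele_def)

lemma adele_matrix_of_rat_eq: "adele_matrix_of_rat q = adele_matrix (map_mat of_rat q) (map_mat fa q)"
  by (simp add: vec_eq_iff adele_matrix_of_rat_def adele_of_rat_def adele_matrix_def)

lemma adele_matrix_eq_iff [simp]: "adele_matrix g k = adele_matrix h l \<longleftrightarrow> g = h \<and> k = l"
  by (auto simp: vec_eq_iff adele_matrix_def)

lemma adele_matrix_cases: obtains g k where "x = adele_matrix g k"
proof -
  have "x = adele_matrix (\<chi> i j. infinite_part (x $ i $ j)) (\<chi> i j. finite_part (x $ i $ j))"
    by (simp add: vec_eq_iff adele_matrix_def)
  thus ?thesis using that by blast
qed

lemma adele_mult [simp]: "Adele a b * Adele c d = Adele (a * c) (b * d)"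
  by (simp add: times_adele_def)

lemma det_adele_matrix: "det (adele_matrix g k) = Adele (det g) (det k)"
  by (simp add: det_2 adele_matrix_def minus_adele_def)

lemma Adele_dvd_1_iff: "Adele a b dvd 1 \<longleftrightarrow> a \<noteq> 0 \<and> b dvd 1"
proof
  assume "Adele a b dvd 1"
  then obtain y where y: "1 = Adele a b * y" by (auto elim: dvdE)
  obtain c d where "y = Adele c d" by (cases y)
  with y have "1 = a * c" "1 = b * d" by (auto simp: one_adele_def)
  thus "a \<noteq> 0 \<and> b dvd 1" by (metis dvd_triv_left mult_zero_left zero_neq_one)
next
  assume "a \<noteq> 0 \<and> b dvd 1"
  then obtain d where "1 = b * d" "a \<noteq> 0" by (auto elim: dvdE)
  hence "1 = Adele a b * Adele (1 / a) d" by (simp add: one_adele_def)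
  thus "Adele a b dvd 1" by (metis dvd_triv_left)
qed

lemma invertible_adele_matrix_iff: "invertible (adele_matrix g k) \<longleftrightarrow> invertible g \<and> invertible k"
  by (simp add: invertible_2_iff det_adele_matrix Adele_dvd_1_iff dvd_field_iff)

lemma map_mat_of_rat_mult:
  "map_mat (of_rat :: rat \<Rightarrow> real) (A ** B) = map_mat of_rat A ** map_mat of_rat B"
  by (simp add: vec_eq_iff forall_2 matrix_matrix_mult_def sum_2 of_rat_add of_rat_mult)

lemma det_map_mat_of_rat: "det (map_mat (of_rat :: rat \<Rightarrow> real) A) = of_rat (det A)"
  by (simp add: det_2 of_rat_diff of_rat_mult)

lemma map_mat_one [simp]:
  "map_mat (of_rat :: rat \<Rightarrow> real) (mat 1) = mat 1" "map_mat fa (mat 1) = mat 1"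
  by (simp_all add: vec_eq_iff mat_def)

lemma adele_matrix_of_rat_mult:
  "adele_matrix_of_rat (A ** B) = adele_matrix_of_rat A ** adele_matrix_of_rat B"
  by (simp add: adele_matrix_of_rat_eq adele_matrix_mult map_mat_fa_mult map_mat_of_rat_mult)

lemma Zhat_units_closed:
  "u \<in> Zhat_units \<Longrightarrow> v \<in> Zhat_units \<Longrightarrow> u * v \<in> Zhat_units"
  "u \<in> Zhat_units \<Longrightarrow> - u \<in> Zhat_units" "1 \<in> Zhat_units"
proof -
  assume "u \<in> Zhat_units" "v \<in> Zhat_units"
  then obtain u' v' where uv: "u \<in> Zhat" "v \<in> Zhat" "u' \<in> Zhat" "v' \<in> Zhat" "u * u' = 1" "v * v' = 1"
    by (auto simp: Zhat_units_iff)
  have "(u * v) * (u' * v') = (u * u') * (v * v')" by (simp only: ac_simps)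
  thus "u * v \<in> Zhat_units" using uv by (auto simp: Zhat_units_iff)
next
  assume "u \<in> Zhat_units"
  then obtain u' where "u \<in> Zhat" "u' \<in> Zhat" "u * u' = 1"
    by (auto simp: Zhat_units_iff)
  thus "- u \<in> Zhat_units" unfolding Zhat_units_iff by (auto intro!: bexI[of _ "- u'"])
qed (auto simp: Zhat_units_iff)

text \<open>Both \<open>q\<close> and \<open>1/q\<close> lie in \<open>\<rat> \<inter> Zhat = \<int>\<close>.\<close>

lemma rational_Zhat_unit:
  assumes "fa q * u = v" "u \<in> Zhat_units" "v \<in> Zhat_units"
  shows "q = 1 \<or> q = - 1"
proof -
  obtain u' v' where uv: "u' \<in> Zhat" "u * u' = 1" "v' \<in> Zhat" "v * v' = 1" "u \<in> Zhat" "v \<in> Zhat"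
    using assms by (auto simp: Zhat_units_iff)
  have q: "fa q = v * u'" using assms(1) uv(2) by (metis mult.assoc mult.right_neutral)
  have 1: "fa q * (u * v') = 1" using assms(1) uv(4) by (simp flip: mult.assoc)
  hence q0: "q \<noteq> 0" by auto
  have "u * v' = fa (1 / q)"
    using fa_mult_inverse[OF q0] 1 by (metis mult.commute mult.left_commute mult.right_neutral)
  hence "fa (1 / q) \<in> Zhat" "fa q \<in> Zhat" using q uv by (metis Zhat_closed(4))+
  then obtain a b where ab: "q = of_int a" "1 / q = of_int b"
    by (auto simp: fa_in_Zhat_iff elim!: Ints_cases)
  hence "(of_int (a * b) :: rat) = of_int 1" using q0 by (simp add: field_simps)
  hence "a * b = 1" by (simp only: of_int_eq_iff)
  hence "a = 1 \<or> a = - 1" by (auto simp: zmult_eq_1_iff)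
  thus ?thesis using ab by auto
qed

lemma calK_iff:
  "(k, t) \<in> carrier calK \<longleftrightarrow> (\<forall>i j. k $ i $ j \<in> Zhat) \<and> t \<in> Zhat_units \<and> det k = t\<^sup>2"
  by (auto simp: calK_def GL2_Zhat_iff Zhat_units_closed power2_eq_square)

text \<open>The decomposition \<open>g = q (h \<times> k)\<close>: scaling makes the square root of the determinant
  a unit that is positive at infinity; then \<open>GL\<^sub>2(\<rat>) GL\<^sub>2(Zhat)\<close> contains the finite part, and the
  sign of the rational determinant is moved to the other factor.\<close>

theorem calG_strong_approximation:
  assumes "x \<in> calG"
  obtains q h k where "q \<in> calG" "h \<in> GL2_real_pos" "k \<in> carrier calK"
    "x = pair_mult (calG_of_rat q) (calG_inf_fin h k)"
proof -
  obtain G s where x: "x = (G, s)" by (cases x)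
  obtain g gf where G: "G = adele_matrix g gf" by (rule adele_matrix_cases)
  obtain t tf where s: "s = Adele t tf" by (cases s)
  have inv: "invertible g" "invertible gf" and t: "t \<noteq> 0" "tf dvd 1"
    and det: "det g = t\<^sup>2" "det gf = tf\<^sup>2"
    using assms by (auto simp: x G s calG_def invertible_adele_matrix_iff Adele_dvd_1_iff
        det_adele_matrix power2_eq_square)
  obtain r0 u0 where r0: "r0 > 0" "u0 \<in> Zhat_units" "tf = fa r0 * u0"
    using finite_idele_decomposition[OF t(2)] by blast
  define r u where "r = (if t > 0 then r0 else - r0)" and "u = (if t > 0 then u0 else - u0)"
  have r: "r \<noteq> 0" "u \<in> Zhat_units" "tf = fa r * u" "t / of_rat r > 0"
    using r0 t by (auto simp: r_def u_def Zhat_units_closed of_rat_minus divide_less_0_iff)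
  define z z' where "z = mat2 r 0 0 r" and "z' = mat2 (1 / r) 0 0 (1 / r)"
  have zz: "z ** z' = mat 1" "det z = r\<^sup>2" using r
    by (simp_all add: z_def z'_def mat2_mult mat_1_eq_mat2 det_mat2 power2_eq_square)
  have "map_mat fa z' ** map_mat fa z = mat 1" "map_mat fa z ** map_mat fa z' = mat 1"
    using r(1) zz(1) by (simp_all add: z_def z'_def mat2_mult mat_1_eq_mat2 flip: map_mat_fa_mult)
       (simp_all add: map_mat_mat2)
  hence "invertible (map_mat fa z' ** gf)"
    using inv(2) by (intro invertible_mult) (auto simp: invertible_def)
  then obtain q0 k0 where qk0: "invertible q0" "k0 \<in> GL2_Zhat" "map_mat fa z' ** gf = map_mat fa q0 ** k0"
    by (rule GL2_finite_adele_decomposition)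
  have "fa (det q0) * det k0 = u\<^sup>2"
  proof -
    have "fa (det q0) * det k0 = fa (1 / r) * fa (1 / r) * det gf"
      using arg_cong[OF qk0(3), of det]
      by (simp add: det_mul det_map_mat_fa z'_def det_mat2 del: fa_hom flip: fa_hom(2))
    also have "\<dots> = (fa r * fa (1 / r)) * (fa r * fa (1 / r)) * u\<^sup>2"
      by (simp only: det r(3) power2_eq_square ac_simps)
    finally show ?thesis using fa_mult_inverse[OF r(1)] by simp
  qed
  hence d: "det q0 = 1 \<or> det q0 = - 1"
    using rational_Zhat_unit[of "det q0" "det k0" "u\<^sup>2"] qk0(2) r(2)
    by (simp add: GL2_Zhat_iff Zhat_units_closed power2_eq_square)
  \<comment> \<open>Integral of determinant \<open>\<plusminus>1\<close>; it moves the sign of \<open>det q0\<close> to the factor in \<open>GL\<^sub>2(Zhat)\<close>.\<close>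
  define \<delta> where "\<delta> = mat2 1 0 0 (det q0)"
  define q k where "q = q0 ** \<delta>" and "k = map_mat fa \<delta> ** k0"
  have dd: "\<delta> ** \<delta> = mat 1" "det \<delta> = det q0" using d
    by (auto simp: \<delta>_def mat2_mult mat_1_eq_mat2 det_mat2)
  have detq: "det q = 1" using d dd by (auto simp: q_def det_mul)
  have qk: "map_mat fa z' ** gf = map_mat fa q ** k"
  proof -
    have "map_mat fa q ** k = map_mat fa q0 ** (map_mat fa (\<delta> ** \<delta>) ** k0)"
      by (simp only: q_def k_def map_mat_fa_mult matrix_mul_assoc)
    thus ?thesis by (simp add: dd qk0)
  qed
  have kZ: "\<forall>i j. k $ i $ j \<in> Zhat"
  proof -
    have "\<forall>i j. map_mat fa \<delta> $ i $ j \<in> Zhat"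
      using d by (auto simp: \<delta>_def forall_2 fa_in_Zhat_iff)
    thus ?thesis using qk0(2)
      by (simp add: k_def GL2_Zhat_iff forall_2 matrix_matrix_mult_def sum_2)
  qed
  have "det k = u\<^sup>2"
    using \<open>fa (det q0) * det k0 = u\<^sup>2\<close> by (simp add: k_def det_mul det_map_mat_fa dd)
  hence k: "(k, u) \<in> carrier calK" using kZ r(2) by (simp add: calK_iff)
  define q' where "q' = z ** q"
  have detq': "det q' = r\<^sup>2" by (simp add: q'_def det_mul zz detq)
  have invq': "invertible q'" using r(1) by (simp add: invertible_2_iff detq' dvd_field_iff)
  then obtain p where p: "q' ** p = mat 1" by (auto simp: invertible_def)
  define h where "h = map_mat of_rat p ** g"
  have "det q' * det p = 1" using p by (metis det_I det_mul)
  hence "det p = 1 / r\<^sup>2" using detq' r(1) by (simp add: field_simps)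
  hence deth: "det h = (t / of_rat r)\<^sup>2"
    by (simp add: h_def det_mul det det_map_mat_of_rat of_rat_divide of_rat_power power_divide)
  have "map_mat of_rat q' ** h = map_mat of_rat (q' ** p) ** g"
    by (simp only: h_def map_mat_of_rat_mult matrix_mul_assoc)
  hence gh: "map_mat of_rat q' ** h = g" by (simp add: p)
  have gk: "map_mat fa q' ** k = gf"
  proof -
    have "map_mat fa q' ** k = map_mat fa (z ** z') ** gf"
      by (simp only: q'_def map_mat_fa_mult qk flip: matrix_mul_assoc)
    thus ?thesis by (simp add: zz)
  qed
  show ?thesis
  proof (rule that)
    show "(q', r) \<in> calG" using invq' detq' r(1) by (simp add: calG_def dvd_field_iff)
    show "h \<in> GL2_real_pos" 
      using zero_less_power[OF r(4), of 2] by (simp only: GL2_real_pos_def deth mem_Collect_eq)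
    show "(k, u) \<in> carrier calK" by (rule k)
    have "sqrt (det h) = t / of_rat r" 
      using abs_of_pos[OF r(4)] by (simp only: deth real_sqrt_abs)
    thus "x = pair_mult (calG_of_rat (q', r)) (calG_inf_fin h (k, u))"
      using r by (simp add: x G s pair_mult_def calG_of_rat_def calG_inf_fin_def
          adele_matrix_of_rat_eq adele_matrix_mult gh gk adele_of_rat_def)
  qed
qed

section \<open>The modular group and its reductions\<close>

lemma group_SL2Z: "group SL2Z"
proof (rule groupI)
  fix x assume "x \<in> carrier SL2Z"
  hence x: "det x = 1" by (simp add: SL2Z_def)
  obtain a b c d where A: "x = mat2 a b c d" by (rule mat2_cases)
  have "mat2 d (- b) (- c) a ** x = mat 1" "det (mat2 d (- b) (- c) a) = 1"
    using x by (simp_all add: A mat2_mult mat_1_eq_mat2 det_mat2 algebra_simps)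
  thus "\<exists>y\<in>carrier SL2Z. y \<otimes>\<^bsub>SL2Z\<^esub> x = \<one>\<^bsub>SL2Z\<^esub>"
    by (auto simp: SL2Z_def)
qed (auto simp: SL2Z_def det_mul matrix_mul_assoc)

lemma SL2Z_carrier: "\<gamma> \<in> carrier SL2Z \<longleftrightarrow> det \<gamma> = 1"
  by (simp add: SL2Z_def)

lemma SL2Z_mult [simp]: "x \<otimes>\<^bsub>SL2Z\<^esub> y = x ** y" "\<one>\<^bsub>SL2Z\<^esub> = mat 1"
  by (simp_all add: SL2Z_def)

lemma subgroup_Gamma0: "subgroup (Gamma0 N) SL2Z"
proof -
  interpret group SL2Z by (rule group_SL2Z)
  show ?thesis
  proof (rule subgroupI)
    have "mat 1 \<in> Gamma0 N" by (simp add: Gamma0_def SL2Z_carrier mat_1_eq_mat2 det_mat2)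
    thus "Gamma0 N \<noteq> {}" by blast
  next
    fix x assume x: "x \<in> Gamma0 N"
    obtain a b c d where A: "x = mat2 a b c d" by (rule mat2_cases)
    have "mat2 d (- b) (- c) a ** x = mat 1" "det (mat2 d (- b) (- c) a) = 1"
      using x by (simp_all add: A Gamma0_def SL2Z_carrier mat2_mult mat_1_eq_mat2 det_mat2 algebra_simps)
    hence "inv\<^bsub>SL2Z\<^esub> x = mat2 d (- b) (- c) a"
      using x by (intro inv_equality) (auto simp: Gamma0_def SL2Z_carrier)
    thus "inv\<^bsub>SL2Z\<^esub> x \<in> Gamma0 N"
      using x by (simp add: A Gamma0_def SL2Z_carrier det_mat2 mult.commute)
  next
    fix x y assume "x \<in> Gamma0 N" "y \<in> Gamma0 N"
    moreover have "(x ** y) $ 2 $ 1 = x $ 2 $ 1 * y $ 1 $ 1 + x $ 2 $ 2 * y $ 2 $ 1"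
      by (simp add: matrix_matrix_mult_def sum_2)
    ultimately show "x \<otimes>\<^bsub>SL2Z\<^esub> y \<in> Gamma0 N"
      by (simp add: Gamma0_def SL2Z_carrier det_mul)
  qed (auto simp: Gamma0_def)
qed

lemma SL2Z_rcoset_some:
  assumes C: "C \<in> rcosets\<^bsub>SL2Z\<^esub> (Gamma0 N)"
  shows "(SOME \<gamma>. \<gamma> \<in> C) \<in> carrier SL2Z" "C = Gamma0 N #>\<^bsub>SL2Z\<^esub> (SOME \<gamma>. \<gamma> \<in> C)"
proof -
  interpret S: group SL2Z by (rule group_SL2Z)
  obtain \<delta> where \<delta>: "\<delta> \<in> carrier SL2Z" "C = Gamma0 N #>\<^bsub>SL2Z\<^esub> \<delta>"
    using C by (auto simp: RCOSETS_def)
  hence "\<delta> \<in> C" using S.rcos_self[OF _ subgroup_Gamma0] by blast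
  hence some: "(SOME \<gamma>. \<gamma> \<in> C) \<in> C" by (rule someI)
  thus "(SOME \<gamma>. \<gamma> \<in> C) \<in> carrier SL2Z"
    using \<delta> subgroup.elemrcos_carrier[OF subgroup_Gamma0 group_SL2Z] by blast
  show "C = Gamma0 N #>\<^bsub>SL2Z\<^esub> (SOME \<gamma>. \<gamma> \<in> C)"
    using S.repr_independence[OF _ \<delta>(1) subgroup_Gamma0] some \<delta>(2) by blast
qed

text \<open>For \<open>k\<close> take the product of the primes that divide \<open>c\<close> but not \<open>d\<close>: each prime factor of \<open>c\<close> then
  divides exactly one of \<open>d\<close> and \<open>N k\<close>.\<close>

lemma coprime_in_progression:
  fixes c d N :: int
  assumes "c \<noteq> 0" and "\<And>p. prime p \<Longrightarrow> p dvd c \<Longrightarrow> p dvd d \<Longrightarrow> \<not> p dvd N"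
  shows "\<exists>k. coprime c (d + N * k)"
proof -
  define k where "k = \<Prod>{p \<in> prime_factors c. \<not> p dvd d}"
  have dvd_k: "p dvd k \<longleftrightarrow> \<not> p dvd d" if p: "prime p" "p dvd c" for p
  proof
    assume "p dvd k"
    then obtain q where "q \<in> prime_factors c" "\<not> q dvd d" "p dvd q"
      using p by (auto simp: k_def prime_dvd_prod_iff)
    moreover from this have "p = q" using p by (auto intro!: primes_dvd_imp_eq)
    ultimately show "\<not> p dvd d" by simp
  next
    assume "\<not> p dvd d"
    thus "p dvd k" using p assms(1) unfolding k_def
      by (intro dvd_prodI) (auto simp: in_prime_factors_iff)
  qed
  have "coprime c (d + N * k)"
  proof (rule ccontr)
    assume "\<not> coprime c (d + N * k)"
    hence "\<not> is_unit (gcd c (d + N * k))" by (simp add: coprime_iff_gcd_eq_1)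
    moreover have "gcd c (d + N * k) \<noteq> 0" using assms(1) by simp
    ultimately obtain p where p: "prime p" "p dvd c" "p dvd d + N * k"
      using prime_divisor_exists[of "gcd c (d + N * k)"] by auto
    show False
    proof (cases "p dvd d")
      case True
      hence "p dvd N * k" using p(3) by (simp add: dvd_add_right_iff)
      hence "p dvd N \<or> p dvd k" using p(1) by (simp add: prime_dvd_mult_iff)
      thus False using True p dvd_k assms(2) by blast
    next
      case False
      hence "p dvd N * k" using dvd_k p by simp
      hence "p dvd d" using p(3) by (metis add_diff_cancel_right' dvd_diff)
      thus False using False by blast
    qed
  qed
  thus ?thesis by blast
qed

text \<open>The lower row is changed modulo \<open>N\<close> into a coprime pair; Bezout coefficients of that pair then
  correct the upper row by multiples of \<open>N\<close> so that the determinant becomes 1.\<close>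

lemma SL2Z_reduction_surjective:
  fixes a b c d :: int
  assumes N: "N > 0" and det: "[a * d - b * c = 1] (mod int N)"
  obtains \<gamma> where "\<gamma> \<in> carrier SL2Z" "[\<gamma> $ 1 $ 1 = a] (mod int N)" "[\<gamma> $ 1 $ 2 = b] (mod int N)"
    "[\<gamma> $ 2 $ 1 = c] (mod int N)" "[\<gamma> $ 2 $ 2 = d] (mod int N)"
proof -
  \<comment> \<open>A non-zero lower left entry, as required for having only finitely many primes to avoid.\<close>
  define c' where "c' = (if c = 0 then int N else c)"
  have c': "c' \<noteq> 0" "[c' = c] (mod int N)" using N by (auto simp: c'_def cong_def)
  have det': "[a * d - b * c' = 1] (mod int N)"
    using cong_diff[OF cong_refl[of "a * d"] cong_mult[OF cong_refl[of b] c'(2)]] det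
    by (rule cong_trans)
  have "\<exists>k. coprime c' (d + int N * k)"
  proof (rule coprime_in_progression[OF c'(1)], rule notI)
    fix p assume p: "prime p" "p dvd c'" "p dvd d" "p dvd int N"
    have "[a * d - b * c' = 1] (mod p)" using det' p(4) by (rule cong_dvd_modulus)
    hence "p dvd (a * d - b * c') - 1" by (simp add: cong_iff_dvd_diff)
    moreover have "p dvd a * d - b * c'" using p by simp
    ultimately have "p dvd (a * d - b * c') - ((a * d - b * c') - 1)" by (rule dvd_diff[rotated])
    hence "p dvd 1" by simp
    thus False using p(1) by (simp add: not_prime_unit)
  qed
  then obtain k where k: "coprime c' (d + int N * k)" by blast
  define d' where "d' = d + int N * k"
  have d': "[d' = d] (mod int N)" by (simp add: d'_def cong_def)
  have "[a * d' - b * c' = 1] (mod int N)"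
    using cong_diff[OF cong_mult[OF cong_refl[of a] d'] cong_refl[of "b * c'"]] det'
    by (rule cong_trans)
  then obtain m where m: "1 - (a * d' - b * c') = int N * m"
    by (metis cong_iff_dvd_diff cong_sym dvdE)
  obtain x y where xy: "c' * x + d' * y = 1"
    using k bezout_int[of c' d'] by (auto simp: d'_def mult.commute)
  define \<gamma> where "\<gamma> = mat2 (a + int N * (m * y)) (b - int N * (m * x)) c' d'"
  have "det \<gamma> = (a * d' - b * c') + int N * m * (c' * x + d' * y)"
    by (simp add: \<gamma>_def det_mat2 algebra_simps)
  hence "det \<gamma> = 1" using m xy by simp
  thus ?thesis using c' d' by (intro that[of \<gamma>]) (auto simp: \<gamma>_def SL2Z_carrier cong_iff_dvd_diff)
qed

section \<open>Integrality of sums of roots of unity\<close>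

lemma e2pi_add: "e2pi (x + y) = e2pi x * e2pi y"
  by (simp add: e2pi_def distrib_left exp_add)

lemma e2pi_0 [simp]: "e2pi 0 = 1"
  by (simp add: e2pi_def)

lemma e2pi_of_int [simp]: "e2pi (of_int n) = 1"
  using exp_integer_2pi[of "of_int n"] by (simp add: e2pi_def mult.commute mult.left_commute)

lemma e2pi_Ints: "x \<in> \<int> \<Longrightarrow> e2pi x = 1"
  by (auto elim!: Ints_cases)

lemma e2pi_cong: "x - y \<in> \<int> \<Longrightarrow> e2pi x = e2pi y"
  using e2pi_add[of "x - y" y] e2pi_Ints[of "x - y"] by simp

lemma e2pi_power: "e2pi x ^ n = e2pi (of_nat n * x)"
  by (simp add: e2pi_def exp_of_nat_mult[symmetric] mult_ac)

lemma norm_e2pi [simp]: "norm (e2pi x) = 1"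
  by (simp add: e2pi_def)

lemma cnj_e2pi: "cnj (e2pi x) = e2pi (- x)"
  by (simp add: e2pi_def exp_cnj)

lemma sum_e2pi_multiples:
  assumes "N > 0" "m dvd N"
  shows "(\<Sum>j | j < N \<and> m dvd j. e2pi (of_int i * real j / real N)) \<in> \<int>"
proof -
  obtain k where k: "N = m * k" using assms by blast
  have mk: "m > 0" "k > 0" using assms k by auto
  define z where "z = e2pi (of_int i * real m / real N)"
  have zk: "z ^ k = 1" using mk by (simp add: z_def e2pi_power k)
  have "(\<Sum>j | j < N \<and> m dvd j. e2pi (of_int i * real j / real N)) = (\<Sum>t<k. z ^ t)"
  proof (rule sum.reindex_bij_witness[of _ "\<lambda>t. m * t" "\<lambda>j. j div m"])
    fix j assume "j \<in> {j. j < N \<and> m dvd j}"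
    thus "j div m \<in> {..<k}" "m * (j div m) = j" using mk k by auto
    show "z ^ (j div m) = e2pi (of_int i * real j / real N)"
    proof -
      have "real j = real m * real (j div m)"
        using \<open>j \<in> _\<close> by (metis (mono_tags, lifting) dvd_mult_div_cancel mem_Collect_eq of_nat_mult)
      thus ?thesis by (simp add: z_def e2pi_power mult_ac)
    qed
  qed (use mk k in auto)
  also have "\<dots> \<in> \<int>"
  proof (cases "z = 1")
    case False
    thus ?thesis using geometric_sum[OF False, of k] zk by simp
  qed simp
  finally show ?thesis .
qed

text \<open>Ramanujan sums are integers: prime by prime, the condition that \<open>p\<close> does not divide \<open>j\<close> is
  removed by subtracting the sum over the multiples of \<open>p\<close>.\<close>

lemma sum_e2pi_sieve:
  assumes "finite S" "N > 0" "m * \<Prod>S dvd N" "\<And>p. p \<in> S \<Longrightarrow> prime p \<and> \<not> p dvd m"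
  shows "(\<Sum>j | j < N \<and> m dvd j \<and> (\<forall>p\<in>S. \<not> p dvd j). e2pi (of_int i * real j / real N)) \<in> \<int>"
  using assms
proof (induction S arbitrary: m rule: finite_induct)
  case empty
  thus ?case using sum_e2pi_multiples[of N m i] by simp
next
  case (insert p S)
  let ?f = "\<lambda>j. e2pi (of_int i * real j / real N)"
  let ?A = "\<lambda>m. {j. j < N \<and> m dvd j \<and> (\<forall>p\<in>S. \<not> p dvd j)}"
  have p: "prime p" "\<not> p dvd m" using insert.prems(3)[of p] by auto
  have "m * \<Prod>S dvd N" "(m * p) * \<Prod>S dvd N"
    using insert.prems(2) insert.hyps by (auto simp: ac_simps dvd_mult_left intro: dvd_mult_right)
  moreover have "prime q \<and> \<not> q dvd m * p" if "q \<in> S" for q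
    using insert.prems(3)[of q] that p(1) insert.hyps
    by (auto simp: prime_dvd_mult_iff dest: primes_dvd_imp_eq)
  ultimately have "sum ?f (?A m) \<in> \<int>" "sum ?f (?A (m * p)) \<in> \<int>"
    using insert.IH[of m] insert.IH[of "m * p"] insert.prems by auto
  moreover have "?A (m * p) = {j \<in> ?A m. p dvd j}"
  proof -
    have "coprime m p" using p by (metis coprime_commute prime_imp_coprime)
    hence "m * p dvd j \<longleftrightarrow> m dvd j \<and> p dvd j" for j
      by (meson divides_mult dvd_mult_left dvd_mult_right)
    thus ?thesis by auto
  qed
  hence "sum ?f (?A m - ?A (m * p)) = sum ?f (?A m) - sum ?f (?A (m * p))"
    by (intro sum_diff) auto
  moreover have "?A m - ?A (m * p) = {j. j < N \<and> m dvd j \<and> (\<forall>q\<in>insert p S. \<not> q dvd j)}"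
    using \<open>?A (m * p) = _\<close> by auto
  ultimately show ?case by simp
qed

lemma sum_e2pi_units:
  assumes "N > 0"
  shows "(\<Sum>j | j < N \<and> coprime j N. e2pi (of_int i * real j / real N)) \<in> \<int>"
proof -
  have "\<Prod>(prime_factors N) dvd N"
  proof -
    have "(\<Prod>p\<in>prime_factors N. p) dvd (\<Prod>p\<in>prime_factors N. p ^ multiplicity p N)"
    proof (rule prod_dvd_prod)
      fix p assume "p \<in> prime_factors N"
      hence "multiplicity p N > 0" using prime_factors_multiplicity by blast
      thus "p dvd p ^ multiplicity p N" by (intro dvd_power) auto
    qed
    thus ?thesis using prod_prime_factors[of N] assms by simp
  qed
  moreover have "coprime j N \<longleftrightarrow> (\<forall>p\<in>prime_factors N. \<not> p dvd j)" for j
  proof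
    assume "coprime j N"
    thus "\<forall>p\<in>prime_factors N. \<not> p dvd j"
      by (auto simp: in_prime_factors_iff) (meson coprime_common_divisor not_prime_unit)
  next
    assume *: "\<forall>p\<in>prime_factors N. \<not> p dvd j"
    show "coprime j N"
    proof (rule ccontr)
      assume "\<not> coprime j N"
      hence "gcd j N \<noteq> 1" using coprime_iff_gcd_eq_1 by blast
      then obtain p where "prime p" "p dvd gcd j N" using prime_factor_nat by blast
      thus False using * assms by (auto simp: in_prime_factors_iff)
    qed
  qed
  moreover have "prime p \<and> \<not> p dvd 1" if "p \<in> prime_factors N" for p
    using that by (auto simp: in_prime_factors_iff)
  ultimately show ?thesis
    using sum_e2pi_sieve[of "prime_factors N" N 1 i] assms by simp
qed

text \<open>Sums of \<open>N\<close>-th roots of unity are treated as values of integer polynomials: congruences become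
  divisibilities of polynomials, and one polynomial yields an identity at all conjugates at once.\<close>

definition eval_at :: "complex \<Rightarrow> int poly \<Rightarrow> complex" where
  "eval_at z P = poly (map_poly of_int P) z"

lemma eval_at_hom [simp]:
  "eval_at z (P + Q) = eval_at z P + eval_at z Q"
  "eval_at z (P * Q) = eval_at z P * eval_at z Q"
  "eval_at z 1 = 1" "eval_at z 0 = 0" "eval_at z (Polynomial.monom 1 n) = z ^ n"
proof -
  have "map_poly of_int (P + Q) = map_poly of_int P + (map_poly of_int Q :: complex poly)"
    by (rule poly_eqI) (simp add: coeff_map_poly)
  thus "eval_at z (P + Q) = eval_at z P + eval_at z Q" by (simp add: eval_at_def)
  have "map_poly of_int (P * Q) = map_poly of_int P * (map_poly of_int Q :: complex poly)"
    by (rule poly_eqI) (simp add: coeff_map_poly coeff_mult)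
  thus "eval_at z (P * Q) = eval_at z P * eval_at z Q" by (simp add: eval_at_def)
qed (simp_all add: eval_at_def map_poly_monom poly_monom)

lemma eval_at_sum [simp]: "eval_at z (sum P A) = (\<Sum>a\<in>A. eval_at z (P a))"
  by (induction A rule: infinite_finite_induct) simp_all

lemma eval_at_power [simp]: "eval_at z (P ^ n) = eval_at z P ^ n"
  by (induction n) simp_all

lemma eval_at_of_nat [simp]: "eval_at z (of_nat n) = of_nat n"
  by (induction n) simp_all

lemma eval_at_of_int [simp]: "eval_at z (of_int n) = of_int n"
  by (simp add: eval_at_def of_int_poly map_poly_pCons)

lemma sum_eval_at_units:
  assumes "N > 0"
  shows "(\<Sum>j | j < N \<and> coprime j N. eval_at (e2pi (real j / real N)) P) \<in> \<int>"
proof -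
  have "eval_at (e2pi (real j / real N)) P
      = (\<Sum>i\<le>Polynomial.degree (map_poly of_int P :: complex poly).
          of_int (Polynomial.coeff P i) * e2pi (of_int (int i) * real j / real N))" for j
    by (simp add: eval_at_def poly_altdef coeff_map_poly e2pi_power)
  hence "(\<Sum>j | j < N \<and> coprime j N. eval_at (e2pi (real j / real N)) P)
      = (\<Sum>i\<le>Polynomial.degree (map_poly of_int P :: complex poly). of_int (Polynomial.coeff P i) *
          (\<Sum>j | j < N \<and> coprime j N. e2pi (of_int (int i) * real j / real N)))"
    by (simp add: sum_distrib_left) (rule sum.swap)
  also have "\<dots> \<in> \<int>"
    by (intro Ints_sum Ints_mult Ints_of_int sum_e2pi_units[OF assms])
  finally show ?thesis .
qed

text \<open>The powers of the fraction \<open>n/m\<close> have a common denominator \<open>c\<close>, so the reduced denominator is 1.\<close>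

lemma dvd_if_powers_dvd:
  fixes m n c :: int
  assumes "m > 0" "c > 0" "\<And>k. m ^ k dvd c * n ^ k"
  shows "m dvd n"
proof -
  define g where "g = gcd m n"
  have g0: "g > 0" using assms by (simp add: g_def)
  hence "gcd m n \<noteq> 0" by (simp add: g_def)
  from gcd_coprime_exists[OF this]
  obtain m' n' where g: "m = m' * g" "n = n' * g" "coprime m' n'"
    unfolding g_def by blast
  have m': "m' > 0" using g(1) g0 assms(1) by (simp add: zero_less_mult_iff)
  have dvd: "m' ^ k dvd c" for k
  proof -
    have "m' ^ k * g ^ k dvd (c * n' ^ k) * g ^ k"
      using assms(3)[of k] by (simp add: g power_mult_distrib mult.assoc)
    hence "m' ^ k dvd c * n' ^ k" using g0 by simp
    moreover have "coprime (m' ^ k) (n' ^ k)" using g(3) by simp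
    ultimately show ?thesis by (simp add: coprime_dvd_mult_left_iff)
  qed
  have "m' = 1"
  proof (rule ccontr)
    assume "m' \<noteq> 1"
    hence "m' \<ge> 2" using m' by simp
    have "c < 2 ^ nat c"
      using of_nat_less_two_power[of "nat c", where 'a = int] assms(2) by simp
    also have "(2 :: int) ^ nat c \<le> m' ^ nat c" using \<open>m' \<ge> 2\<close> by (intro power_mono) auto
    also have "\<dots> \<le> c" using dvd assms(2) by (intro zdvd_imp_le) auto
    finally show False by simp
  qed
  thus ?thesis by (simp add: g)
qed

text \<open>If all conjugates of an element of \<open>\<int>[\<zeta>]\<close> equal \<open>n/m\<close>, the traces of its powers are the integers
  \<open>\<phi>(N) (n/m)\<^sup>k\<close>, so the denominators of the powers of \<open>n/m\<close> are bounded.\<close>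

lemma rational_cyclotomic_integer:
  assumes N: "N > 0" and m: "m > 0"
    and eq: "\<And>j. j < N \<Longrightarrow> coprime j N \<Longrightarrow> of_int m * eval_at (e2pi (real j / real N)) P = of_int n"
  shows "m dvd n"
proof (rule dvd_if_powers_dvd[OF m])
  let ?U = "{j. j < N \<and> coprime j N}"
  show "0 < int (card ?U)"
  proof -
    have "(if N = 1 then 0 else 1) \<in> ?U" using N by auto
    thus ?thesis by (auto simp: card_gt_0_iff)
  qed
  show "m ^ k dvd int (card ?U) * n ^ k" for k
  proof -
    obtain z where z: "(\<Sum>j\<in>?U. eval_at (e2pi (real j / real N)) (P ^ k)) = of_int z"
      using sum_eval_at_units[OF N, of "P ^ k"] by (auto elim: Ints_cases)
    have "of_int (m ^ k * z) = (\<Sum>j\<in>?U. (of_int m * eval_at (e2pi (real j / real N)) P) ^ k)"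
      using arg_cong[OF z, of "\<lambda>x. of_int m ^ k * x"]
      by (simp add: sum_distrib_left power_mult_distrib)
    also have "\<dots> = (\<Sum>j\<in>?U. of_int n ^ k)" using eq by (intro sum.cong) auto
    also have "\<dots> = of_int (int (card ?U) * n ^ k)" by simp
    finally have "m ^ k * z = int (card ?U) * n ^ k" by (simp only: of_int_eq_iff)
    thus ?thesis by (metis dvd_triv_left)
  qed
qed

text \<open>The Frobenius map is additive modulo \<open>p\<close>.\<close>

lemma sum_power_prime_dvd:
  fixes x :: "'b \<Rightarrow> 'a :: comm_ring_1"
  assumes p: "prime p" and "finite A"
  shows "of_nat p dvd (\<Sum>a\<in>A. x a) ^ p - (\<Sum>a\<in>A. x a ^ p)"
  using assms(2)
proof (induction A rule: finite_induct)
  case empty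
  thus ?case using prime_gt_0_nat[OF p] by (simp add: zero_power)
next
  case (insert a A)
  let ?s = "\<Sum>a\<in>A. x a"
  have p0: "p > 0" using p prime_gt_0_nat by blast
  have "(x a + ?s) ^ p = (\<Sum>k\<le>p. of_nat (p choose k) * x a ^ k * ?s ^ (p - k))"
    by (rule binomial_ring)
  also have "{..p} = insert 0 (insert p {0<..<p})" using p0 by auto
  also have "(\<Sum>k\<in>\<dots>. of_nat (p choose k) * x a ^ k * ?s ^ (p - k))
      = ?s ^ p + (x a ^ p + (\<Sum>k\<in>{0<..<p}. of_nat (p choose k) * x a ^ k * ?s ^ (p - k)))"
    using p0 by simp
  finally have "(x a + ?s) ^ p - x a ^ p - ?s ^ p
      = (\<Sum>k\<in>{0<..<p}. of_nat (p choose k) * x a ^ k * ?s ^ (p - k))" by simp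
  also have "of_nat p dvd \<dots>"
  proof (intro dvd_sum dvd_mult2)
    fix k assume "k \<in> {0<..<p}"
    hence "p dvd p choose k" using p by (auto intro!: dvd_choose_prime)
    thus "(of_nat p :: 'a) dvd of_nat (p choose k)" by (auto elim!: dvdE)
  qed
  finally have "of_nat p dvd ((x a + ?s) ^ p - x a ^ p - ?s ^ p) + (?s ^ p - (\<Sum>a\<in>A. x a ^ p))"
    using insert.IH by (rule dvd_add)
  thus ?case using insert.hyps by (simp add: algebra_simps)
qed

section \<open>Jacobi symbols\<close>

lemma Legendre_cong: "[a = b] (mod p) \<Longrightarrow> Legendre a p = Legendre b p"
proof -
  assume ab: "[a = b] (mod p)"
  hence "[x = a] (mod p) \<longleftrightarrow> [x = b] (mod p)" for x
    using cong_trans cong_sym by blast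
  moreover have "[a = 0] (mod p) \<longleftrightarrow> [b = 0] (mod p)"
    using ab cong_trans cong_sym by blast
  ultimately show ?thesis by (simp add: Legendre_def QuadRes_def)
qed

lemma Legendre_values: "Legendre a p \<in> {0, 1, -1}"
  by (simp add: Legendre_def)

text \<open>This turns congruences between signs into equalities.\<close>

lemma cong_unit_values:
  fixes a b :: int
  assumes "p > 2" "[a = b] (mod int p)" "a \<in> {0, 1, -1}" "b \<in> {0, 1, -1}"
  shows "a = b"
  using assms by (auto simp: cong_iff_dvd_diff zdvd_not_zless dest: zdvd_imp_le)

lemma Legendre_mult:
  assumes p: "prime p" "2 < p"
  shows "Legendre (a * b) (int p) = Legendre a (int p) * Legendre b (int p)"
proof (rule cong_unit_values[OF p(2)])
  have "[Legendre (a * b) (int p) = (a * b) ^ ((p - 1) div 2)] (mod int p)"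
    by (rule euler_criterion[OF p])
  also have "(a * b) ^ ((p - 1) div 2) = a ^ ((p - 1) div 2) * b ^ ((p - 1) div 2)"
    by (rule power_mult_distrib)
  also have "[\<dots> = Legendre a (int p) * Legendre b (int p)] (mod int p)"
    by (intro cong_mult cong_sym[OF euler_criterion[OF p]])
  finally show "[Legendre (a * b) (int p) = Legendre a (int p) * Legendre b (int p)] (mod int p)" .
  show "Legendre a (int p) * Legendre b (int p) \<in> {0, 1, -1}"
    using Legendre_values[of a "int p"] Legendre_values[of b "int p"] by auto
qed (rule Legendre_values)

lemma Legendre_minus_1:
  assumes p: "prime p" "2 < p"
  shows "Legendre (- 1) (int p) = (- 1) ^ ((p - 1) div 2)"
proof (rule cong_unit_values[OF p(2)])
  show "[Legendre (- 1) (int p) = (- 1) ^ ((p - 1) div 2)] (mod int p)"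
    by (rule euler_criterion[OF p])
  show "(- 1 :: int) ^ ((p - 1) div 2) \<in> {0, 1, -1}"
    by (cases "even ((p - 1) div 2)") auto
qed (rule Legendre_values)

lemma Legendre_nonzero:
  assumes "prime p" "\<not> int p dvd a" shows "Legendre a (int p) \<noteq> 0"
  using assms by (simp add: Legendre_def cong_0_iff)

text \<open>The sign \<open>e\<close> is \<open>(-1)\<^sup>(\<^sup>p\<^sup>-\<^sup>1\<^sup>)\<^sup>/\<^sup>2\<close>, whose Legendre symbol modulo \<open>l\<close> is the sign in the reciprocity law.\<close>

lemma Legendre_reciprocity:
  assumes l: "prime l" "2 < l" and p: "prime p" "2 < p" and "l \<noteq> p"
    and e: "e \<in> {1, -1}" "[e * int p = 1] (mod 4)"
  shows "Legendre (int l) (int p) = Legendre (e * int p) (int l)"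
proof -
  have r: "Legendre (int p) (int l) * Legendre (int l) (int p)
      = (- 1) ^ ((p - 1) div 2 * ((l - 1) div 2))"
    using Quadratic_Reciprocity[OF p l] assms(5) by simp
  have e_pow: "e = (- 1) ^ ((p - 1) div 2)"
  proof -
    have "odd p" using p prime_odd_nat by blast
    then obtain k where k: "p = 2 * k + 1" by (auto elim: oddE)
    show ?thesis
    proof (cases "even k")
      case True
      then obtain j where "k = 2 * j" by blast
      with e k show ?thesis by (auto simp: cong_iff_dvd_diff) presburger
    next
      case False
      then obtain j where "k = 2 * j + 1" by (auto elim: oddE)
      with e k show ?thesis by (auto simp: cong_iff_dvd_diff) presburger
    qed
  qed
  have "Legendre e (int l) = (- 1) ^ ((p - 1) div 2 * ((l - 1) div 2))"
  proof (cases "even ((p - 1) div 2)")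
    case True
    moreover have "Legendre 1 (int l) = 1"
      using l by (auto simp: Legendre_def QuadRes_def cong_0_iff intro!: exI[of _ 1])
    ultimately show ?thesis using e_pow by simp
  next
    case False
    thus ?thesis using e_pow Legendre_minus_1[OF l] by (auto simp: power_mult)
  qed
  hence "Legendre (e * int p) (int l)
      = Legendre (int p) (int l) * (Legendre (int p) (int l) * Legendre (int l) (int p))"
    using Legendre_mult[OF l, of e "int p"] r by simp
  moreover have "Legendre (int p) (int l) \<noteq> 0"
    using assms(5) l p by (intro Legendre_nonzero) (auto dest: primes_dvd_imp_eq)
  hence "Legendre (int p) (int l) * Legendre (int p) (int l) = 1"
    using Legendre_values[of "int p" "int l"] by auto
  ultimately show ?thesis by (simp flip: mult.assoc)
qed

lemma jacobi_1 [simp]: "jacobi a (Suc 0) = 1"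
  by (simp add: jacobi_def)

lemma jacobi_prime_mult:
  assumes "prime p" "n > 0" shows "jacobi a (p * n) = Legendre a (int p) * jacobi a n"
  using assms by (simp add: jacobi_def prime_factorization_mult prime_factorization_prime prime_gt_0_nat)

lemma jacobi_cong:
  assumes "[a = b] (mod int N)" "\<And>p. prime p \<Longrightarrow> p dvd n \<Longrightarrow> p dvd N"
  shows "jacobi a n = jacobi b n"
  unfolding jacobi_def
proof (rule arg_cong[of _ _ prod_mset], rule image_mset_cong)
  fix p assume "p \<in># prime_factorization n"
  hence "p dvd N" using assms(2) by (auto simp: in_prime_factors_iff)
  thus "Legendre a (int p) = Legendre b (int p)"
    using assms(1) by (intro Legendre_cong) (auto intro: cong_dvd_modulus)
qed

lemma jacobi_mult:
  assumes "odd n" shows "jacobi (a * b) n = jacobi a n * jacobi b n"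
proof -
  have "jacobi (a * b) n = (\<Prod>p\<in>#prime_factorization n. Legendre a (int p) * Legendre b (int p))"
    unfolding jacobi_def
  proof (rule arg_cong[of _ _ prod_mset], rule image_mset_cong)
    fix p assume "p \<in># prime_factorization n"
    hence p: "prime p" "p dvd n" by (auto simp: in_prime_factors_iff)
    hence "p \<noteq> 2" using assms by auto
    hence "2 < p" using prime_ge_2_nat[OF p(1)] by simp
    thus "Legendre (a * b) (int p) = Legendre a (int p) * Legendre b (int p)"
      using p Legendre_mult by blast
  qed
  thus ?thesis by (simp add: jacobi_def prod_mset.distrib)
qed

text \<open>The integers \<open>\<plusminus>n \<equiv> 1\<close> modulo 4 are closed under multiplication, so both sides are multiplicative
  in \<open>n\<close>, which reduces the claim to prime \<open>n\<close>.\<close>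

lemma jacobi_reciprocity:
  assumes l: "prime l" "2 < l" and n: "odd n" "\<not> l dvd n"
    and e: "e \<in> {1, -1}" "[e * int n = 1] (mod 4)"
  shows "jacobi (int l) n = Legendre (e * int n) (int l)"
  using n e
proof (induction n arbitrary: e rule: less_induct)
  case (less n)
  show ?case
  proof (cases "n = 1")
    case True
    with less.prems have "e = 1" by (auto simp: cong_iff_dvd_diff)
    moreover have "Legendre 1 (int l) = 1"
      using l by (auto simp: Legendre_def QuadRes_def cong_0_iff intro!: exI[of _ 1])
    ultimately show ?thesis using True by simp
  next
    case False
    then obtain p where p: "prime p" "p dvd n" using prime_factor_nat by blast
    then obtain m where m: "n = p * m" by blast
    have n0: "n > 0" using less.prems by (cases n) auto
    have m0: "m > 0" "m < n" using m n0 prime_gt_1_nat[OF p(1)] by auto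
    have odd: "odd p" "odd m" using less.prems m by auto
    have p2: "2 < p" using odd(1) prime_ge_2_nat[OF p(1)] by (cases "p = 2") auto
    define s where "s x = (if [int x = 1] (mod 4) then 1 else - 1 :: int)" for x :: nat
    have s: "s x \<in> {1, -1}" "[s x * int x = 1] (mod 4)" if "odd x" for x
      using that unfolding s_def cong_iff_dvd_diff by (simp, auto) presburger+
    have "e = s p * s m"
    proof -
      have "[(s p * int p) * (s m * int m) = 1 * 1] (mod 4)"
        using s odd by (intro cong_mult) auto
      hence "[(s p * s m) * int n = e * int n] (mod 4)"
        using less.prems(4) by (simp add: m ac_simps) (metis cong_sym cong_trans)
      moreover have "coprime (int n) 4"
        using less.prems(1) coprime_power_right_iff[of "int n" 2 2] by simp
      ultimately have "[s p * s m = e] (mod 4)" using cong_mult_rcancel by blast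
      thus ?thesis using s(1)[OF odd(1)] s(1)[OF odd(2)] less.prems(3)
        by (auto simp: cong_iff_dvd_diff)
    qed
    moreover have "jacobi (int l) m = Legendre (s m * int m) (int l)"
      using less.prems s[OF odd(2)] m odd by (intro less.IH[OF m0(2)]) auto
    moreover have "Legendre (int l) (int p) = Legendre (s p * int p) (int l)"
      using s[OF odd(1)] p p2 l less.prems m by (intro Legendre_reciprocity) auto
    ultimately show ?thesis
      using Legendre_mult[OF l, of "s p * int p" "s m * int m"] jacobi_prime_mult[OF p(1) m0(1)]
      by (simp add: m ac_simps)
  qed
qed

section \<open>The discriminant group and its Gauss sums\<close>

lemma SL2Z_S_T [simp]: "mat2 0 (- 1) 1 0 \<in> carrier SL2Z" "mat2 1 n 0 1 \<in> carrier SL2Z"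
  by (simp_all add: SL2Z_carrier det_mat2)

lemma SL2Z_mult_closed: "x \<in> carrier SL2Z \<Longrightarrow> y \<in> carrier SL2Z \<Longrightarrow> x ** y \<in> carrier SL2Z"
  by (simp add: SL2Z_carrier det_mul)

locale weil_lattice =
  fixes L :: "'v::real_vector set" and B :: "'v \<Rightarrow> 'v \<Rightarrow> real"
    and \<rho> :: "int^2^2 \<Rightarrow> ('v set \<Rightarrow> complex) \<Rightarrow> ('v set \<Rightarrow> complex)"
  assumes lat: "even_lattice L B" and weil: "weil_representation L B \<rho>"
begin

abbreviation "D \<equiv> disc L B"
abbreviation "M \<equiv> dual_lattice L B"
abbreviation "N \<equiv> level L B"
abbreviation "GA \<equiv> group_algebra L B"

definition coset :: "'v \<Rightarrow> 'v set" where "coset x = {x + l | l. l \<in> L}"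

text \<open>The representative at which \<open>disc_form\<close> evaluates.\<close>

definition rep :: "'v set \<Rightarrow> 'v" where "rep \<mu> = (SOME x. x \<in> \<mu>)"

lemma L_closed:
  "0 \<in> L" "x \<in> L \<Longrightarrow> y \<in> L \<Longrightarrow> x + y \<in> L" "x \<in> L \<Longrightarrow> of_int k *\<^sub>R x \<in> L"
proof -
  obtain E where E: "finite E" "L = {\<Sum>b\<in>E. real_of_int (c b) *\<^sub>R b | c :: 'v \<Rightarrow> int. True}"
    using lat by (auto simp: even_lattice_def is_lattice_def)
  have mem: "(\<Sum>b\<in>E. real_of_int (c b) *\<^sub>R b) \<in> L" for c using E by blast
  show "0 \<in> L" using mem[of "\<lambda>_. 0"] by simp
  show "x + y \<in> L" if "x \<in> L" "y \<in> L"
  proof -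
    obtain c d where "x = (\<Sum>b\<in>E. real_of_int (c b) *\<^sub>R b)" "y = (\<Sum>b\<in>E. real_of_int (d b) *\<^sub>R b)"
      using \<open>x \<in> L\<close> \<open>y \<in> L\<close> E by blast
    hence "x + y = (\<Sum>b\<in>E. real_of_int (c b + d b) *\<^sub>R b)"
      by (simp add: scaleR_left_distrib sum.distrib)
    thus ?thesis using mem[of "\<lambda>b. c b + d b"] by simp
  qed
  show "of_int k *\<^sub>R x \<in> L" if "x \<in> L"
  proof -
    obtain c where "x = (\<Sum>b\<in>E. real_of_int (c b) *\<^sub>R b)" using \<open>x \<in> L\<close> E by blast
    hence "of_int k *\<^sub>R x = (\<Sum>b\<in>E. real_of_int (k * c b) *\<^sub>R b)"
      by (simp add: scaleR_sum_right)
    thus ?thesis using mem[of "\<lambda>b. k * c b"] by simp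
  qed
qed

lemma L_minus: "x \<in> L \<Longrightarrow> - x \<in> L" "x \<in> L \<Longrightarrow> y \<in> L \<Longrightarrow> x - y \<in> L"
  using L_closed(3)[of _ "- 1"] L_closed(2)[of x "- y"] L_closed(3)[of y "- 1"] by auto

lemma bilin: "bilinear B" and B_commute: "B x y = B y x"
  and B_L: "x \<in> L \<Longrightarrow> y \<in> L \<Longrightarrow> B x y \<in> \<int>" and q_L: "x \<in> L \<Longrightarrow> B x x / 2 \<in> \<int>"
  using lat by (auto simp: even_lattice_def)

lemmas B_simps = bilinear_ladd[OF bilin] bilinear_radd[OF bilin] bilinear_lmul[OF bilin]
  bilinear_rmul[OF bilin] bilinear_lneg[OF bilin] bilinear_rneg[OF bilin]
  bilinear_lsub[OF bilin] bilinear_rsub[OF bilin] bilinear_lzero[OF bilin] bilinear_rzero[OF bilin]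

lemma M_closed:
  "0 \<in> M" "x \<in> L \<Longrightarrow> x \<in> M" "x \<in> M \<Longrightarrow> y \<in> M \<Longrightarrow> x + y \<in> M" "x \<in> M \<Longrightarrow> y \<in> M \<Longrightarrow> x - y \<in> M"
  "x \<in> M \<Longrightarrow> of_int k *\<^sub>R x \<in> M" "x \<in> M \<Longrightarrow> - x \<in> M"
  by (auto simp: dual_lattice_def B_simps span_zero span_base B_L
      intro: span_add span_diff span_scale span_neg)

lemma M_scale_nat: "x \<in> M \<Longrightarrow> real n *\<^sub>R x \<in> M"
  using M_closed(5)[of x "int n"] by simp

lemma B_M: "x \<in> M \<Longrightarrow> y \<in> L \<Longrightarrow> B x y \<in> \<int>" "x \<in> L \<Longrightarrow> y \<in> M \<Longrightarrow> B x y \<in> \<int>"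
  using B_commute by (auto simp: dual_lattice_def)

lemma disc_eq: "D = coset ` M"
  by (auto simp: disc_def coset_def)

lemma coset_in_D: "x \<in> M \<Longrightarrow> coset x \<in> D"
  by (simp add: disc_eq)

lemma coset_self: "x \<in> coset x"
  using L_closed(1) by (force simp: coset_def)

lemma coset_eq_iff: "coset x = coset y \<longleftrightarrow> x - y \<in> L"
proof
  assume "coset x = coset y"
  hence "x \<in> coset y" using coset_self by blast
  thus "x - y \<in> L" by (auto simp: coset_def)
next
  assume xy: "x - y \<in> L"
  have sub: "coset a \<subseteq> coset b" if "a - b \<in> L" for a b
  proof
    fix z assume "z \<in> coset a"
    then obtain l where "l \<in> L" "z = b + ((a - b) + l)" by (auto simp: coset_def)
    thus "z \<in> coset b" unfolding coset_def using that L_closed(2) by blast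
  qed
  show "coset x = coset y"
    using sub[OF xy] sub[of y x] L_minus(1)[OF xy] by simp
qed

lemma coset_0: "coset 0 = L"
  by (auto simp: coset_def)

lemma L_in_D: "L \<in> D"
  using coset_in_D[OF M_closed(1)] by (simp add: coset_0)

lemma rep_coset: "rep (coset x) - x \<in> L"
proof -
  have "rep (coset x) \<in> coset x" unfolding rep_def using coset_self by (rule someI)
  thus ?thesis by (auto simp: coset_def)
qed

lemma rep_D: assumes "\<mu> \<in> D" shows "rep \<mu> \<in> M" "coset (rep \<mu>) = \<mu>"
proof -
  obtain x where x: "x \<in> M" "\<mu> = coset x" using assms by (auto simp: disc_eq)
  have "rep \<mu> = x + (rep (coset x) - x)" by (simp add: x)
  thus "rep \<mu> \<in> M" using x M_closed(2,3) rep_coset by metis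
  show "coset (rep \<mu>) = \<mu>" using rep_coset[of x] by (simp add: x coset_eq_iff)
qed

lemma disc_form_rep: "disc_form B \<mu> \<nu> = B (rep \<mu>) (rep \<nu>)"
  by (simp add: disc_form_def rep_def)

lemma B_coset_cong:
  assumes "x \<in> M" "y \<in> M" "x - x' \<in> L" "y - y' \<in> L"
  shows "B x y - B x' y' \<in> \<int>"
proof -
  have "x' = x - (x - x')" by simp
  hence "x' \<in> M" using assms M_closed by metis
  hence "B (x - x') y + B x' (y - y') \<in> \<int>" using assms B_M by (intro Ints_add) auto
  thus ?thesis by (simp add: B_simps)
qed

lemma q_coset_cong:
  assumes "x \<in> M" "x - x' \<in> L"
  shows "B x x / 2 - B x' x' / 2 \<in> \<int>"
proof -
  have "B x (x - x') - B (x - x') (x - x') / 2 \<in> \<int>"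
    using assms B_M q_L by (intro Ints_diff) auto
  moreover have "B x (x - x') - B (x - x') (x - x') / 2 = B x x / 2 - B x' x' / 2"
    using B_commute[of x x'] by (simp add: B_simps field_simps)
  ultimately show ?thesis by simp
qed

lemma e2pi_form:
  assumes "x \<in> M" "y \<in> M"
  shows "e2pi (disc_form B (coset x) (coset y)) = e2pi (B x y)"
proof (rule e2pi_cong)
  have "B x y - B (rep (coset x)) (rep (coset y)) \<in> \<int>"
    using assms L_minus(1)[OF rep_coset] by (intro B_coset_cong) auto
  thus "disc_form B (coset x) (coset y) - B x y \<in> \<int>"
    by (metis disc_form_rep minus_diff_eq Ints_minus)
qed

lemma e2pi_q:
  assumes "x \<in> M"
  shows "e2pi (of_int r * disc_q B (coset x)) = e2pi (of_int r * (B x x / 2))"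
proof (rule e2pi_cong)
  have "B x x / 2 - B (rep (coset x)) (rep (coset x)) / 2 \<in> \<int>"
    using assms L_minus(1)[OF rep_coset, of x] by (intro q_coset_cong) auto
  hence "of_int (- r) * (B x x / 2 - B (rep (coset x)) (rep (coset x)) / 2) \<in> \<int>"
    by (intro Ints_mult) auto
  thus "of_int r * disc_q B (coset x) - of_int r * (B x x / 2) \<in> \<int>"
    by (simp add: disc_form_rep disc_q_def algebra_simps)
qed

lemma e2pi_form_L [simp]: "\<mu> \<in> D \<Longrightarrow> e2pi (disc_form B L \<mu>) = 1" "\<mu> \<in> D \<Longrightarrow> e2pi (disc_form B \<mu> L) = 1"
  using e2pi_form[OF M_closed(1), of "rep \<mu>"] e2pi_form[OF _ M_closed(1), of "rep \<mu>"] rep_D[of \<mu>]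
  by (simp_all add: coset_0 B_simps)

lemma e2pi_q_L [simp]: "e2pi (of_int r * disc_q B L) = 1"
  using e2pi_q[OF M_closed(1), of r] by (simp add: coset_0 B_simps)

lemma basis_GA [simp]: "\<nu> \<in> D \<Longrightarrow> basis_vec \<nu> \<in> GA"
  by (auto simp: group_algebra_def basis_vec_def)

abbreviation "SS \<equiv> mat2 0 (- 1) 1 0 :: int^2^2"
abbreviation "TT n \<equiv> mat2 1 n 0 1 :: int^2^2"

definition weil_const :: complex where
  "weil_const = e2pi (of_int (lattice_sig L B) / 8) / of_real (sqrt (real (card D)))"

lemma rho_GA: "\<gamma> \<in> carrier SL2Z \<Longrightarrow> u \<in> GA \<Longrightarrow> \<rho> \<gamma> u \<in> GA"
  using weil unfolding weil_representation_def by blast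

lemma rho_linear:
  "\<gamma> \<in> carrier SL2Z \<Longrightarrow> u \<in> GA \<Longrightarrow> v \<in> GA \<Longrightarrow>
   \<rho> \<gamma> (\<lambda>\<mu>. a * u \<mu> + b * v \<mu>) = (\<lambda>\<mu>. a * \<rho> \<gamma> u \<mu> + b * \<rho> \<gamma> v \<mu>)"
  using weil unfolding weil_representation_def by blast

lemma rho_one: "u \<in> GA \<Longrightarrow> \<rho> (mat 1) u = u"
  using weil unfolding weil_representation_def by blast

lemma rho_mult:
  "\<gamma> \<in> carrier SL2Z \<Longrightarrow> \<delta> \<in> carrier SL2Z \<Longrightarrow> u \<in> GA \<Longrightarrow> \<rho> (\<gamma> ** \<delta>) u = \<rho> \<gamma> (\<rho> \<delta> u)"
  using weil unfolding weil_representation_def by blast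

lemma rho_herm:
  "\<gamma> \<in> carrier SL2Z \<Longrightarrow> u \<in> GA \<Longrightarrow> v \<in> GA \<Longrightarrow> herm L B (\<rho> \<gamma> u) (\<rho> \<gamma> v) = herm L B u v"
  using weil unfolding weil_representation_def by blast

lemma rho_T: "\<nu> \<in> D \<Longrightarrow> \<rho> (TT 1) (basis_vec \<nu>) = (\<lambda>\<mu>. e2pi (- disc_q B \<nu>) * basis_vec \<nu> \<mu>)"
  using weil unfolding weil_representation_def by blast

lemma rho_S: "\<nu> \<in> D \<Longrightarrow>
   \<rho> SS (basis_vec \<nu>) = (\<lambda>\<eta>. weil_const * (\<Sum>\<mu>\<in>D. e2pi (disc_form B \<nu> \<mu>) * basis_vec \<mu> \<eta>))"
  using weil unfolding weil_representation_def weil_const_def by blast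

lemma rho_cong:
  "\<gamma> \<in> carrier SL2Z \<Longrightarrow> \<delta> \<in> carrier SL2Z \<Longrightarrow> (\<And>i j. [\<gamma> $ i $ j = \<delta> $ i $ j] (mod int N)) \<Longrightarrow>
   u \<in> GA \<Longrightarrow> \<rho> \<gamma> u = \<rho> \<delta> u"
  using weil unfolding weil_representation_def by blast

lemma rho_scale: "\<gamma> \<in> carrier SL2Z \<Longrightarrow> u \<in> GA \<Longrightarrow> \<rho> \<gamma> (\<lambda>\<mu>. a * u \<mu>) = (\<lambda>\<mu>. a * \<rho> \<gamma> u \<mu>)"
  using rho_linear[of \<gamma> u u a 0] by simp

lemma rho_sum:
  assumes "\<gamma> \<in> carrier SL2Z" "\<And>i. i \<in> I \<Longrightarrow> u i \<in> GA"
  shows "\<rho> \<gamma> (\<lambda>\<mu>. \<Sum>i\<in>I. a i * u i \<mu>) = (\<lambda>\<mu>. \<Sum>i\<in>I. a i * \<rho> \<gamma> (u i) \<mu>)"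
  using assms
proof (induction I rule: infinite_finite_induct)
  case (insert i I)
  have "(\<lambda>\<mu>. \<Sum>i\<in>I. a i * u i \<mu>) \<in> GA"
    using insert by (auto simp: group_algebra_def intro!: sum.neutral)
  thus ?case using insert rho_linear[of \<gamma> "u i" "\<lambda>\<mu>. \<Sum>i\<in>I. a i * u i \<mu>" "a i" 1] by simp
qed (use rho_linear[OF assms(1) basis_GA[OF L_in_D] basis_GA[OF L_in_D], of 0 0] in simp_all)

text \<open>If \<open>D\<close> were infinite, the sum defining \<open>\<rho>(S)\<close> would vanish, although \<open>S\<close> acts invertibly.\<close>

lemma finite_D: "finite D"
proof (rule ccontr)
  assume inf: "infinite D"
  have e: "basis_vec L \<in> GA" using L_in_D by simp
  have z: "\<rho> SS (basis_vec L) = (\<lambda>\<mu>. 0 * basis_vec L \<mu>)"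
    using rho_S[OF L_in_D] inf by simp
  have z0: "\<rho> \<gamma> (\<lambda>\<mu>. 0 * basis_vec L \<mu>) = (\<lambda>_. 0)" if "\<gamma> \<in> carrier SL2Z" for \<gamma>
    using rho_scale[OF that e, of 0] by simp
  define \<gamma> where "\<gamma> = SS ** (SS ** SS)"
  have c: "\<gamma> \<in> carrier SL2Z" by (simp add: \<gamma>_def SL2Z_mult_closed)
  have "\<gamma> ** SS = mat 1" by (simp add: \<gamma>_def mat2_mult mat_1_eq_mat2)
  hence "\<rho> (mat 1) (basis_vec L) = (\<lambda>_. 0)"
    using rho_mult[OF c SL2Z_S_T(1) e] z z0[OF c] by simp
  hence "basis_vec L = (\<lambda>_. 0)" using rho_one[OF e] by simp
  hence "basis_vec L L = 0" by simp
  thus False by (simp add: basis_vec_def)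
qed

lemma card_D: "card D > 0"
  using finite_D L_in_D by (auto simp: card_gt_0_iff)

lemma GA_expand: "u \<in> GA \<Longrightarrow> u = (\<lambda>\<mu>. \<Sum>\<nu>\<in>D. u \<nu> * basis_vec \<nu> \<mu>)"
  using finite_D by (auto simp: basis_vec_def group_algebra_def if_distrib cong: if_cong)

lemma sum_basis: "(\<Sum>\<mu>\<in>D. f \<mu> * basis_vec \<mu> \<eta>) = (if \<eta> \<in> D then f \<eta> else 0)"
  using finite_D by (auto simp: basis_vec_def if_distrib cong: if_cong)

lemma S_apply:
  assumes "u \<in> GA"
  shows "\<rho> SS u = (\<lambda>\<eta>. if \<eta> \<in> D then weil_const * (\<Sum>\<nu>\<in>D. u \<nu> * e2pi (disc_form B \<nu> \<eta>)) else 0)"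
proof -
  have "\<rho> SS u = (\<lambda>\<eta>. \<Sum>\<nu>\<in>D. u \<nu> * \<rho> SS (basis_vec \<nu>) \<eta>)"
    by (subst GA_expand[OF assms]) (rule rho_sum, simp_all)
  also have "\<dots> = (\<lambda>\<eta>. \<Sum>\<nu>\<in>D. u \<nu> * (weil_const * (if \<eta> \<in> D then e2pi (disc_form B \<nu> \<eta>) else 0)))"
    by (simp add: rho_S sum_basis)
  finally show ?thesis by (auto simp: sum_distrib_left mult_ac fun_eq_iff)
qed

lemma T_apply:
  assumes "u \<in> GA"
  shows "\<rho> (TT (int n)) u = (\<lambda>\<eta>. e2pi (- of_nat n * disc_q B \<eta>) * u \<eta>)"
  using assms
proof (induction n arbitrary: u)
  case 0
  thus ?case using rho_one[of u] by (simp add: mat_1_eq_mat2)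
next
  case (Suc n)
  have "\<rho> (TT 1) u = (\<lambda>\<eta>. \<Sum>\<nu>\<in>D. u \<nu> * \<rho> (TT 1) (basis_vec \<nu>) \<eta>)"
    by (subst GA_expand[OF Suc.prems]) (rule rho_sum, simp_all)
  also have "\<dots> = (\<lambda>\<eta>. \<Sum>\<nu>\<in>D. (u \<nu> * e2pi (- disc_q B \<nu>)) * basis_vec \<nu> \<eta>)"
    by (simp add: rho_T mult.assoc)
  also have "\<dots> = (\<lambda>\<eta>. e2pi (- disc_q B \<eta>) * u \<eta>)"
    using Suc.prems unfolding sum_basis by (auto simp: fun_eq_iff group_algebra_def)
  finally have T1: "\<rho> (TT 1) u = (\<lambda>\<eta>. e2pi (- disc_q B \<eta>) * u \<eta>)" .
  have "TT (int (Suc n)) = TT (int n) ** TT 1" by (simp add: mat2_mult)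
  hence "\<rho> (TT (int (Suc n))) u = \<rho> (TT (int n)) (\<rho> (TT 1) u)"
    using rho_mult[OF SL2Z_S_T(2) SL2Z_S_T(2) Suc.prems] by metis
  also have "\<dots> = (\<lambda>\<eta>. e2pi (- of_nat n * disc_q B \<eta>) * (e2pi (- disc_q B \<eta>) * u \<eta>))"
    using Suc.IH[OF rho_GA[OF SL2Z_S_T(2) Suc.prems, of 1]] by (simp add: T1)
  finally show ?case by (simp add: algebra_simps flip: e2pi_add mult.assoc)
qed

lemma norm_weil_const: "weil_const * cnj weil_const = 1 / of_nat (card D)"
proof -
  have "norm weil_const = 1 / sqrt (real (card D))" by (simp add: weil_const_def norm_divide)
  hence n: "(norm weil_const)\<^sup>2 = 1 / real (card D)" by (simp add: power_divide)
  have "weil_const * cnj weil_const = of_real ((norm weil_const)\<^sup>2)" by (simp only: complex_norm_square)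
  thus ?thesis by (simp only: n) simp
qed

text \<open>Unitarity of \<open>\<rho>(S)\<close> is the orthogonality of characters, so the form on \<open>D\<close> is non-degenerate.\<close>

lemma form_orthogonality:
  assumes "\<eta> \<in> D"
  shows "(\<Sum>\<mu>\<in>D. e2pi (disc_form B \<eta> \<mu>)) = (if \<eta> = L then of_nat (card D) else 0)"
proof -
  have S: "\<rho> SS (basis_vec \<nu>) \<mu> = weil_const * e2pi (disc_form B \<nu> \<mu>)" if "\<nu> \<in> D" "\<mu> \<in> D" for \<nu> \<mu>
    using that by (simp add: rho_S sum_basis)
  have "herm L B (\<rho> SS (basis_vec \<eta>)) (\<rho> SS (basis_vec L)) = herm L B (basis_vec \<eta>) (basis_vec L)"
    using assms L_in_D by (intro rho_herm) auto
  also have "herm L B (basis_vec \<eta>) (basis_vec L) = (\<Sum>\<mu>\<in>D. if \<mu> = L then (if L = \<eta> then 1 else 0) else 0)"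
    unfolding herm_def by (intro sum.cong) (auto simp: basis_vec_def)
  also have "\<dots> = (if \<eta> = L then 1 else 0)"
    using finite_D L_in_D by simp
  also have "herm L B (\<rho> SS (basis_vec \<eta>)) (\<rho> SS (basis_vec L))
      = (\<Sum>\<mu>\<in>D. (weil_const * cnj weil_const) * e2pi (disc_form B \<eta> \<mu>))"
    unfolding herm_def using assms L_in_D by (intro sum.cong) (auto simp: S mult_ac)
  also have "\<dots> = (\<Sum>\<mu>\<in>D. e2pi (disc_form B \<eta> \<mu>)) / of_nat (card D)"
    by (simp add: norm_weil_const sum_divide_distrib)
  finally show ?thesis using card_D by (auto simp: field_simps split: if_splits)
qed

lemma nondegenerate:
  assumes "x \<in> M" "\<And>y. y \<in> M \<Longrightarrow> B x y \<in> \<int>" shows "x \<in> L"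
proof -
  have "e2pi (disc_form B (coset x) \<mu>) = 1" if "\<mu> \<in> D" for \<mu>
    using e2pi_form[OF assms(1), of "rep \<mu>"] rep_D[OF that] assms(2) by (simp add: e2pi_Ints)
  hence "(\<Sum>\<mu>\<in>D. e2pi (disc_form B (coset x) \<mu>)) = of_nat (card D)" by simp
  hence "coset x = coset 0"
    using form_orthogonality[OF coset_in_D[OF assms(1)]] card_D
    by (auto simp: coset_0 split: if_splits)
  thus "x \<in> L" by (simp add: coset_eq_iff)
qed

text \<open>Two of the first \<open>|D| + 1\<close> multiples of \<open>x\<close> lie in the same coset of \<open>L\<close>.\<close>

lemma M_torsion:
  assumes x: "x \<in> M" obtains m where "m > 0" "m \<le> card D" "of_int (int m) *\<^sub>R x \<in> L"
proof -
  have "\<not> inj_on (\<lambda>i. coset (of_int (int i) *\<^sub>R x)) {..card D}"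
  proof
    assume "inj_on (\<lambda>i. coset (of_int (int i) *\<^sub>R x)) {..card D}"
    hence "card {..card D} \<le> card D"
      using x by (intro card_inj_on_le[OF _ _ finite_D]) (auto intro!: coset_in_D M_scale_nat)
    thus False by simp
  qed
  then obtain i j where ij: "i < j" "j \<le> card D" "coset (of_int (int i) *\<^sub>R x) = coset (of_int (int j) *\<^sub>R x)"
    by (auto simp: inj_on_def) (metis linorder_neqE_nat)
  hence "of_int (int j) *\<^sub>R x - of_int (int i) *\<^sub>R x \<in> L" by (metis coset_eq_iff)
  thus ?thesis using ij that[of "j - i"] by (simp add: algebra_simps of_nat_diff)
qed

text \<open>The level is defined as a least number; it exists because \<open>2 |D|!\<close> clears the denominators of \<open>q\<close>.\<close>

lemma level_properties: "N > 0" "x \<in> M \<Longrightarrow> real N * (B x x / 2) \<in> \<int>"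
proof -
  have "\<exists>n. n > 0 \<and> (\<forall>x\<in>M. real n * (B x x / 2) \<in> \<int>)"
  proof (intro exI[of _ "2 * fact (card D)"] conjI ballI)
    fix x assume x: "x \<in> M"
    obtain m where m: "m > 0" "m \<le> card D" "of_int (int m) *\<^sub>R x \<in> L" using M_torsion[OF x] .
    obtain k where k: "(fact (card D) :: nat) = m * k"
      using dvd_fact[of m "card D"] m by (auto elim: dvdE)
    have "real k * B (of_int (int m) *\<^sub>R x) x \<in> \<int>" using m x B_M by (intro Ints_mult) auto
    moreover have "real (fact (card D)) = real m * real k" by (simp only: k of_nat_mult)
    ultimately show "real (2 * fact (card D)) * (B x x / 2) \<in> \<int>" by (simp add: B_simps mult_ac)
  qed simp
  from LeastI_ex[OF this]
  show "N > 0" "x \<in> M \<Longrightarrow> real N * (B x x / 2) \<in> \<int>" by (auto simp: level_def)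
qed

lemma level_B: assumes "x \<in> M" "y \<in> M" shows "real N * B x y \<in> \<int>"
proof -
  have "real N * (B (x + y) (x + y) / 2) - real N * (B x x / 2) - real N * (B y y / 2) \<in> \<int>"
    using assms M_closed by (intro Ints_diff level_properties) auto
  thus ?thesis using B_commute[of x y] by (simp add: B_simps field_simps)
qed

text \<open>\<open>N (x, y)\<close> is integral by polarization, so \<open>N x\<close> lies in the radical of the form on \<open>D\<close>.\<close>

lemma level_annihilates: "x \<in> M \<Longrightarrow> of_int (int N) *\<^sub>R x \<in> L"
proof (rule nondegenerate)
  assume x: "x \<in> M"
  thus "of_int (int N) *\<^sub>R x \<in> M" by (rule M_closed)
  show "B (of_int (int N) *\<^sub>R x) y \<in> \<int>" if "y \<in> M" for y
    using level_B[OF x that] by (simp add: B_simps)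
qed

abbreviation "gs \<equiv> gauss_sum L B"

lemma gs_rep: "gs r = (\<Sum>\<mu>\<in>D. e2pi (of_int r * (B (rep \<mu>) (rep \<mu>) / 2)))"
  by (simp add: gauss_sum_def disc_q_def disc_form_rep)

lemma e2pi_q_cong:
  assumes "x \<in> M" "[r = s] (mod int N)"
  shows "e2pi (of_int r * (B x x / 2)) = e2pi (of_int s * (B x x / 2))"
proof (rule e2pi_cong)
  obtain k where k: "r - s = int N * k" using assms by (auto simp: cong_iff_dvd_diff)
  have "of_int k * (real N * (B x x / 2)) \<in> \<int>"
    using level_properties(2)[OF assms(1)] by (rule Ints_mult[OF Ints_of_int])
  moreover have "of_int r * (B x x / 2) - of_int s * (B x x / 2) = of_int (r - s) * (B x x / 2)"
    by (simp add: left_diff_distrib)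
  hence "of_int r * (B x x / 2) - of_int s * (B x x / 2) = of_int k * (real N * (B x x / 2))"
    by (simp add: k)
  ultimately show "of_int r * (B x x / 2) - of_int s * (B x x / 2) \<in> \<int>" by (simp only:)
qed

lemma gs_cong: "[r = s] (mod int N) \<Longrightarrow> gs r = gs s"
  unfolding gs_rep by (intro sum.cong refl e2pi_q_cong rep_D)

text \<open>Completing the square in \<open>-r q(\<nu>) + (\<nu>, \<eta>)\<close> by the translation \<open>\<nu> \<mapsto> \<nu> + s \<eta>\<close>, where \<open>r s \<equiv> 1\<close>.\<close>

lemma gauss_complete_square:
  assumes rs: "[r * s = 1] (mod int N)" and y: "\<eta> \<in> D"
  shows "(\<Sum>\<nu>\<in>D. e2pi (- of_int r * disc_q B \<nu>) * e2pi (disc_form B \<nu> \<eta>))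
       = gs (- r) * e2pi (of_int s * disc_q B \<eta>)"
proof -
  let ?y = "rep \<eta>"
  have yM: "?y \<in> M" using rep_D[OF y] by simp
  define t where "t \<nu> = coset (rep \<nu> + of_int s *\<^sub>R ?y)" for \<nu>
  have tM: "rep \<nu> + of_int s *\<^sub>R ?y \<in> M" if "\<nu> \<in> D" for \<nu>
    using rep_D[OF that] yM M_closed by auto
  have "inj_on t D"
  proof
    fix \<mu> \<nu> assume *: "\<mu> \<in> D" "\<nu> \<in> D" "t \<mu> = t \<nu>"
    hence "rep \<mu> - rep \<nu> \<in> L" by (simp add: t_def coset_eq_iff)
    thus "\<mu> = \<nu>" using rep_D * coset_eq_iff by metis
  qed
  moreover have tD: "t ` D \<subseteq> D" using tM by (auto simp: t_def intro: coset_in_D)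
  ultimately have bij: "bij_betw t D D"
    using endo_inj_surj[OF finite_D] by (auto simp: bij_betw_def)
  obtain k where k: "r * s = 1 + int N * k"
    using rs by (metis cong_iff_lin mult.commute cong_sym)
  have summand: "e2pi (- of_int r * disc_q B (t \<nu>)) * e2pi (disc_form B (t \<nu>) \<eta>)
      = e2pi (of_int (- r) * disc_q B \<nu>) * e2pi (of_int s * disc_q B \<eta>)" if \<nu>: "\<nu> \<in> D" for \<nu>
  proof -
    let ?x = "rep \<nu>" and ?z = "rep \<nu> + of_int s *\<^sub>R rep \<eta>"
    have xM: "?x \<in> M" using rep_D[OF \<nu>] by simp
    have "e2pi (- of_int r * disc_q B (t \<nu>)) * e2pi (disc_form B (t \<nu>) \<eta>)
        = e2pi (of_int (- r) * (B ?z ?z / 2)) * e2pi (B ?z ?y)"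
      using e2pi_q[OF tM[OF \<nu>], of "- r"] e2pi_form[OF tM[OF \<nu>] yM] rep_D[OF y] by (simp add: t_def)
    also have "\<dots> = e2pi (of_int (- r) * (B ?z ?z / 2) + B ?z ?y)" by (simp only: e2pi_add)
    also have "\<dots> = e2pi (of_int (- r) * (B ?x ?x / 2) + of_int s * (B ?y ?y / 2))"
    proof (rule e2pi_cong)
      have rs': "real_of_int r * real_of_int s = 1 + real N * real_of_int k"
        using arg_cong[OF k, of real_of_int] by simp
      have "of_int (- r) * (B ?z ?z / 2) + B ?z ?y
            - (of_int (- r) * (B ?x ?x / 2) + of_int s * (B ?y ?y / 2))
          = (1 - of_int r * of_int s) * B ?x ?y + of_int s * (1 - of_int r * of_int s) * (B ?y ?y / 2)"
        using B_commute[of ?x ?y] by (simp add: B_simps field_simps)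
      also have "\<dots> = of_int (- k) * (real N * B ?x ?y) + of_int (- s * k) * (real N * (B ?y ?y / 2))"
        by (simp add: rs')
      also have "\<dots> \<in> \<int>"
        by (intro Ints_add Ints_mult[OF Ints_of_int] level_B[OF xM yM] level_properties(2)[OF yM])
      finally show "of_int (- r) * (B ?z ?z / 2) + B ?z ?y
            - (of_int (- r) * (B ?x ?x / 2) + of_int s * (B ?y ?y / 2)) \<in> \<int>" .
    qed
    finally show ?thesis by (simp only: e2pi_add disc_q_def disc_form_rep)
  qed
  have "(\<Sum>\<nu>\<in>D. e2pi (- of_int r * disc_q B \<nu>) * e2pi (disc_form B \<nu> \<eta>))
      = (\<Sum>\<nu>\<in>D. e2pi (- of_int r * disc_q B (t \<nu>)) * e2pi (disc_form B (t \<nu>) \<eta>))"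
    by (rule sum.reindex_bij_betw[OF bij, symmetric])
  also have "\<dots> = (\<Sum>\<nu>\<in>D. e2pi (of_int (- r) * disc_q B \<nu>) * e2pi (of_int s * disc_q B \<eta>))"
    by (rule sum.cong[OF refl summand])
  finally show ?thesis by (simp add: gauss_sum_def sum_distrib_right)
qed

text \<open>The scalar of \<open>rho_diagonal\<close>; the identity matrix will show that it equals \<open>1/g(D)\<close>.\<close>

definition diagonal_factor :: complex where "diagonal_factor = weil_const ^ 3 * of_nat (card D)"

text \<open>\<open>S\<close> spreads \<open>\<e>\<^sub>0\<close> evenly over \<open>D\<close>; applying \<open>T\<^sup>r\<close> and \<open>S\<close> yields a Gauss sum and the phase \<open>e(s q)\<close>, by
  completing the square; \<open>T\<^sup>s\<close> removes this phase; and the last \<open>S\<close> collects the constant vector at \<open>\<e>\<^sub>0\<close>, which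
  \<open>T\<^sup>r\<close> fixes.\<close>

lemma diagonal_word:
  assumes rs: "[int r * int s = 1] (mod int N)"
  defines "\<gamma> \<equiv> TT (int r) ** (SS ** (TT (int s) ** (SS ** (TT (int r) ** SS))))"
  shows "\<rho> \<gamma> (basis_vec L) = (\<lambda>\<eta>. diagonal_factor * gs (- int r) * basis_vec L \<eta>)"
    and "\<gamma> \<in> carrier SL2Z"
    and "[\<gamma> $ 1 $ 1 = - int r] (mod int N)" "[\<gamma> $ 1 $ 2 = 0] (mod int N)"
        "[\<gamma> $ 2 $ 1 = 0] (mod int N)" "[\<gamma> $ 2 $ 2 = - int s] (mod int N)"
proof -
  let ?e = "basis_vec L"
  let ?d = "\<lambda>\<eta>. if \<eta> \<in> D then 1 else 0 :: complex"
  note [simp] = SL2Z_mult_closed rho_GA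
  let ?w2 = "TT (int r) ** SS"
  let ?w3 = "SS ** ?w2"
  let ?w4 = "TT (int s) ** ?w3"
  let ?w5 = "SS ** ?w4"
  have e: "?e \<in> GA" using L_in_D by simp
  show "\<gamma> \<in> carrier SL2Z" by (simp add: \<gamma>_def)
  have v1: "\<rho> SS ?e = (\<lambda>\<eta>. weil_const * ?d \<eta>)"
    unfolding rho_S[OF L_in_D] sum_basis by (auto simp: fun_eq_iff)
  have v2: "\<rho> ?w2 ?e = (\<lambda>\<eta>. weil_const * (?d \<eta> * e2pi (- of_int (int r) * disc_q B \<eta>)))"
    using T_apply[OF rho_GA[OF SL2Z_S_T(1) e]] e by (simp add: rho_mult v1 mult_ac)
  have v3: "\<rho> ?w3 ?e
      = (\<lambda>\<eta>. weil_const ^ 2 * gs (- int r) * (?d \<eta> * e2pi (of_int (int s) * disc_q B \<eta>)))"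
  proof -
    have "\<rho> ?w3 ?e = \<rho> SS (\<rho> ?w2 ?e)"
      using e by (intro rho_mult) auto
    also have "\<dots> = (\<lambda>\<eta>. if \<eta> \<in> D then weil_const * (\<Sum>\<nu>\<in>D. \<rho> ?w2 ?e \<nu> * e2pi (disc_form B \<nu> \<eta>)) else 0)"
      using e by (intro S_apply) simp
    also have "\<dots> = (\<lambda>\<eta>. if \<eta> \<in> D then weil_const * (weil_const * (\<Sum>\<nu>\<in>D. e2pi (- of_int (int r) * disc_q B \<nu>)
        * e2pi (disc_form B \<nu> \<eta>))) else 0)"
      unfolding v2 by (auto simp: sum_distrib_left fun_eq_iff intro!: sum.cong)
    finally show ?thesis
      using gauss_complete_square[OF rs] by (auto simp: fun_eq_iff power2_eq_square)
  qed
  have v4: "\<rho> ?w4 ?e = (\<lambda>\<eta>. weil_const ^ 2 * gs (- int r) * ?d \<eta>)"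
  proof -
    have "\<rho> ?w4 ?e = \<rho> (TT (int s)) (\<rho> ?w3 ?e)"
      using e by (intro rho_mult) auto
    also have "\<dots> = (\<lambda>\<eta>. e2pi (- of_nat s * disc_q B \<eta>) * \<rho> ?w3 ?e \<eta>)"
      using e by (intro T_apply) simp
    also have "\<dots> = (\<lambda>\<eta>. weil_const ^ 2 * gs (- int r) * ?d \<eta>)"
    proof
      fix \<eta>
      have "e2pi (- of_nat s * disc_q B \<eta>) * e2pi (of_int (int s) * disc_q B \<eta>) = 1"
        by (simp flip: e2pi_add)
      thus "e2pi (- of_nat s * disc_q B \<eta>) * \<rho> ?w3 ?e \<eta> = weil_const ^ 2 * gs (- int r) * ?d \<eta>"
        by (simp add: v3 mult_ac)
    qed
    finally show ?thesis .
  qed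
  have v5: "\<rho> ?w5 ?e = (\<lambda>\<eta>. diagonal_factor * gs (- int r) * ?e \<eta>)"
  proof -
    have "\<rho> ?w5 ?e
        = \<rho> SS (\<rho> ?w4 ?e)"
      using e by (intro rho_mult) auto
    also have "\<dots> = (\<lambda>\<eta>. if \<eta> \<in> D then weil_const * (\<Sum>\<nu>\<in>D. \<rho> ?w4 ?e \<nu>
        * e2pi (disc_form B \<nu> \<eta>)) else 0)"
      using e by (intro S_apply) simp
    also have "\<dots> = (\<lambda>\<eta>. diagonal_factor * gs (- int r) * ?e \<eta>)"
    proof
      fix \<eta>
      have "(\<Sum>\<nu>\<in>D. \<rho> ?w4 ?e \<nu> * e2pi (disc_form B \<nu> \<eta>))
          = weil_const ^ 2 * gs (- int r) * (\<Sum>\<nu>\<in>D. e2pi (disc_form B \<eta> \<nu>))"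
        unfolding v4 using B_commute by (auto simp: sum_distrib_left disc_form_rep intro!: sum.cong)
      thus "(if \<eta> \<in> D then weil_const * (\<Sum>\<nu>\<in>D. \<rho> ?w4 ?e \<nu>
          * e2pi (disc_form B \<nu> \<eta>)) else 0) = diagonal_factor * gs (- int r) * ?e \<eta>"
        using L_in_D by (auto simp: form_orthogonality diagonal_factor_def basis_vec_def power3_eq_cube power2_eq_square)
    qed
    finally show ?thesis .
  qed
  have "\<rho> \<gamma> ?e = \<rho> (TT (int r)) (\<rho> ?w5 ?e)"
    using e unfolding \<gamma>_def by (intro rho_mult) auto
  also have "\<dots> = (\<lambda>\<eta>. e2pi (- of_nat r * disc_q B \<eta>) *
      \<rho> ?w5 ?e \<eta>)"
    using e by (intro T_apply) simp
  also have "\<dots> = (\<lambda>\<eta>. diagonal_factor * gs (- int r) * ?e \<eta>)"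
    using e2pi_q_L[of "- int r"] unfolding v5 by (auto simp: basis_vec_def fun_eq_iff)
  finally show "\<rho> \<gamma> ?e = (\<lambda>\<eta>. diagonal_factor * gs (- int r) * ?e \<eta>)" .
  have \<gamma>: "\<gamma> = mat2 ((int r * int s - 1) * int r - int r) (1 - int r * int s) (int r * int s - 1) (- int s)"
    by (simp add: \<gamma>_def mat2_mult algebra_simps)
  obtain k where k: "int r * int s = 1 + int N * k"
    using rs by (metis cong_iff_lin mult.commute cong_sym)
  show "[\<gamma> $ 1 $ 1 = - int r] (mod int N)" "[\<gamma> $ 1 $ 2 = 0] (mod int N)"
        "[\<gamma> $ 2 $ 1 = 0] (mod int N)" "[\<gamma> $ 2 $ 2 = - int s] (mod int N)"
    by (auto simp: \<gamma> k cong_iff_dvd_diff)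
qed

lemma rho_diagonal:
  assumes \<gamma>: "\<gamma> \<in> carrier SL2Z" and off: "[\<gamma> $ 1 $ 2 = 0] (mod int N)" "[\<gamma> $ 2 $ 1 = 0] (mod int N)"
  shows "\<rho> \<gamma> (basis_vec L) = (\<lambda>\<eta>. diagonal_factor * gs (\<gamma> $ 1 $ 1) * basis_vec L \<eta>)"
proof -
  \<comment> \<open>The word for \<open>r\<close> and \<open>s\<close> is \<open>diag(-r, -s)\<close>, whence the signs.\<close>
  define r s where "r = nat ((- \<gamma> $ 1 $ 1) mod int N)" and "s = nat ((- \<gamma> $ 2 $ 2) mod int N)"
  have N0: "int N > 0" using level_properties(1) by simp
  have r: "[int r = - \<gamma> $ 1 $ 1] (mod int N)" and s: "[int s = - \<gamma> $ 2 $ 2] (mod int N)"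
    using N0 by (simp_all add: r_def s_def)
  have "\<gamma> $ 1 $ 1 * \<gamma> $ 2 $ 2 - \<gamma> $ 1 $ 2 * \<gamma> $ 2 $ 1 = 1"
    using \<gamma> by (simp add: SL2Z_carrier det_2)
  moreover have "[\<gamma> $ 1 $ 1 * \<gamma> $ 2 $ 2 - \<gamma> $ 1 $ 2 * \<gamma> $ 2 $ 1
      = \<gamma> $ 1 $ 1 * \<gamma> $ 2 $ 2 - 0 * 0] (mod int N)"
    using off by (intro cong_diff cong_mult cong_refl)
  ultimately have "[1 = \<gamma> $ 1 $ 1 * \<gamma> $ 2 $ 2] (mod int N)" by simp
  hence "[\<gamma> $ 1 $ 1 * \<gamma> $ 2 $ 2 = 1] (mod int N)" by (rule cong_sym)
  hence rs: "[int r * int s = 1] (mod int N)"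
    using cong_mult[OF r s] cong_trans by simp
  note w = diagonal_word[OF rs]
  have "\<rho> \<gamma> (basis_vec L)
      = \<rho> (TT (int r) ** (SS ** (TT (int s) ** (SS ** (TT (int r) ** SS))))) (basis_vec L)"
  proof (rule rho_cong[OF \<gamma> w(2) _ basis_GA[OF L_in_D]])
    have m: "[- int r = \<gamma> $ 1 $ 1] (mod int N)" "[- int s = \<gamma> $ 2 $ 2] (mod int N)"
      using cong_minus_minus_iff[of "int r" "- \<gamma> $ 1 $ 1" "int N"]
        cong_minus_minus_iff[of "int s" "- \<gamma> $ 2 $ 2" "int N"] r s by auto
    have "\<forall>i j. [\<gamma> $ i $ j =
        (TT (int r) ** (SS ** (TT (int s) ** (SS ** (TT (int r) ** SS))))) $ i $ j] (mod int N)"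
      unfolding forall_2
      using off m w(3-6) by (meson cong_sym cong_trans)
    thus "[\<gamma> $ i $ j =
        (TT (int r) ** (SS ** (TT (int s) ** (SS ** (TT (int r) ** SS))))) $ i $ j] (mod int N)" for i j
      by blast
  qed
  moreover have "gs (- int r) = gs (\<gamma> $ 1 $ 1)"
    using cong_minus_minus_iff[of "int r" "- \<gamma> $ 1 $ 1" "int N"] r by (intro gs_cong) simp
  ultimately show ?thesis using w(1) by simp
qed

lemma diagonal_factor_gs_1: "diagonal_factor * gs 1 = 1"
proof -
  have "\<rho> (mat 1) (basis_vec L) = (\<lambda>\<eta>. diagonal_factor * gs 1 * basis_vec L \<eta>)"
    using rho_diagonal[of "mat 1"] by (simp add: SL2Z_carrier mat_1_eq_mat2 det_mat2)
  hence "basis_vec L L = diagonal_factor * gs 1 * basis_vec L L"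
    using rho_one[OF basis_GA[OF L_in_D]] by metis
  thus ?thesis by (simp add: basis_vec_def)
qed

lemma gs_1_nonzero: "gs 1 \<noteq> 0"
  using diagonal_factor_gs_1 by auto

definition gauss_ratio :: "int \<Rightarrow> complex" where "gauss_ratio r = gs r / gs 1"

lemma diagonal_factor_gs: "diagonal_factor * gs r = gauss_ratio r"
  using diagonal_factor_gs_1 gs_1_nonzero by (simp add: gauss_ratio_def field_simps)

lemma gs_eq: "gs r = gauss_ratio r * gs 1"
  using gs_1_nonzero by (simp add: gauss_ratio_def)

lemma gauss_ratio_cong: "[r = s] (mod int N) \<Longrightarrow> gauss_ratio r = gauss_ratio s"
  by (simp add: gauss_ratio_def gs_cong)

lemma gauss_ratio_1 [simp]: "gauss_ratio 1 = 1"
  using gs_1_nonzero by (simp add: gauss_ratio_def)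

text \<open>Modulo \<open>N\<close>, an element of \<open>\<Gamma>\<^sub>0(N)\<close> is a diagonal matrix times a power of \<open>T\<close>, and \<open>T\<close> fixes \<open>\<e>\<^sub>0\<close>.\<close>

lemma rho_Gamma0:
  assumes \<gamma>: "\<gamma> \<in> Gamma0 N"
  shows "\<rho> \<gamma> (basis_vec L) = (\<lambda>\<eta>. gauss_ratio (\<gamma> $ 1 $ 1) * basis_vec L \<eta>)"
proof -
  obtain a b c d where g: "\<gamma> = mat2 a b c d" by (rule mat2_cases)
  have det: "a * d - b * c = 1" and c: "int N dvd c" and SL: "\<gamma> \<in> carrier SL2Z"
    using \<gamma> by (auto simp: Gamma0_def SL2Z_carrier g det_mat2)
  define n where "n = nat ((d * b) mod int N)"
  have n: "[int n = d * b] (mod int N)" using level_properties(1) by (simp add: n_def)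
  define \<delta> where "\<delta> = \<gamma> ** TT (- int n)"
  have \<delta>: "\<delta> = mat2 a (b - a * int n) c (d - c * int n)" by (simp add: \<delta>_def g mat2_mult)
  have \<delta>SL: "\<delta> \<in> carrier SL2Z" using SL by (simp add: \<delta>_def SL2Z_mult_closed)
  have e: "basis_vec L \<in> GA" using L_in_D by simp
  have "[b - a * int n = b - a * (d * b)] (mod int N)"
    by (intro cong_diff cong_mult cong_refl n)
  moreover have "b - a * (d * b) = - (b * b) * c"
    using arg_cong[OF det, of "\<lambda>x. b * x"] by (simp add: algebra_simps)
  ultimately have "[b - a * int n = - (b * b) * c] (mod int N)" by simp
  moreover have "[- (b * b) * c = 0] (mod int N)" using c by (simp add: cong_0_iff)
  ultimately have off: "[\<delta> $ 1 $ 2 = 0] (mod int N)" unfolding \<delta> using cong_trans by auto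
  have "\<gamma> = \<delta> ** TT (int n)" by (simp add: \<delta> g mat2_mult)
  hence "\<rho> \<gamma> (basis_vec L) = \<rho> \<delta> (\<rho> (TT (int n)) (basis_vec L))"
    using rho_mult[OF \<delta>SL SL2Z_S_T(2) e] by simp
  also have "\<rho> (TT (int n)) (basis_vec L) = basis_vec L"
    using T_apply[OF e, of n] e2pi_q_L[of "- int n"] by (auto simp: basis_vec_def fun_eq_iff)
  also have "\<rho> \<delta> (basis_vec L) = (\<lambda>\<eta>. diagonal_factor * gs (\<delta> $ 1 $ 1) * basis_vec L \<eta>)"
    using off c by (intro rho_diagonal \<delta>SL) (auto simp: \<delta> cong_0_iff)
  finally show ?thesis by (simp add: diagonal_factor_gs \<delta> g)
qed

lemma diagonal_lift:
  assumes "coprime a (int N)"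
  obtains \<gamma> where "\<gamma> \<in> carrier SL2Z" "[\<gamma> $ 1 $ 1 = a] (mod int N)"
    "[\<gamma> $ 1 $ 2 = 0] (mod int N)" "[\<gamma> $ 2 $ 1 = 0] (mod int N)"
proof -
  obtain d where "[a * d = 1] (mod int N)" using cong_solve_coprime_int[OF assms] by auto
  hence "[a * d - 0 * 0 = 1] (mod int N)" by simp
  thus ?thesis using SL2Z_reduction_surjective[OF level_properties(1)] that by blast
qed

text \<open>Multiplicativity is inherited from \<open>\<rho>\<close>, through the action of diagonal matrices on \<open>\<e>\<^sub>0\<close>.\<close>

lemma gauss_ratio_mult:
  assumes "coprime a (int N)" "coprime b (int N)"
  shows "gauss_ratio (a * b) = gauss_ratio a * gauss_ratio b"
proof -
  obtain \<gamma> where \<gamma>: "\<gamma> \<in> carrier SL2Z" "[\<gamma> $ 1 $ 1 = a] (mod int N)"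
    "[\<gamma> $ 1 $ 2 = 0] (mod int N)" "[\<gamma> $ 2 $ 1 = 0] (mod int N)" using diagonal_lift[OF assms(1)] .
  obtain \<delta> where \<delta>: "\<delta> \<in> carrier SL2Z" "[\<delta> $ 1 $ 1 = b] (mod int N)"
    "[\<delta> $ 1 $ 2 = 0] (mod int N)" "[\<delta> $ 2 $ 1 = 0] (mod int N)" using diagonal_lift[OF assms(2)] .
  have nth: "(\<gamma> ** \<delta>) $ i $ j = \<gamma> $ i $ 1 * \<delta> $ 1 $ j + \<gamma> $ i $ 2 * \<delta> $ 2 $ j" for i j
    by (simp add: matrix_matrix_mult_def sum_2)
  have off: "[(\<gamma> ** \<delta>) $ 1 $ 2 = 0] (mod int N)" "[(\<gamma> ** \<delta>) $ 2 $ 1 = 0] (mod int N)"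
    and "int N dvd \<gamma> $ 1 $ 2 * \<delta> $ 2 $ 1"
    using \<gamma> \<delta> unfolding nth cong_0_iff by auto
  hence "[(\<gamma> ** \<delta>) $ 1 $ 1 = a * b + 0] (mod int N)"
    unfolding nth using \<gamma> \<delta> by (intro cong_add cong_mult) (auto simp: cong_0_iff)
  hence "gauss_ratio ((\<gamma> ** \<delta>) $ 1 $ 1) = gauss_ratio (a * b)" by (intro gauss_ratio_cong) simp
  moreover have "gauss_ratio (\<gamma> $ 1 $ 1) = gauss_ratio a" "gauss_ratio (\<delta> $ 1 $ 1) = gauss_ratio b" using \<gamma> \<delta> gauss_ratio_cong by auto
  moreover have "\<rho> (\<gamma> ** \<delta>) (basis_vec L) = \<rho> \<gamma> (\<rho> \<delta> (basis_vec L))"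
    using \<gamma> \<delta> L_in_D by (intro rho_mult) auto
  ultimately have "(\<lambda>\<eta>. gauss_ratio (a * b) * basis_vec L \<eta>) = (\<lambda>\<eta>. gauss_ratio b * (gauss_ratio a * basis_vec L \<eta>))"
    using rho_diagonal[OF SL2Z_mult_closed[OF \<gamma>(1) \<delta>(1)] off] rho_diagonal[OF \<gamma>(1,3,4)]
      rho_diagonal[OF \<delta>(1,3,4)] rho_scale[OF \<gamma>(1) basis_GA[OF L_in_D], of "gauss_ratio b"]
    by (simp add: diagonal_factor_gs)
  from fun_cong[OF this, of L] show ?thesis by (simp add: basis_vec_def)
qed

lemma L_coprime:
  assumes "of_int a *\<^sub>R x \<in> L" "of_int b *\<^sub>R x \<in> L" "coprime a b"
  shows "x \<in> L"
proof -
  obtain u v where uv: "u * a + v * b = 1" using assms(3) bezout_int[of a b] by auto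
  have "of_int u *\<^sub>R (of_int a *\<^sub>R x) + of_int v *\<^sub>R (of_int b *\<^sub>R x) \<in> L"
    using assms L_closed by blast
  moreover have "of_int u *\<^sub>R (of_int a *\<^sub>R x) + of_int v *\<^sub>R (of_int b *\<^sub>R x) = of_int (u * a + v * b) *\<^sub>R x"
    by (simp add: scaleR_left_distrib)
  ultimately show ?thesis by (simp add: uv)
qed

lemma M_coprime: "x \<in> M \<Longrightarrow> of_int a *\<^sub>R x \<in> L \<Longrightarrow> coprime a (int N) \<Longrightarrow> x \<in> L"
  using L_coprime level_annihilates by blast

text \<open>Multiplication by \<open>r\<close> permutes \<open>D\<close> and multiplies \<open>q\<close> by \<open>r\<^sup>2\<close>.\<close>

lemma gauss_ratio_square: assumes r: "coprime r (int N)" shows "gauss_ratio r * gauss_ratio r = 1"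
proof -
  define t where "t \<mu> = coset (of_int r *\<^sub>R rep \<mu>)" for \<mu>
  have tM: "of_int r *\<^sub>R rep \<mu> \<in> M" if "\<mu> \<in> D" for \<mu> using rep_D[OF that] M_closed by blast
  have "inj_on t D"
  proof
    fix \<mu> \<nu> assume *: "\<mu> \<in> D" "\<nu> \<in> D" "t \<mu> = t \<nu>"
    have "of_int r *\<^sub>R (rep \<mu> - rep \<nu>) \<in> L"
      using *(3) by (simp add: t_def coset_eq_iff scaleR_diff_right)
    hence "rep \<mu> - rep \<nu> \<in> L"
      using M_coprime[OF M_closed(4)[OF rep_D(1)[OF *(1)] rep_D(1)[OF *(2)]] _ r] by blast
    thus "\<mu> = \<nu>" using rep_D * coset_eq_iff by metis
  qed
  moreover have "t ` D \<subseteq> D" using tM by (auto simp: t_def intro: coset_in_D)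
  ultimately have bij: "bij_betw t D D"
    using endo_inj_surj[OF finite_D] by (auto simp: bij_betw_def)
  have "gs 1 = (\<Sum>\<mu>\<in>D. e2pi (of_int 1 * disc_q B (t \<mu>)))"
    unfolding gauss_sum_def by (rule sum.reindex_bij_betw[OF bij, symmetric])
  also have "\<dots> = gs (r * r)"
    unfolding gs_rep
  proof (rule sum.cong[OF refl])
    fix \<mu> assume "\<mu> \<in> D"
    from e2pi_q[OF tM[OF this], of 1]
    show "e2pi (of_int 1 * disc_q B (t \<mu>)) = e2pi (of_int (r * r) * (B (rep \<mu>) (rep \<mu>) / 2))"
      by (simp add: t_def B_simps mult.assoc)
  qed
  finally have "gauss_ratio (r * r) = 1" using gs_1_nonzero by (simp add: gauss_ratio_def)
  thus ?thesis using gauss_ratio_mult[OF r r] by simp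
qed

text \<open>\<open>g(D)\<close> is the inverse of \<open>diagonal_factor\<close>, of absolute value \<open>|D|\<^sup>-\<^sup>1\<^sup>/\<^sup>2\<close>, and
  \<open>g\<^sub>-\<^sub>1(D)\<close> is the complex conjugate of \<open>g(D)\<close>.\<close>

lemma gs_1_mult_gs_minus_1: "gs 1 * gs (- 1) = of_nat (card D)"
proof -
  have "norm weil_const = 1 / sqrt (real (card D))" by (simp add: weil_const_def norm_divide)
  hence "norm diagonal_factor = real (card D) / sqrt (real (card D)) ^ 3"
    by (simp add: diagonal_factor_def norm_mult norm_power power_divide)
  hence "sqrt (real (card D)) * norm diagonal_factor = 1"
    using card_D by (simp add: power3_eq_cube field_simps)
  hence "norm (gs 1) = (sqrt (real (card D)) * norm diagonal_factor) * norm (gs 1)" by simp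
  also have "\<dots> = sqrt (real (card D)) * norm (diagonal_factor * gs 1)" by (simp only: norm_mult mult.assoc)
  finally have "norm (gs 1) = sqrt (real (card D))" by (simp add: diagonal_factor_gs_1)
  hence n: "(norm (gs 1))\<^sup>2 = real (card D)" by simp
  have "cnj (gs 1) = gs (- 1)" by (simp add: gauss_sum_def cnj_e2pi)
  hence "gs 1 * gs (- 1) = of_real ((norm (gs 1))\<^sup>2)" by (simp only: complex_norm_square)
  thus ?thesis by (simp only: n) simp
qed

section \<open>The prime divisors of the order of the discriminant group\<close>

definition D_group :: "'v set monoid" where
  "D_group = \<lparr>carrier = D, mult = (\<lambda>\<mu> \<nu>. coset (rep \<mu> + rep \<nu>)), one = L\<rparr>"

lemma D_group_mult:
  assumes "x \<in> M" "y \<in> M"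
  shows "coset x \<otimes>\<^bsub>D_group\<^esub> coset y = coset (x + y)"
proof -
  have "(rep (coset x) - x) + (rep (coset y) - y) \<in> L" by (intro L_closed rep_coset)
  moreover have "(rep (coset x) - x) + (rep (coset y) - y) = rep (coset x) + rep (coset y) - (x + y)"
    by simp
  ultimately show ?thesis by (simp add: D_group_def coset_eq_iff)
qed

lemma group_D_group: "group D_group"
proof (rule groupI)
  have car: "carrier D_group = coset ` M" by (simp add: D_group_def disc_eq)
  have one: "\<one>\<^bsub>D_group\<^esub> = coset 0" by (simp add: D_group_def coset_0)
  show "\<one>\<^bsub>D_group\<^esub> \<in> carrier D_group" using L_in_D by (simp add: D_group_def)
  fix x assume x: "x \<in> carrier D_group"
  then obtain a where a: "a \<in> M" "x = coset a" by (auto simp: car)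
  show "\<one>\<^bsub>D_group\<^esub> \<otimes>\<^bsub>D_group\<^esub> x = x" using a M_closed(1) by (simp add: one D_group_mult)
  show "\<exists>y\<in>carrier D_group. y \<otimes>\<^bsub>D_group\<^esub> x = \<one>\<^bsub>D_group\<^esub>"
    using a M_closed(6) by (intro bexI[of _ "coset (- a)"]) (auto simp: D_group_mult one car)
  fix y assume y: "y \<in> carrier D_group"
  then obtain b where b: "b \<in> M" "y = coset b" by (auto simp: car)
  show "x \<otimes>\<^bsub>D_group\<^esub> y \<in> carrier D_group" using a b M_closed(3) by (simp add: D_group_mult car)
  fix z assume "z \<in> carrier D_group"
  then obtain c where c: "c \<in> M" "z = coset c" by (auto simp: car)
  show "x \<otimes>\<^bsub>D_group\<^esub> y \<otimes>\<^bsub>D_group\<^esub> z = x \<otimes>\<^bsub>D_group\<^esub> (y \<otimes>\<^bsub>D_group\<^esub> z)"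
    using a b c M_closed(3) by (simp add: D_group_mult add.assoc)
qed

lemma D_group_pow: "x \<in> M \<Longrightarrow> coset x [^]\<^bsub>D_group\<^esub> (n :: nat) = coset (real n *\<^sub>R x)"
proof (induction n)
  case 0
  thus ?case by (simp add: nat_pow_def D_group_def coset_0)
next
  case (Suc n)
  interpret group D_group by (rule group_D_group)
  show ?case using Suc M_scale_nat by (simp add: D_group_mult scaleR_left_distrib add.commute)
qed

text \<open>Otherwise a Sylow subgroup would be non-trivial but killed both by a power of \<open>p\<close> and by \<open>N\<close>.\<close>

lemma prime_dvd_card_D:
  assumes p: "prime p" "p dvd card D" shows "p dvd N"
proof (rule ccontr)
  assume pN: "\<not> p dvd N"
  interpret group D_group by (rule group_D_group)
  define a where "a = multiplicity p (card D)"
  have a: "a > 0" using p card_D by (simp add: a_def prime_multiplicity_gt_zero_iff)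
  have "p ^ a dvd card D" by (simp add: a_def multiplicity_dvd)
  then obtain m where m: "card D = p ^ a * m" by blast
  have "order D_group = p ^ a * m" using m by (simp add: order_def D_group_def)
  then obtain H where H: "subgroup H D_group" "card H = p ^ a"
    using sylow_thm[OF p(1) group_D_group, of a m] finite_D by (auto simp: D_group_def)
  have "card H > 1" using H(2) one_less_power[OF prime_gt_1_nat[OF p(1)] a] by simp
  have "\<not> H \<subseteq> {L}"
  proof
    assume "H \<subseteq> {L}"
    hence "card H \<le> card {L}" by (intro card_mono) auto
    with \<open>card H > 1\<close> show False by simp
  qed
  then obtain \<mu> where \<mu>: "\<mu> \<in> H" "\<mu> \<noteq> L" by blast
  have \<mu>D: "\<mu> \<in> D" using \<mu> H subgroup.subset by (fastforce simp: D_group_def)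
  let ?x = "rep \<mu>"
  have x: "?x \<in> M" "\<mu> = coset ?x" using rep_D[OF \<mu>D] by auto
  interpret H: group "D_group\<lparr>carrier := H\<rparr>" using subgroup.subgroup_is_group[OF H(1) group_D_group] .
  have "\<mu> [^]\<^bsub>D_group\<lparr>carrier := H\<rparr>\<^esub> (p ^ a) = \<one>\<^bsub>D_group\<lparr>carrier := H\<rparr>\<^esub>"
    using H.pow_order_eq_1[of \<mu>] \<mu> H(2) by (simp add: order_def)
  hence "\<mu> [^]\<^bsub>D_group\<^esub> (p ^ a) = L" by (simp add: nat_pow_def D_group_def)
  hence "coset (real (p ^ a) *\<^sub>R ?x) = coset 0" using D_group_pow[OF x(1)] x(2) coset_0 by metis
  hence "of_int (int (p ^ a)) *\<^sub>R ?x \<in> L" by (simp add: coset_eq_iff)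
  moreover have "coprime (int (p ^ a)) (int N)"
    using pN p(1) prime_imp_coprime_nat by (simp add: coprime_power_left_iff)
  ultimately have "?x \<in> L" using x(1) M_coprime by blast
  hence "\<mu> = L" using x(2) coset_eq_iff[of ?x 0] coset_0 by simp
  thus False using \<mu> by simp
qed

lemma odd_card_D: "odd N \<Longrightarrow> odd (card D)"
  using prime_dvd_card_D[of 2] by auto

section \<open>Gauss sums as values of the Jacobi symbol\<close>

text \<open>The exponent of \<open>\<mu>\<close> is the residue of the integer \<open>N q(\<mu>)\<close> modulo \<open>N\<close>.\<close>

lemma gauss_exponents:
  obtains e :: "'v set \<Rightarrow> nat" where
    "\<And>\<mu> j. \<mu> \<in> D \<Longrightarrow> e2pi (real j * disc_q B \<mu>) = e2pi (real j / real N) ^ e \<mu>"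
proof -
  have N0: "N > 0" by (rule level_properties)
  define z where "z \<mu> = \<lfloor>real N * disc_q B \<mu>\<rfloor>" for \<mu>
  have z: "real N * disc_q B \<mu> = of_int (z \<mu>)" if "\<mu> \<in> D" for \<mu>
    using level_properties(2)[OF rep_D(1)[OF that]]
    by (simp add: z_def disc_q_def disc_form_rep)
  define e where "e \<mu> = nat (z \<mu> mod int N)" for \<mu>
  show ?thesis
  proof (rule that[of e])
    fix \<mu> j assume \<mu>: "\<mu> \<in> D"
    have e: "real (e \<mu>) = of_int (z \<mu>) - real N * of_int (z \<mu> div int N)"
    proof -
      have "int (e \<mu>) = z \<mu> - int N * (z \<mu> div int N)"
        using N0 by (simp add: e_def minus_mult_div_eq_mod)
      from arg_cong[OF this, of real_of_int] show ?thesis by simp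
    qed
    have "real j * disc_q B \<mu> - real (e \<mu>) * (real j / real N) = of_int (int j * (z \<mu> div int N))"
      unfolding e z[OF \<mu>, symmetric] using N0 by (simp add: field_simps)
    thus "e2pi (real j * disc_q B \<mu>) = e2pi (real j / real N) ^ e \<mu>"
      unfolding e2pi_power by (intro e2pi_cong) (metis Ints_of_int)
  qed
qed

abbreviation zeta :: "nat \<Rightarrow> complex" where "zeta j \<equiv> e2pi (real j / real N)"

text \<open>The same \<open>G\<close> serves for every \<open>j\<close>, and so does the quotient \<open>P\<close> in the Frobenius congruence modulo \<open>l\<close>.\<close>

lemma gauss_polynomial:
  obtains G where "\<And>j. gs (int j) = eval_at (zeta j) G"
    and "\<And>l. prime l \<Longrightarrow> \<exists>P. \<forall>j. gs (int j) ^ l - gs (int (l * j)) = of_nat l * eval_at (zeta j) P"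
proof -
  obtain e where e: "\<And>\<mu> j. \<mu> \<in> D \<Longrightarrow> e2pi (real j * disc_q B \<mu>) = zeta j ^ e \<mu>"
    using gauss_exponents by blast
  define x where "x \<mu> = Polynomial.monom (1 :: int) (e \<mu>)" for \<mu>
  have gs: "gs (int j) = (\<Sum>\<mu>\<in>D. eval_at (zeta j) (x \<mu>))" for j
    unfolding gauss_sum_def by (intro sum.cong) (auto simp: e x_def)
  have "\<exists>P. \<forall>j. gs (int j) ^ l - gs (int (l * j)) = of_nat l * eval_at (zeta j) P" if l: "prime l" for l
  proof -
    obtain P where P: "(\<Sum>\<mu>\<in>D. x \<mu>) ^ l - (\<Sum>\<mu>\<in>D. x \<mu> ^ l) = of_nat l * P"
      using sum_power_prime_dvd[OF l finite_D, of x] by (auto elim: dvdE)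
    hence P': "(\<Sum>\<mu>\<in>D. x \<mu>) ^ l = of_nat l * P + (\<Sum>\<mu>\<in>D. x \<mu> ^ l)" by (simp add: algebra_simps)
    have "gs (int j) ^ l - gs (int (l * j)) = of_nat l * eval_at (zeta j) P" for j
    proof -
      have "gs (int (l * j)) = (\<Sum>\<mu>\<in>D. eval_at (zeta j) (x \<mu>) ^ l)"
        unfolding gauss_sum_def
      proof (rule sum.cong[OF refl])
        fix \<mu> assume "\<mu> \<in> D"
        have "e2pi (of_int (int (l * j)) * disc_q B \<mu>) = e2pi (real j * disc_q B \<mu>) ^ l"
          by (simp add: e2pi_power mult_ac)
        thus "e2pi (of_int (int (l * j)) * disc_q B \<mu>) = eval_at (zeta j) (x \<mu>) ^ l"
          using e[OF \<open>\<mu> \<in> D\<close>] by (simp add: x_def)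
      qed
      moreover have "gs (int j) ^ l = of_nat l * eval_at (zeta j) P + (\<Sum>\<mu>\<in>D. eval_at (zeta j) (x \<mu>) ^ l)"
        using arg_cong[OF P', of "eval_at (zeta j)"] by (simp add: gs)
      ultimately show ?thesis by simp
    qed
    thus ?thesis by blast
  qed
  thus ?thesis using gs by (intro that[of "\<Sum>\<mu>\<in>D. x \<mu>"]) auto
qed

text \<open>\<open>q(-\<mu>) = q(\<mu>)\<close>, and as \<open>N\<close> is odd only \<open>\<mu> = 0\<close> equals its negative; a set of representatives
  of the non-zero elements up to sign gives \<open>P\<close>.\<close>

lemma gauss_polynomial_parity:
  assumes "odd N" obtains P where "\<And>j. gs (int j) = 1 + 2 * eval_at (zeta j) P"
proof -
  obtain e where e: "\<And>\<mu> j. \<mu> \<in> D \<Longrightarrow> e2pi (real j * disc_q B \<mu>) = zeta j ^ e \<mu>"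
    using gauss_exponents by blast
  obtain f n where f: "inj_on f D" "f ` D = {i :: nat. i < n}"
    using finite_imp_inj_to_nat_seg[OF finite_D] by metis
  define m where "m \<mu> = coset (- rep \<mu>)" for \<mu>
  have mD: "m \<mu> \<in> D" if "\<mu> \<in> D" for \<mu>
    using rep_D[OF that] M_closed(6) by (auto simp: m_def intro: coset_in_D)
  have mm: "m (m \<mu>) = \<mu>" if "\<mu> \<in> D" for \<mu>
  proof -
    have "- (rep (coset (- rep \<mu>)) - (- rep \<mu>)) \<in> L" using rep_coset L_minus by blast
    moreover have "- (rep (coset (- rep \<mu>)) - (- rep \<mu>)) = - rep (m \<mu>) - rep \<mu>"
      by (simp add: m_def)
    ultimately have "coset (- rep (m \<mu>)) = coset (rep \<mu>)" by (simp only: coset_eq_iff)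
    thus ?thesis using rep_D[OF that] by (simp add: m_def)
  qed
  have fix_only: "\<mu> = L" if "\<mu> \<in> D" "m \<mu> = \<mu>" for \<mu>
  proof -
    have "coset (rep \<mu>) = coset (- rep \<mu>)" using that rep_D[OF that(1)] by (simp add: m_def)
    hence "of_int 2 *\<^sub>R rep \<mu> \<in> L" by (simp add: coset_eq_iff scaleR_2)
    moreover have "coprime 2 (int N)" using assms by simp
    ultimately have "rep \<mu> \<in> L" using rep_D[OF that(1)] M_coprime by blast
    hence "coset (rep \<mu>) = coset 0" by (simp add: coset_eq_iff)
    thus ?thesis using rep_D[OF that(1)] coset_0 by simp
  qed
  have mL: "m L = L"
  proof -
    have "rep L \<in> L" using rep_coset[of 0] by (simp add: coset_0)
    thus ?thesis using L_minus(1) coset_eq_iff[of "- rep L" 0] by (simp add: m_def coset_0)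
  qed
  have qm: "e2pi (real j * disc_q B (m \<mu>)) = e2pi (real j * disc_q B \<mu>)" if "\<mu> \<in> D" for \<mu> j
    using e2pi_q[of "- rep \<mu>" "int j"] M_closed(6)[OF rep_D(1)[OF that]]
    by (simp add: m_def B_simps disc_q_def disc_form_rep)
  \<comment> \<open>One element of each pair \<open>{\<mu>, -\<mu>}\<close>, the one numbered first.\<close>
  define H where "H = {\<mu> \<in> D. f \<mu> < f (m \<mu>)}"
  have HD: "H \<subseteq> D" and finH: "finite H" using finite_D by (auto simp: H_def)
  have split: "D = insert L (H \<union> m ` H)"
  proof (intro equalityI subsetI)
    fix \<mu> assume \<mu>: "\<mu> \<in> D"
    show "\<mu> \<in> insert L (H \<union> m ` H)"
    proof (cases "m \<mu> = \<mu>")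
      case True
      thus ?thesis using fix_only \<mu> by simp
    next
      case False
      hence "f \<mu> \<noteq> f (m \<mu>)" using f(1) \<mu> mD by (auto simp: inj_on_def)
      hence "\<mu> \<in> H \<or> m \<mu> \<in> H" using \<mu> mD mm by (auto simp: H_def)
      thus ?thesis using mm[OF \<mu>] by (metis UnI1 UnI2 imageI insertI2)
    qed
  qed (use L_in_D HD mD in auto)
  have LH: "L \<notin> H \<union> m ` H"
  proof
    assume "L \<in> H \<union> m ` H"
    moreover have "L \<notin> H" by (simp add: H_def mL)
    ultimately obtain \<mu> where "\<mu> \<in> H" "m \<mu> = L" by auto
    hence "\<mu> = L" using mm[of \<mu>] HD mL by auto
    thus False using \<open>\<mu> \<in> H\<close> \<open>L \<notin> H\<close> by simp
  qed
  have dis: "H \<inter> m ` H = {}"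
  proof -
    have "m \<mu> \<notin> H" if "\<mu> \<in> H" for \<mu> using that HD mm[of \<mu>] by (auto simp: H_def)
    thus ?thesis by auto
  qed
  have inj: "inj_on m H" using mm HD by (metis inj_on_inverseI subset_eq)
  define P where "P = (\<Sum>\<mu>\<in>H. Polynomial.monom (1 :: int) (e \<mu>))"
  have "gs (int j) = 1 + 2 * eval_at (zeta j) P" for j
  proof -
    let ?g = "\<lambda>\<mu>. e2pi (real j * disc_q B \<mu>)"
    have "gs (int j) = sum ?g (insert L (H \<union> m ` H))"
      unfolding gauss_sum_def using split by simp
    also have "\<dots> = ?g L + (sum ?g H + sum ?g (m ` H))"
      using LH finH dis by (simp add: sum.union_disjoint)
    also have "sum ?g (m ` H) = sum ?g H"
      unfolding sum.reindex[OF inj] using qm HD by (intro sum.cong) auto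
    also have "sum ?g H = eval_at (zeta j) P"
      unfolding P_def eval_at_sum eval_at_hom using e HD by (intro sum.cong) auto
    finally show ?thesis using e2pi_q_L[of "int j"] by simp
  qed
  thus ?thesis using that by blast
qed

lemma gauss_ratio_values: assumes "coprime r (int N)" obtains k :: int where "k \<in> {1, -1}" "gauss_ratio r = of_int k"
proof -
  have "(gauss_ratio r - 1) * (gauss_ratio r + 1) = 0" using gauss_ratio_square[OF assms] by (simp add: algebra_simps)
  hence "gauss_ratio r = 1 \<or> gauss_ratio r = - 1" by (auto simp: eq_neg_iff_add_eq_0)
  thus ?thesis using that[of 1] that[of "- 1"] by auto
qed

text \<open>With \<open>d = g(D)\<^sup>2 = \<plusminus>|D| \<equiv> 1\<close> modulo 4, raising \<open>g(D)\<close> to the power \<open>l = 2 h + 1\<close> gives \<open>d\<^sup>h g(D)\<close> on the one hand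
  and \<open>g\<^sub>l(D)\<close> modulo \<open>l\<close> on the other. So the quotient is \<open>d\<^sup>h\<close> modulo \<open>l\<close>, that is \<open>(d/l)\<close>.\<close>

lemma gauss_ratio_prime:
  assumes N: "odd N" and l: "prime l" "2 < l" "\<not> l dvd N"
  shows "gauss_ratio (int l) = of_int (jacobi (int l) (card D))"
proof -
  have N0: "N > 0" by (rule level_properties)
  obtain s where s: "s \<in> {1, -1}" "gauss_ratio (- 1) = of_int s" by (rule gauss_ratio_values[of "- 1"]) auto
  have lN: "coprime (int l) (int N)" using l prime_imp_coprime_nat by simp
  obtain k where k: "k \<in> {1, -1}" "gauss_ratio (int l) = of_int k" by (rule gauss_ratio_values[OF lN])
  define d where "d = s * int (card D)"
  note oddD = odd_card_D[OF N]
  have lD: "\<not> l dvd card D" using prime_dvd_card_D l by blast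
  have sq: "gs (int j) * gs (int j) = of_int d" if "coprime j N" for j
  proof -
    have "gs (int j) * gs (int j) = (gauss_ratio (int j) * gauss_ratio (int j)) * (gs 1 * gs 1)"
      by (subst (1 2) gs_eq) (simp only: ac_simps)
    also have "gauss_ratio (int j) * gauss_ratio (int j) = 1" using that by (intro gauss_ratio_square) simp
    also have "1 * (gs 1 * gs 1) = of_int (s * s) * (gs 1 * gs 1)" using s by auto
    also have "\<dots> = of_int s * (gs 1 * gs (- 1))"
      using gs_eq[of "- 1"] s by (simp only: of_int_mult ac_simps)
    finally show ?thesis by (simp add: gs_1_mult_gs_minus_1 d_def)
  qed
  have "4 dvd d - 1"
  proof -
    obtain P where P: "\<And>j. gs (int j) = 1 + 2 * eval_at (zeta j) P"
      using gauss_polynomial_parity[OF N] by blast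
    show ?thesis
    proof (rule rational_cyclotomic_integer[OF N0, of 4 "P + P * P"])
      fix j assume "coprime j N"
      from sq[OF this] have "1 + 4 * (eval_at (zeta j) P + eval_at (zeta j) P * eval_at (zeta j) P) = of_int d"
        unfolding P by (simp add: algebra_simps)
      thus "of_int 4 * eval_at (zeta j) (P + P * P) = of_int (d - 1)" by (simp add: algebra_simps)
    qed simp
  qed
  hence d1: "[s * int (card D) = 1] (mod 4)" by (simp add: cong_iff_dvd_diff d_def)
  have "odd l" using l prime_odd_nat by blast
  then obtain h where h: "l = 2 * h + 1" by (auto elim: oddE)
  have "int l dvd (d ^ h - k) * d"
  proof -
    obtain G where G: "\<And>j. gs (int j) = eval_at (zeta j) G"
      and "\<exists>P. \<forall>j. gs (int j) ^ l - gs (int (l * j)) = of_nat l * eval_at (zeta j) P"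
      using gauss_polynomial l(1) by metis
    then obtain P where P: "\<And>j. gs (int j) ^ l - gs (int (l * j)) = of_nat l * eval_at (zeta j) P"
      by blast
    show ?thesis
    proof (rule rational_cyclotomic_integer[OF N0, of "int l" "P * G"])
      fix j assume j: "coprime j N"
      have "gs (int j) ^ l = of_int d ^ h * gs (int j)"
        using sq[OF j] by (simp add: h power_mult power2_eq_square)
      moreover have "gs (int (l * j)) = of_int k * gs (int j)"
        using gauss_ratio_mult[OF lN, of "int j"] j gs_eq[of "int (l * j)"] gs_eq[of "int j"] k by simp
      ultimately have "of_nat l * eval_at (zeta j) P = (of_int d ^ h - of_int k) * gs (int j)"
        using P[of j] by (simp add: algebra_simps)
      hence "of_nat l * eval_at (zeta j) P * gs (int j) = (of_int d ^ h - of_int k) * of_int d"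
        using sq[OF j] by (simp add: mult.assoc)
      thus "of_int (int l) * eval_at (zeta j) (P * G) = of_int ((d ^ h - k) * d)"
        by (simp add: G mult.assoc)
    qed (use l in auto)
  qed
  moreover have "\<not> int l dvd d" using lD s by (auto simp: d_def)
  ultimately have "int l dvd d ^ h - k" using l(1) by (simp add: prime_dvd_mult_iff)
  moreover have "[Legendre d (int l) = d ^ h] (mod int l)" using euler_criterion[OF l(1,2), of d] h by simp
  ultimately have "[Legendre d (int l) = k] (mod int l)"
    by (meson cong_iff_dvd_diff cong_trans)
  hence "Legendre d (int l) = k"
    using k Legendre_values[of d "int l"] by (intro cong_unit_values[OF l(2)]) auto
  moreover have "jacobi (int l) (card D) = Legendre d (int l)"
    unfolding d_def by (rule jacobi_reciprocity[OF l(1,2) oddD lD s(1) d1])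
  ultimately show ?thesis using k by simp
qed

text \<open>Both sides are multiplicative and depend only on \<open>r\<close> modulo \<open>N\<close>. As \<open>N\<close> is odd, every class contains an odd
  positive integer, so odd primes suffice.\<close>

theorem gauss_sum_quotient_eq_jacobi:
  assumes N: "odd N" and r: "coprime r (int N)"
  shows "gauss_ratio r = chi_D L B r"
proof -
  note oddD = odd_card_D[OF N]
  have pos: "gauss_ratio (int n) = of_int (jacobi (int n) (card D))" if "odd n" "coprime n N" for n
    using that
  proof (induction n rule: less_induct)
    case (less n)
    show ?case
    proof (cases "n = 1")
      case True
      have "jacobi 1 (card D) * jacobi 1 (card D) = jacobi 1 (card D)"
        using jacobi_mult[OF oddD, of 1 1] by simp
      moreover have "Legendre 1 (int p) = 1" if "prime p" for p
        using that by (auto simp: Legendre_def QuadRes_def cong_0_iff intro!: exI[of _ 1])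
      hence "jacobi 1 (card D) = 1"
        unfolding jacobi_def by (intro prod_mset.neutral) (auto simp: in_prime_factors_iff)
      ultimately show ?thesis using True by simp
    next
      case False
      then obtain p where p: "prime p" "p dvd n" using prime_factor_nat by blast
      then obtain m where m: "n = p * m" by blast
      have n0: "n > 0" using less.prems by (cases n) auto
      have m0: "m > 0" "m < n" using m n0 prime_gt_1_nat[OF p(1)] by auto
      have odd: "odd p" "odd m" and cop: "coprime p N" "coprime m N" using less.prems m by auto
      have p2: "2 < p" using odd(1) prime_ge_2_nat[OF p(1)] by (cases "p = 2") auto
      have "\<not> p dvd N" using cop(1) p(1) by (meson coprime_common_divisor dvd_refl not_prime_unit)
      hence "gauss_ratio (int p) = of_int (jacobi (int p) (card D))" using gauss_ratio_prime[OF N p(1) p2] by blast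
      thus ?thesis using less.IH[OF m0(2) odd(2) cop(2)] gauss_ratio_mult[of "int p" "int m"] cop
          jacobi_mult[OF oddD, of "int p" "int m"] by (simp add: m)
    qed
  qed
  have N0: "int N > 0" using level_properties(1) by simp
  define n0 where "n0 = nat (r mod int N)"
  define n where "n = (if odd n0 then n0 else n0 + N)"
  have nr: "[int n = r] (mod int N)" using N0 by (simp add: n_def n0_def cong_def)
  have "odd n" using N by (simp add: n_def)
  moreover have "coprime n N"
    using r cong_imp_coprime[OF cong_sym[OF nr]] by simp
  ultimately have "gauss_ratio (int n) = of_int (jacobi (int n) (card D))" by (rule pos)
  moreover have "jacobi (int n) (card D) = jacobi r (card D)"
    using nr prime_dvd_card_D by (rule jacobi_cong)
  ultimately show ?thesis using gauss_ratio_cong[OF nr] by (simp add: chi_D_def)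
qed

end

section \<open>The action of the compact group\<close>

lemma calK_simps [simp]: "x \<otimes>\<^bsub>calK\<^esub> y = pair_mult x y" "\<one>\<^bsub>calK\<^esub> = (mat 1, 1)"
  by (simp_all add: calK_def)

lemma matrix_mult_nth_2: "(A ** B) $ i $ j = A $ i $ 1 * B $ 1 $ j + A $ i $ 2 * B $ 2 $ j"
  for A :: "'a::semiring_1^2^2"
  by (simp add: matrix_matrix_mult_def sum_2)

lemma Zhat_matrix_mult:
  fixes k l :: "finite_adele^2^2"
  shows "\<forall>i j. k $ i $ j \<in> Zhat \<Longrightarrow> \<forall>i j. l $ i $ j \<in> Zhat \<Longrightarrow> \<forall>i j. (k ** l) $ i $ j \<in> Zhat"
  by (simp add: matrix_mult_nth_2)

lemma group_calK: "group calK"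
proof (rule groupI)
  fix x y assume "x \<in> carrier calK" "y \<in> carrier calK"
  thus "x \<otimes>\<^bsub>calK\<^esub> y \<in> carrier calK"
    by (cases x; cases y) (auto simp: pair_mult_def calK_iff Zhat_units_closed det_mul
        power_mult_distrib Zhat_matrix_mult)
next
  show "\<one>\<^bsub>calK\<^esub> \<in> carrier calK"
    by (simp add: calK_iff Zhat_units_closed mat_1_eq_mat2 det_mat2 forall_2)
next
  fix x assume x: "x \<in> carrier calK"
  obtain k t where kt: "x = (k, t)" by (cases x)
  obtain l where l: "\<forall>i j. l $ i $ j \<in> Zhat" "k ** l = mat 1" "l ** k = mat 1"
    using x by (auto simp: kt calK_def GL2_Zhat_def)
  obtain s where s: "s \<in> Zhat" "t * s = 1" and t: "t \<in> Zhat"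
    using x by (auto simp: kt calK_iff Zhat_units_iff)
  have "det l * det k = 1" using l(3) by (metis det_I det_mul)
  hence "det l * t\<^sup>2 * s\<^sup>2 = s\<^sup>2" using x by (simp add: kt calK_iff)
  moreover have "det l * t\<^sup>2 * s\<^sup>2 = det l * (t * s)\<^sup>2" by (simp add: power_mult_distrib mult.assoc)
  ultimately have "det l = s\<^sup>2" by (simp add: s)
  moreover have "s \<in> Zhat_units" using s t by (auto simp: Zhat_units_iff mult.commute)
  ultimately have "(l, s) \<in> carrier calK" using l by (simp add: calK_iff)
  moreover have "pair_mult (l, s) x = (mat 1, 1)"
    using l s by (simp add: kt pair_mult_def mult.commute)
  ultimately show "\<exists>y\<in>carrier calK. y \<otimes>\<^bsub>calK\<^esub> x = \<one>\<^bsub>calK\<^esub>" by auto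
qed (auto simp: pair_mult_def matrix_mul_assoc mult.assoc)

lemma calK0_iff:
  "x \<in> calK0 N \<longleftrightarrow> x \<in> carrier calK \<and> Zhat_cong N (fst x $ 2 $ 1) 0"
  by (cases x) (auto simp: calK0_def K0_def Zhat_cong_def calK_def)

lemma K0_iff: "k \<in> K0 N \<longleftrightarrow> k \<in> GL2_Zhat \<and> Zhat_cong N (k $ 2 $ 1) 0"
  by (auto simp: K0_def Zhat_cong_def)

lemma Zhat_cong_mult_0:
  assumes "Zhat_cong N x 0" "y \<in> Zhat" shows "Zhat_cong N (x * y) 0" "Zhat_cong N (y * x) 0"
  using Zhat_cong_mult[OF assms(1) Zhat_cong_refl[of N y]] assms(2) by (simp_all add: mult.commute)

lemma Zhat_cong_0_add: "Zhat_cong N x 0 \<Longrightarrow> Zhat_cong N y 0 \<Longrightarrow> Zhat_cong N (x + y) 0"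
  using Zhat_cong_add[of N x 0 y 0] by simp

lemma subgroup_calK0: "subgroup (calK0 N) calK"
proof -
  interpret group calK by (rule group_calK)
  show ?thesis
  proof (rule subgroupI)
    have "(mat 1, 1) \<in> calK0 N" using one_closed by (simp add: calK0_iff mat_1_eq_mat2)
    thus "calK0 N \<noteq> {}" by blast
  next
    fix x assume x: "x \<in> calK0 N"
    hence xK: "x \<in> carrier calK" by (simp add: calK0_iff)
    obtain k t where kt: "x = (k, t)" by (cases x)
    obtain l s where ls: "inv\<^bsub>calK\<^esub> x = (l, s)" by (cases "inv\<^bsub>calK\<^esub> x")
    have lK: "(l, s) \<in> carrier calK" using xK ls by (metis inv_closed)
    have "pair_mult (l, s) (k, t) = (mat 1, 1)" using l_inv[OF xK] unfolding ls unfolding kt by simp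
    hence lk: "l ** k = mat 1" by (simp add: pair_mult_def)
    obtain a b c d where k: "k = mat2 a b c d" by (rule mat2_cases)
    obtain a' b' c' d' where l: "l = mat2 a' b' c' d'" by (rule mat2_cases)
    have z: "c' \<in> Zhat" "d' \<in> Zhat" "b' \<in> Zhat" "a' \<in> Zhat" "a \<in> Zhat" "c \<in> Zhat" "d \<in> Zhat" "b \<in> Zhat"
      using lK xK by (auto simp: kt k l calK_iff forall_2)
    have c0: "Zhat_cong N c 0" using x by (simp add: calK0_iff kt k)
    have e: "c' * a + d' * c = 0" "c' * b + d' * d = 1" "a' * a + b' * c = 1"
      using lk by (auto simp: k l mat2_mult mat_1_eq_mat2)
    \<comment> \<open>\<open>c\<close> divides \<open>c' a = - d' c\<close>, and \<open>a'\<close> is an inverse of \<open>a\<close> modulo \<open>c\<close>.\<close>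
    have "c' = c' * (a' * a + b' * c)" by (simp add: e)
    also have "\<dots> = a' * (c' * a) + c' * b' * c" by (simp add: algebra_simps)
    also have "c' * a = - d' * c" using e(1) by (simp add: eq_neg_iff_add_eq_0)
    also have "a' * (- d' * c) + c' * b' * c = c * (c' * b' - a' * d')" by (simp add: algebra_simps)
    finally have "Zhat_cong N c' 0" using Zhat_cong_mult_0(1)[OF c0, of "c' * b' - a' * d'"] z by auto
    thus "inv\<^bsub>calK\<^esub> x \<in> calK0 N" using lK by (simp add: calK0_iff ls l)
  next
    fix x y assume xy: "x \<in> calK0 N" "y \<in> calK0 N"
    hence "pair_mult x y \<in> carrier calK" using m_closed[of x y] by (simp add: calK0_iff)
    have "fst x $ 2 $ 2 \<in> Zhat" "fst y $ 1 $ 1 \<in> Zhat"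
      using xy by (cases x; cases y; simp add: calK0_iff calK_iff)+
    moreover have "Zhat_cong N (fst x $ 2 $ 1) 0" "Zhat_cong N (fst y $ 2 $ 1) 0"
      using xy by (auto simp: calK0_iff)
    ultimately have "Zhat_cong N (fst x $ 2 $ 1 * fst y $ 1 $ 1 + fst x $ 2 $ 2 * fst y $ 2 $ 1) 0"
      by (intro Zhat_cong_0_add Zhat_cong_mult_0(1)[of N "fst x $ 2 $ 1"]
          Zhat_cong_mult_0(2)[of N "fst y $ 2 $ 1"])
    hence "Zhat_cong N (fst (pair_mult x y) $ 2 $ 1) 0"
      by (simp add: pair_mult_def matrix_mult_nth_2)
    with \<open>pair_mult x y \<in> carrier calK\<close> show "x \<otimes>\<^bsub>calK\<^esub> y \<in> calK0 N" by (simp add: calK0_iff)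
  qed (auto simp: calK0_iff)
qed

definition int_mat :: "int^2^2 \<Rightarrow> finite_adele^2^2" where
  "int_mat \<gamma> = map_mat of_int \<gamma>"

lemma int_mat_nth [simp]: "int_mat \<gamma> $ i $ j = of_int (\<gamma> $ i $ j)"
  by (simp add: int_mat_def)

lemma int_mat_mult: "int_mat (\<gamma> ** \<delta>) = int_mat \<gamma> ** int_mat \<delta>"
  by (simp add: vec_eq_iff matrix_mult_nth_2)

lemma det_int_mat: "det (int_mat \<gamma>) = of_int (det \<gamma>)"
  by (simp add: det_2)

definition embK :: "int^2^2 \<Rightarrow> (finite_adele^2^2) \<times> finite_adele" where
  "embK \<gamma> = (int_mat \<gamma>, 1)"

lemma embK_closed: "\<gamma> \<in> carrier SL2Z \<Longrightarrow> embK \<gamma> \<in> carrier calK"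
  by (simp add: embK_def calK_iff det_int_mat SL2Z_carrier Zhat_units_closed)

lemma embK_mult: "embK (\<gamma> ** \<delta>) = pair_mult (embK \<gamma>) (embK \<delta>)"
  by (simp add: embK_def pair_mult_def int_mat_mult)

lemma embK_one: "embK (mat 1) = (mat 1, 1)"
  by (simp add: embK_def vec_eq_iff mat_def)

lemma embK_inv:
  assumes "\<gamma> \<in> carrier SL2Z" shows "embK (inv\<^bsub>SL2Z\<^esub> \<gamma>) = inv\<^bsub>calK\<^esub> (embK \<gamma>)"
proof -
  interpret S: group SL2Z by (rule group_SL2Z)
  interpret K: group calK by (rule group_calK)
  have "pair_mult (embK (inv\<^bsub>SL2Z\<^esub> \<gamma>)) (embK \<gamma>) = (mat 1, 1)"
    using S.l_inv[OF assms] by (simp flip: embK_mult add: embK_one)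
  thus ?thesis using assms embK_closed by (intro K.inv_equality[symmetric]) auto
qed

lemma embK_calK0_iff:
  assumes "N > 0" "\<gamma> \<in> carrier SL2Z"
  shows "embK \<gamma> \<in> calK0 N \<longleftrightarrow> \<gamma> \<in> Gamma0 N"
  using assms Zhat_cong_of_int_iff[OF assms(1), of "\<gamma> $ 2 $ 1" 0]
  by (simp add: calK0_iff embK_closed Gamma0_def embK_def cong_0_iff)
     (use embK_closed[OF assms(2)] in \<open>simp add: embK_def\<close>)

context weil_lattice
begin

text \<open>\<open>\<gamma>\<close> represents \<open>t\<^sup>-\<^sup>1 k\<close> modulo \<open>N\<close> for \<open>x = (k, t)\<close>, so that \<open>\<omega>\<^sub>f(x)\<close> is a multiple of \<open>\<rho>(\<gamma>)\<close>.\<close>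

definition lifts :: "((finite_adele^2^2) \<times> finite_adele) \<Rightarrow> int^2^2 \<Rightarrow> bool" where
  "lifts x \<gamma> \<longleftrightarrow> \<gamma> \<in> carrier SL2Z \<and> (\<forall>i j. Zhat_cong N (fst x $ i $ j) (snd x * of_int (\<gamma> $ i $ j)))"

lemma calK_Zhat:
  "x \<in> carrier calK \<Longrightarrow> fst x $ i $ j \<in> Zhat" "x \<in> carrier calK \<Longrightarrow> snd x \<in> Zhat"
  "x \<in> carrier calK \<Longrightarrow> snd x \<in> Zhat_units"
  by (cases x, simp add: calK_iff Zhat_units_iff)+

lemma lifts_iff:
  assumes x: "x \<in> carrier calK"
  shows "lifts x \<gamma> \<longleftrightarrow> \<gamma> \<in> carrier SL2Z \<and>
    (\<forall>i j. [Zhat_mod N (snd x) * \<gamma> $ i $ j = Zhat_mod N (fst x $ i $ j)] (mod int N))"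
proof -
  note N0 = level_properties(1)
  have "Zhat_cong N (fst x $ i $ j) (snd x * of_int (\<gamma> $ i $ j)) \<longleftrightarrow>
      [Zhat_mod N (snd x) * \<gamma> $ i $ j = Zhat_mod N (fst x $ i $ j)] (mod int N)" for i j
  proof -
    have "Zhat_cong N (snd x * of_int (\<gamma> $ i $ j)) (of_int (Zhat_mod N (snd x)) * of_int (\<gamma> $ i $ j))"
      using x by (intro Zhat_cong_mult Zhat_mod_cong N0) (auto simp: calK_Zhat)
    hence "Zhat_cong N (snd x * of_int (\<gamma> $ i $ j)) (of_int (Zhat_mod N (snd x) * \<gamma> $ i $ j))"
      by simp
    hence "Zhat_cong N (fst x $ i $ j) (snd x * of_int (\<gamma> $ i $ j)) \<longleftrightarrow>
        Zhat_cong N (fst x $ i $ j) (of_int (Zhat_mod N (snd x) * \<gamma> $ i $ j))"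
      by (meson Zhat_cong_sym Zhat_cong_trans)
    also have "\<dots> \<longleftrightarrow> [Zhat_mod N (fst x $ i $ j) = Zhat_mod N (snd x) * \<gamma> $ i $ j] (mod int N)"
      using x N0 by (intro Zhat_cong_iff_mod) (auto simp: calK_Zhat)
    finally show ?thesis by (simp add: cong_sym_eq)
  qed
  thus ?thesis by (simp add: lifts_def)
qed

text \<open>\<open>det k = t\<^sup>2\<close> gives \<open>t\<^sup>-\<^sup>1 k\<close> determinant 1 modulo \<open>N\<close>.\<close>

lemma lift_exists:
  assumes x: "x \<in> carrier calK" shows "\<exists>\<gamma>. lifts x \<gamma>"
proof -
  note N0 = level_properties(1)
  let ?m = "Zhat_mod N"
  obtain k t where kt: "x = (k, t)" by (cases x)
  obtain a b c d where k: "k = mat2 a b c d" by (rule mat2_cases)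
  have z: "a \<in> Zhat" "b \<in> Zhat" "c \<in> Zhat" "d \<in> Zhat" "t \<in> Zhat" and t: "t \<in> Zhat_units"
    and det: "a * d + - 1 * (b * c) = t * t"
    using x by (auto simp: kt k calK_iff forall_2 Zhat_units_iff det_mat2 power2_eq_square)
  obtain s where s: "[?m t * s = 1] (mod int N)"
    using cong_solve_coprime_int[OF Zhat_mod_unit[OF t N0]] by blast
  have "[?m (a * d + - 1 * (b * c)) = ?m a * ?m d + ?m (- 1) * (?m b * ?m c)] (mod int N)"
  proof -
    have "[?m (a * d + - 1 * (b * c)) = ?m (a * d) + ?m (- 1 * (b * c))] (mod int N)"
      using z N0 by (intro Zhat_mod_add) auto
    also have "[?m (a * d) + ?m (- 1 * (b * c)) = ?m a * ?m d + ?m (- 1) * ?m (b * c)] (mod int N)"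
      using z N0 by (intro cong_add Zhat_mod_mult) auto
    also have "[?m a * ?m d + ?m (- 1) * ?m (b * c) = ?m a * ?m d + ?m (- 1) * (?m b * ?m c)] (mod int N)"
      using z N0 by (intro cong_add cong_mult Zhat_mod_mult cong_refl) auto
    finally show ?thesis .
  qed
  moreover have "[?m (- 1) = - 1] (mod int N)" using Zhat_mod_of_int[OF N0, of "- 1"] by simp
  hence "[?m a * ?m d + ?m (- 1) * (?m b * ?m c) = ?m a * ?m d + - 1 * (?m b * ?m c)] (mod int N)"
    by (intro cong_add cong_mult cong_refl)
  moreover have "[?m (t * t) = ?m t * ?m t] (mod int N)" using z N0 by (intro Zhat_mod_mult) auto
  ultimately have dm: "[?m a * ?m d + - 1 * (?m b * ?m c) = ?m t * ?m t] (mod int N)"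
    unfolding det by (meson cong_sym cong_trans)
  have "[(s * ?m a) * (s * ?m d) - (s * ?m b) * (s * ?m c) = 1] (mod int N)"
  proof -
    have "(s * ?m a) * (s * ?m d) - (s * ?m b) * (s * ?m c)
        = (s * s) * (?m a * ?m d + - 1 * (?m b * ?m c))" by (simp add: algebra_simps)
    also have "[\<dots> = (s * s) * (?m t * ?m t)] (mod int N)" by (intro cong_mult cong_refl dm)
    also have "(s * s) * (?m t * ?m t) = (?m t * s) * (?m t * s)" by (simp add: ac_simps)
    also have "[\<dots> = 1 * 1] (mod int N)" by (intro cong_mult s)
    finally show ?thesis by simp
  qed
  then obtain \<gamma> where \<gamma>: "\<gamma> \<in> carrier SL2Z"
    "[\<gamma> $ 1 $ 1 = s * ?m a] (mod int N)" "[\<gamma> $ 1 $ 2 = s * ?m b] (mod int N)"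
    "[\<gamma> $ 2 $ 1 = s * ?m c] (mod int N)" "[\<gamma> $ 2 $ 2 = s * ?m d] (mod int N)"
    using SL2Z_reduction_surjective[OF N0] by blast
  have ts: "[?m t * u = v] (mod int N)" if "[u = s * v] (mod int N)" for u v
  proof -
    have "[?m t * u = ?m t * (s * v)] (mod int N)" using that by (intro cong_mult cong_refl)
    also have "?m t * (s * v) = (?m t * s) * v" by simp
    also have "[\<dots> = 1 * v] (mod int N)" by (intro cong_mult s cong_refl)
    finally show ?thesis by simp
  qed
  have "lifts x \<gamma>" using \<gamma> ts unfolding lifts_iff[OF x] by (simp add: kt k forall_2)
  thus ?thesis by blast
qed

abbreviation "om \<equiv> omega_f L B \<rho>"

text \<open>All lifts act alike, so the one chosen in \<open>weil_ext\<close> may be replaced by \<open>\<gamma>\<close>; and since \<open>g\<^sub>r(D)/g(D) = \<plusminus>1\<close>, it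
  equals its inverse \<open>g(D)/g\<^sub>r(D)\<close>.\<close>

lemma omega_eq:
  assumes x: "x \<in> carrier calK" and l: "lifts x \<gamma>" and u: "u \<in> GA"
  shows "om x u = (\<lambda>\<mu>. gauss_ratio (Zhat_mod N (snd x)) * \<rho> \<gamma> u \<mu>)"
proof -
  note N0 = level_properties(1)
  define r where "r = Zhat_mod N (snd x)"
  have r: "coprime r (int N)" using calK_Zhat(3)[OF x] N0 by (simp add: r_def Zhat_mod_unit)
  define \<delta> where "\<delta> = (SOME \<gamma>. \<gamma> \<in> carrier SL2Z \<and>
    (\<forall>i j. [r * \<gamma> $ i $ j = (\<chi> i j. Zhat_mod N (fst x $ i $ j)) $ i $ j] (mod int N)))"
  have \<delta>: "\<delta> \<in> carrier SL2Z \<and> (\<forall>i j. [r * \<delta> $ i $ j = (\<chi> i j. Zhat_mod N (fst x $ i $ j)) $ i $ j] (mod int N))"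
    unfolding \<delta>_def by (rule someI[of _ \<gamma>]) (use l lifts_iff[OF x, of \<gamma>] in \<open>simp add: r_def\<close>)
  have "\<rho> \<delta> u = \<rho> \<gamma> u"
  proof (rule rho_cong[OF _ _ _ u])
    show "\<delta> \<in> carrier SL2Z" "\<gamma> \<in> carrier SL2Z" using \<delta> l by (auto simp: lifts_def)
    fix i j
    have "[r * \<delta> $ i $ j = Zhat_mod N (fst x $ i $ j)] (mod int N)" using \<delta> by simp
    moreover have "[r * \<gamma> $ i $ j = Zhat_mod N (fst x $ i $ j)] (mod int N)"
      using l lifts_iff[OF x, of \<gamma>] by (simp add: r_def)
    ultimately have "[r * \<delta> $ i $ j = r * \<gamma> $ i $ j] (mod int N)"
      using cong_trans cong_sym by blast
    thus "[\<delta> $ i $ j = \<gamma> $ i $ j] (mod int N)" using r cong_mult_lcancel by blast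
  qed
  moreover have "gs r \<noteq> 0" using gauss_ratio_square[OF r] by (auto simp: gauss_ratio_def)
  hence "gs 1 / gs r = gauss_ratio r"
    using gauss_ratio_square[OF r] gs_1_nonzero by (simp add: gauss_ratio_def field_simps)
  moreover have "om x u = (\<lambda>\<mu>. gs 1 / gs r * \<rho> \<delta> u \<mu>)"
    by (simp add: omega_f_def weil_ext_def sigma_N_def \<delta>_def r_def)
  ultimately show ?thesis by (simp only: r_def)
qed

lemma omega_GA: assumes "x \<in> carrier calK" "u \<in> GA" shows "om x u \<in> GA"
proof -
  obtain \<gamma> where \<gamma>: "lifts x \<gamma>" using lift_exists[OF assms(1)] by blast
  hence "\<rho> \<gamma> u \<in> GA" using assms rho_GA by (simp add: lifts_def)
  thus ?thesis using omega_eq[OF assms(1) \<gamma> assms(2)] by (simp add: group_algebra_def)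
qed

lemma omega_sum:
  assumes x: "x \<in> carrier calK" and u: "\<And>i. i \<in> I \<Longrightarrow> u i \<in> GA"
  shows "om x (\<lambda>\<mu>. \<Sum>i\<in>I. a i * u i \<mu>) = (\<lambda>\<mu>. \<Sum>i\<in>I. a i * om x (u i) \<mu>)"
proof -
  obtain \<gamma> where \<gamma>: "lifts x \<gamma>" using lift_exists[OF x] by blast
  have "(\<lambda>\<mu>. \<Sum>i\<in>I. a i * u i \<mu>) \<in> GA"
    using u by (auto simp: group_algebra_def intro!: sum.neutral)
  thus ?thesis using u \<gamma> rho_sum[of \<gamma> I u a]
    by (auto simp: omega_eq[OF x \<gamma>] lifts_def sum_distrib_left mult_ac fun_eq_iff intro!: sum.cong)
qed

lemma omega_scale:
  assumes x: "x \<in> carrier calK" and u: "u \<in> GA"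
  shows "om x (\<lambda>\<mu>. a * u \<mu>) = (\<lambda>\<mu>. a * om x u \<mu>)"
  using omega_sum[OF x, of "{()}" "\<lambda>_. u" "\<lambda>_. a"] u by simp

text \<open>That \<open>r \<mapsto> g(D)/g\<^sub>r(D)\<close> is a character makes \<open>\<omega>\<^sub>f\<close> a homomorphism.\<close>

lemma omega_mult:
  assumes x: "x \<in> carrier calK" and y: "y \<in> carrier calK" and u: "u \<in> GA"
  shows "om (pair_mult x y) u = om x (om y u)"
proof -
  note N0 = level_properties(1)
  interpret K: group calK by (rule group_calK)
  obtain \<gamma> \<delta> where l: "lifts x \<gamma>" "lifts y \<delta>" using lift_exists x y by blast
  have xy: "pair_mult x y \<in> carrier calK" using K.m_closed[OF x y] by simp
  have "Zhat_cong N (fst (pair_mult x y) $ i $ j) (snd (pair_mult x y) * of_int ((\<gamma> ** \<delta>) $ i $ j))" for i j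
  proof -
    have "Zhat_cong N (fst x $ i $ m * fst y $ m $ j)
        ((snd x * of_int (\<gamma> $ i $ m)) * (snd y * of_int (\<delta> $ m $ j)))" for m
      using l calK_Zhat[OF x] calK_Zhat[OF y] by (intro Zhat_cong_mult) (auto simp: lifts_def)
    from Zhat_cong_add[OF this[of 1] this[of 2]]
    show ?thesis by (simp add: pair_mult_def matrix_mult_nth_2 algebra_simps)
  qed
  hence lxy: "lifts (pair_mult x y) (\<gamma> ** \<delta>)" using l by (simp add: lifts_def SL2Z_mult_closed)
  have SL: "\<gamma> \<in> carrier SL2Z" "\<delta> \<in> carrier SL2Z" using l by (auto simp: lifts_def)
  have "gauss_ratio (Zhat_mod N (snd (pair_mult x y))) = gauss_ratio (Zhat_mod N (snd x) * Zhat_mod N (snd y))"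
    using calK_Zhat[OF x] calK_Zhat[OF y] N0 by (intro gauss_ratio_cong) (simp add: pair_mult_def Zhat_mod_mult)
  also have "\<dots> = gauss_ratio (Zhat_mod N (snd x)) * gauss_ratio (Zhat_mod N (snd y))"
    using calK_Zhat(3)[OF x] calK_Zhat(3)[OF y] N0 by (intro gauss_ratio_mult Zhat_mod_unit)
  finally have p: "gauss_ratio (Zhat_mod N (snd (pair_mult x y)))
      = gauss_ratio (Zhat_mod N (snd x)) * gauss_ratio (Zhat_mod N (snd y))" .
  have \<delta>u: "\<rho> \<delta> u \<in> GA" by (rule rho_GA[OF SL(2) u])
  have "om x (om y u) = (\<lambda>\<mu>. gauss_ratio (Zhat_mod N (snd y)) * om x (\<rho> \<delta> u) \<mu>)"
    unfolding omega_eq[OF y l(2) u] by (rule omega_scale[OF x \<delta>u])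
  thus ?thesis
    unfolding omega_eq[OF xy lxy u] omega_eq[OF x l(1) \<delta>u] rho_mult[OF SL u] p
    by (simp add: mult_ac)
qed

lemma omega_embK:
  assumes "\<gamma> \<in> carrier SL2Z" "u \<in> GA" shows "om (embK \<gamma>) u = \<rho> \<gamma> u"
proof -
  have "lifts (embK \<gamma>) \<gamma>" using assms by (simp add: lifts_def embK_def)
  moreover have "gauss_ratio (Zhat_mod N 1) = 1"
    using gauss_ratio_cong[OF Zhat_mod_of_int[OF level_properties(1), of 1]] by simp
  ultimately show ?thesis
    using omega_eq[OF embK_closed[OF assms(1)] _ assms(2), of \<gamma>] by (simp add: embK_def)
qed

lemma omega_one: "u \<in> GA \<Longrightarrow> om (mat 1, 1) u = u"
  using omega_embK[of "mat 1" u] rho_one[of u] by (simp add: embK_one SL2Z_carrier)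

lemma omega_inv_into:
  assumes x: "x \<in> carrier calK" and v: "v \<in> GA"
  shows "inv_into GA (om x) v = om (inv\<^bsub>calK\<^esub> x) v"
proof -
  interpret K: group calK by (rule group_calK)
  have i: "inv\<^bsub>calK\<^esub> x \<in> carrier calK" using x by simp
  have "om (inv\<^bsub>calK\<^esub> x) (om x u) = u" if "u \<in> GA" for u
    using omega_mult[OF i x that] K.l_inv[OF x] omega_one[OF that] by simp
  hence "inj_on (om x) GA" by (intro inj_on_inverseI[where g = "om (inv\<^bsub>calK\<^esub> x)"])
  moreover have "om x (om (inv\<^bsub>calK\<^esub> x) v) = v"
    using omega_mult[OF x i v] K.r_inv[OF x] omega_one[OF v] by simp
  ultimately show ?thesis using inv_into_f_f[OF _ omega_GA[OF i v]] by metis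
qed

lemma rho_inv_into:
  assumes \<gamma>: "\<gamma> \<in> carrier SL2Z" and v: "v \<in> GA"
  shows "inv_into GA (\<rho> \<gamma>) v = \<rho> (inv\<^bsub>SL2Z\<^esub> \<gamma>) v"
proof -
  interpret S: group SL2Z by (rule group_SL2Z)
  have i: "inv\<^bsub>SL2Z\<^esub> \<gamma> \<in> carrier SL2Z" using \<gamma> by simp
  have "\<rho> (inv\<^bsub>SL2Z\<^esub> \<gamma>) (\<rho> \<gamma> u) = u" if "u \<in> GA" for u
    using rho_mult[OF i \<gamma> that] S.l_inv[OF \<gamma>] rho_one[OF that] by simp
  hence "inj_on (\<rho> \<gamma>) GA" by (intro inj_on_inverseI[where g = "\<rho> (inv\<^bsub>SL2Z\<^esub> \<gamma>)"])
  moreover have "\<rho> \<gamma> (\<rho> (inv\<^bsub>SL2Z\<^esub> \<gamma>) v) = v"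
    using rho_mult[OF \<gamma> i v] S.r_inv[OF \<gamma>] rho_one[OF v] by simp
  ultimately show ?thesis using inv_into_f_f[OF _ rho_GA[OF i v]] by metis
qed

text \<open>A lift \<open>\<gamma>\<close> of \<open>x = (k, t)\<close> lies in \<open>\<Gamma>\<^sub>0(N)\<close>; the scalars of \<open>t\<close> and of \<open>t\<^sup>-\<^sup>1 d\<close> multiply to that of the lower
  right entry \<open>d\<close> of \<open>k\<close>.\<close>

lemma omega_calK0:
  assumes x: "x \<in> calK0 N" and odd: "odd N"
  shows "om x (basis_vec L) = (\<lambda>\<mu>. xi_D L B (fst x) * basis_vec L \<mu>)"
    and "xi_D L B (fst x) * xi_D L B (fst x) = 1"
proof -
  note N0 = level_properties(1)
  have xK: "x \<in> carrier calK" and c: "Zhat_cong N (fst x $ 2 $ 1) 0" using x by (auto simp: calK0_iff)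
  obtain \<gamma> where l: "lifts x \<gamma>" using lift_exists[OF xK] by blast
  define r where "r = Zhat_mod N (snd x)"
  have r: "coprime r (int N)" using calK_Zhat(3)[OF xK] N0 by (simp add: r_def Zhat_mod_unit)
  have m: "[r * \<gamma> $ i $ j = Zhat_mod N (fst x $ i $ j)] (mod int N)" for i j
    using l lifts_iff[OF xK] by (simp add: r_def)
  have "[Zhat_mod N (fst x $ 2 $ 1) = 0] (mod int N)"
    using c Zhat_cong_iff_mod[OF calK_Zhat(1)[OF xK] N0, of 2 1 0] by simp
  with m[of 2 1] have "[r * \<gamma> $ 2 $ 1 = 0] (mod int N)" by (rule cong_trans)
  hence "int N dvd \<gamma> $ 2 $ 1"
    using r by (simp add: cong_0_iff coprime_commute coprime_dvd_mult_right_iff)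
  hence \<gamma>: "\<gamma> \<in> Gamma0 N" and SL: "\<gamma> \<in> carrier SL2Z" using l by (auto simp: lifts_def Gamma0_def)
  have "\<gamma> $ 1 $ 1 * \<gamma> $ 2 $ 2 - \<gamma> $ 1 $ 2 * \<gamma> $ 2 $ 1 = 1" using SL by (simp add: SL2Z_carrier det_2)
  hence "\<gamma> $ 1 $ 1 * \<gamma> $ 2 $ 2 - 1 = \<gamma> $ 1 $ 2 * \<gamma> $ 2 $ 1" by simp
  hence ad: "[\<gamma> $ 1 $ 1 * \<gamma> $ 2 $ 2 = 1] (mod int N)"
    using \<open>int N dvd \<gamma> $ 2 $ 1\<close> by (simp add: cong_iff_dvd_diff)
  have a: "coprime (\<gamma> $ 1 $ 1) (int N)" using ad coprime_iff_invertible_int by blast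
  have "[\<gamma> $ 2 $ 2 * \<gamma> $ 1 $ 1 = 1] (mod int N)" using ad by (simp add: mult.commute)
  hence d: "coprime (\<gamma> $ 2 $ 2) (int N)" using coprime_iff_invertible_int by blast
  have "gauss_ratio (\<gamma> $ 1 $ 1) = gauss_ratio (\<gamma> $ 1 $ 1) * (gauss_ratio (\<gamma> $ 2 $ 2) * gauss_ratio (\<gamma> $ 2 $ 2))"
    by (simp add: gauss_ratio_square[OF d])
  also have "\<dots> = (gauss_ratio (\<gamma> $ 1 $ 1) * gauss_ratio (\<gamma> $ 2 $ 2)) * gauss_ratio (\<gamma> $ 2 $ 2)"
    by (simp only: mult.assoc)
  also have "gauss_ratio (\<gamma> $ 1 $ 1) * gauss_ratio (\<gamma> $ 2 $ 2) = 1"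
    using gauss_ratio_mult[OF a d] gauss_ratio_cong[OF ad] by simp
  finally have pad: "gauss_ratio (\<gamma> $ 1 $ 1) = gauss_ratio (\<gamma> $ 2 $ 2)" by (simp only: mult_1)
  have cop: "coprime (Zhat_mod N (fst x $ 2 $ 2)) (int N)"
    using cong_imp_coprime[OF m[of 2 2]] r d by simp
  have xi: "xi_D L B (fst x) = gauss_ratio (Zhat_mod N (fst x $ 2 $ 2))"
    unfolding xi_D_def using gauss_sum_quotient_eq_jacobi[OF odd cop] by simp
  also have "\<dots> = gauss_ratio r * gauss_ratio (\<gamma> $ 2 $ 2)"
    using gauss_ratio_cong[OF m[of 2 2]] gauss_ratio_mult[OF r d] by simp
  finally have xi': "xi_D L B (fst x) = gauss_ratio r * gauss_ratio (\<gamma> $ 1 $ 1)" by (simp add: pad)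
  show "om x (basis_vec L) = (\<lambda>\<mu>. xi_D L B (fst x) * basis_vec L \<mu>)"
    using omega_eq[OF xK l basis_GA[OF L_in_D]] rho_Gamma0[OF \<gamma>] by (simp add: xi' r_def mult.assoc)
  show "xi_D L B (fst x) * xi_D L B (fst x) = 1" unfolding xi by (rule gauss_ratio_square[OF cop])
qed

end

section \<open>Automorphy factors\<close>

lemma GL2_real_pos_iff: "h \<in> GL2_real_pos \<longleftrightarrow> det h > 0"
  by (simp add: GL2_real_pos_def)

lemma j_factor_i_nonzero:
  assumes "h \<in> GL2_real_pos" shows "j_factor h \<i> \<noteq> 0"
proof
  assume "j_factor h \<i> = 0"
  hence "h $ 2 $ 1 = 0" "h $ 2 $ 2 = 0" by (auto simp: j_factor_def complex_eq_iff)
  thus False using assms by (simp add: GL2_real_pos_iff det_2)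
qed

lemma moebius_i_upper:
  assumes "h \<in> GL2_real_pos" shows "moebius h \<i> \<in> upper_half_plane"
proof -
  have "h $ 2 $ 1 \<noteq> 0 \<or> h $ 2 $ 2 \<noteq> 0"
    using assms by (auto simp: GL2_real_pos_iff det_2)
  hence "(h $ 2 $ 2)\<^sup>2 + (h $ 2 $ 1)\<^sup>2 > 0" by (simp add: sum_power2_gt_zero_iff disj_commute)
  moreover have "Im (moebius h \<i>) = det h / ((h $ 2 $ 2)\<^sup>2 + (h $ 2 $ 1)\<^sup>2)"
    by (simp add: moebius_def j_factor_def Im_divide det_2 power2_eq_square algebra_simps)
  ultimately show ?thesis using assms by (simp add: upper_half_plane_def GL2_real_pos_iff)
qed

lemma j_factor_mult:
  assumes "j_factor h \<tau> \<noteq> 0"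
  shows "j_factor (g ** h) \<tau> = j_factor g (moebius h \<tau>) * j_factor h \<tau>"
  using assms by (simp add: j_factor_def[of "g ** h"] j_factor_def[of g] moebius_def matrix_mult_nth_2 field_simps)
    (simp add: j_factor_def algebra_simps)

lemma moebius_mult:
  assumes "j_factor h \<tau> \<noteq> 0"
  shows "moebius (g ** h) \<tau> = moebius g (moebius h \<tau>)"
proof -
  have "of_real ((g ** h) $ 1 $ 1) * \<tau> + of_real ((g ** h) $ 1 $ 2)
      = (of_real (g $ 1 $ 1) * moebius h \<tau> + of_real (g $ 1 $ 2)) * j_factor h \<tau>"
    using assms by (simp add: moebius_def matrix_mult_nth_2 field_simps)
      (simp add: j_factor_def algebra_simps)
  thus ?thesis using assms by (simp add: moebius_def[of "g ** h"] moebius_def[of g] j_factor_mult)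
qed

definition weight_factor :: "int \<Rightarrow> real^2^2 \<Rightarrow> complex" where
  "weight_factor \<kappa> h = of_real (det h powr (of_int \<kappa> / 2)) * j_factor h \<i> powi (- \<kappa>)"

lemma det_real_matrix: "det (real_matrix \<gamma>) = of_int (det \<gamma>)"
  by (simp add: det_2 real_matrix_def)

lemma weight_factor_slash:
  assumes h: "h \<in> GL2_real_pos" and \<gamma>: "\<gamma> \<in> carrier SL2Z"
  shows "weight_factor \<kappa> (real_matrix \<gamma> ** h) * f (moebius (real_matrix \<gamma> ** h) \<i>)
       = weight_factor \<kappa> h * slash \<kappa> f (real_matrix \<gamma>) (moebius h \<i>)"
  using j_factor_i_nonzero[OF h] \<gamma>
  by (simp add: weight_factor_def slash_def det_mul det_real_matrix SL2Z_carrier j_factor_mult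
      moebius_mult power_int_mult_distrib)

lemma real_matrix_GL2_pos:
  "\<gamma> \<in> carrier SL2Z \<Longrightarrow> h \<in> GL2_real_pos \<Longrightarrow> real_matrix \<gamma> ** h \<in> GL2_real_pos"
  by (simp add: GL2_real_pos_iff det_mul det_real_matrix SL2Z_carrier)

lemma adele_matrix_of_int:
  "adele_matrix_of_rat (map_mat of_int \<gamma>) = adele_matrix (real_matrix \<gamma>) (int_mat \<gamma>)"
proof -
  have "map_mat of_rat (map_mat rat_of_int \<gamma>) = real_matrix \<gamma>"
    by (simp add: vec_eq_iff real_matrix_def)
  moreover have "map_mat fa (map_mat rat_of_int \<gamma>) = int_mat \<gamma>"
    by (simp add: vec_eq_iff)
  ultimately show ?thesis by (simp add: adele_matrix_of_rat_eq)
qed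

text \<open>\<open>GL\<^sub>2(\<rat>)\<close> meets \<open>GL\<^sub>2(\<real>)\<^sup>+ \<times> K\<^sub>0(N)\<close> in \<open>\<Gamma>\<^sub>0(N)\<close>: the entries of such a matrix lie in \<open>\<rat> \<inter> Zhat = \<int>\<close>, and its
  determinant is a positive unit.\<close>

lemma GL2_decomposition_unique:
  assumes N: "N > 0" and h: "h \<in> GL2_real_pos" "h' \<in> GL2_real_pos" and k: "k \<in> K0 N" "k' \<in> K0 N"
    and q: "invertible q" "invertible q'"
    and eq: "adele_matrix_of_rat q ** adele_matrix h k = adele_matrix_of_rat q' ** adele_matrix h' k'"
  obtains \<gamma> where "\<gamma> \<in> Gamma0 N" "h' = real_matrix \<gamma> ** h" "k' = int_mat \<gamma> ** k"
proof -
  obtain p where p: "p ** q' = mat 1" using q(2) by (auto simp: invertible_def)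
  define s where "s = p ** q"
  have "adele_matrix_of_rat s ** adele_matrix h k
      = adele_matrix_of_rat p ** (adele_matrix_of_rat q ** adele_matrix h k)"
    by (simp add: s_def adele_matrix_of_rat_mult matrix_mul_assoc)
  also have "\<dots> = adele_matrix_of_rat (p ** q') ** adele_matrix h' k'"
    by (simp add: eq adele_matrix_of_rat_mult matrix_mul_assoc)
  also have "\<dots> = adele_matrix h' k'"
    by (simp add: p adele_matrix_of_rat_eq adele_matrix_mult)
  finally have s: "map_mat of_rat s ** h = h'" "map_mat fa s ** k = k'"
    by (simp_all add: adele_matrix_of_rat_eq adele_matrix_mult)
  have kZ: "k \<in> GL2_Zhat" "k' \<in> GL2_Zhat" using k by (auto simp: K0_iff)
  have "fa (det s) * det k = det k'" using s(2) by (metis det_mul det_map_mat_fa)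
  from rational_Zhat_unit[OF this] have "det s = 1 \<or> det s = - 1"
    using kZ by (simp add: GL2_Zhat_iff)
  moreover have "det h' = of_rat (det s) * det h"
    using s(1) by (metis det_mul det_map_mat_of_rat)
  ultimately have dets: "det s = 1" using h by (auto simp: GL2_real_pos_iff)
  obtain l where l: "\<forall>i j. l $ i $ j \<in> Zhat" "k ** l = mat 1"
    using kZ(1) by (auto simp: GL2_Zhat_def)
  have "map_mat fa s = k' ** l"
    using s(2) l(2) by (metis matrix_mul_assoc matrix_mul_rid)
  moreover have "\<forall>i j. (k' ** l) $ i $ j \<in> Zhat"
    using kZ(2) l(1) by (intro Zhat_matrix_mult) (auto simp: GL2_Zhat_iff)
  ultimately have "fa (s $ i $ j) \<in> Zhat" for i j by (metis map_mat_nth)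
  hence sZ: "s $ i $ j \<in> \<int>" for i j by (simp add: fa_in_Zhat_iff)
  define \<gamma> where "\<gamma> = map_mat floor s"
  have s\<gamma>: "s = map_mat of_int \<gamma>"
    using sZ by (auto simp: vec_eq_iff \<gamma>_def elim!: Ints_cases)
  have "(of_int (det \<gamma>) :: rat) = of_int 1" using dets by (simp add: s\<gamma> det_2)
  hence SL: "\<gamma> \<in> carrier SL2Z" by (simp only: of_int_eq_iff SL2Z_carrier)
  have rel: "h' = real_matrix \<gamma> ** h" "k' = int_mat \<gamma> ** k"
    using s adele_matrix_of_int[of \<gamma>] by (simp_all add: s\<gamma> adele_matrix_of_rat_eq)
  have z: "\<And>i j. k $ i $ j \<in> Zhat" using kZ by (simp add: GL2_Zhat_iff)
  have k0: "Zhat_cong N (k $ 2 $ 1) 0" "Zhat_cong N (k' $ 2 $ 1) 0" using k by (auto simp: K0_iff)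
  have "Zhat_cong N (k $ 1 $ 1 * k $ 2 $ 2 + - k $ 1 $ 2 * k $ 2 $ 1) (k $ 1 $ 1 * k $ 2 $ 2 + 0)"
    using z by (intro Zhat_cong_add Zhat_cong_refl Zhat_cong_mult_0 k0) auto
  hence "Zhat_cong N (det k) (k $ 1 $ 1 * k $ 2 $ 2)" by (simp add: det_2)
  moreover have "Zhat_cong N (k $ 1 $ 1 * k $ 2 $ 2)
      (of_int (Zhat_mod N (k $ 1 $ 1)) * of_int (Zhat_mod N (k $ 2 $ 2)))"
    using z N by (intro Zhat_cong_mult Zhat_mod_cong) auto
  ultimately have "Zhat_cong N (det k) (of_int (Zhat_mod N (k $ 1 $ 1) * Zhat_mod N (k $ 2 $ 2)))"
    using Zhat_cong_trans by simp
  moreover have dk: "det k \<in> Zhat_units" using kZ by (simp add: GL2_Zhat_iff)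
  ultimately have "[Zhat_mod N (det k) = Zhat_mod N (k $ 1 $ 1) * Zhat_mod N (k $ 2 $ 2)] (mod int N)"
    using N Zhat_cong_iff_mod by (meson Zhat_units_iff)
  hence cop: "coprime (Zhat_mod N (k $ 1 $ 1)) (int N)"
    using cong_imp_coprime[OF _ Zhat_mod_unit[OF dk N]] by (metis coprime_mult_left_iff)
  have e21: "k' $ 2 $ 1 = of_int (\<gamma> $ 2 $ 1) * k $ 1 $ 1 + of_int (\<gamma> $ 2 $ 2) * k $ 2 $ 1"
    by (simp add: rel(2) matrix_mult_nth_2)
  have "Zhat_cong N (k' $ 2 $ 1 + of_int (- \<gamma> $ 2 $ 2) * k $ 2 $ 1) 0"
    by (intro Zhat_cong_0_add Zhat_cong_mult_0 k0) auto
  hence c1: "Zhat_cong N (of_int (\<gamma> $ 2 $ 1) * k $ 1 $ 1) 0" by (simp add: e21)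
  have c2: "Zhat_cong N (of_int (\<gamma> $ 2 $ 1) * k $ 1 $ 1)
      (of_int (\<gamma> $ 2 $ 1) * of_int (Zhat_mod N (k $ 1 $ 1)))"
    using z N by (intro Zhat_cong_mult Zhat_mod_cong Zhat_cong_refl) auto
  have "Zhat_cong N (of_int (\<gamma> $ 2 $ 1 * Zhat_mod N (k $ 1 $ 1))) (of_int 0)"
    using Zhat_cong_trans[OF Zhat_cong_sym[OF c2] c1] by (simp only: of_int_0 of_int_mult)
  hence "[\<gamma> $ 2 $ 1 * Zhat_mod N (k $ 1 $ 1) = 0] (mod int N)"
    by (simp only: Zhat_cong_of_int_iff[OF N])
  hence "int N dvd \<gamma> $ 2 $ 1"
    using cop by (simp add: cong_0_iff coprime_commute coprime_dvd_mult_left_iff)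
  hence "\<gamma> \<in> Gamma0 N" using SL by (simp add: Gamma0_def)
  thus ?thesis using that rel by blast
qed

section \<open>Adelization and lifting commute\<close>

context weil_lattice
begin

lemma chi_D_mult:
  assumes "odd N" shows "chi_D L B (a * b) = chi_D L B a * chi_D L B b"
  by (simp add: chi_D_def jacobi_mult[OF odd_card_D[OF assms]])

lemma chi_D_cong: "[a = b] (mod int N) \<Longrightarrow> chi_D L B a = chi_D L B b"
  unfolding chi_D_def using jacobi_cong prime_dvd_card_D by metis

lemma xi_D_Gamma0:
  assumes odd: "odd N" and \<gamma>: "\<gamma> \<in> Gamma0 N" and k: "k \<in> GL2_Zhat"
  shows "xi_D L B (int_mat \<gamma> ** k) = chi_D L B (\<gamma> $ 2 $ 2) * xi_D L B k"
    and "chi_D L B (\<gamma> $ 2 $ 2) * chi_D L B (\<gamma> $ 2 $ 2) = 1"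
proof -
  note N0 = level_properties(1)
  have z: "\<And>i j. k $ i $ j \<in> Zhat" using k by (simp add: GL2_Zhat_iff)
  obtain c where c: "\<gamma> $ 2 $ 1 = int N * c" using \<gamma> by (auto simp: Gamma0_def)
  have kz: "(int_mat \<gamma> ** k) $ 2 $ 2 \<in> Zhat" using z by (simp add: matrix_mult_nth_2)
  have "Zhat_cong N (of_int (\<gamma> $ 2 $ 1) * k $ 1 $ 2 + of_int (\<gamma> $ 2 $ 2) * k $ 2 $ 2)
      (0 + of_int (\<gamma> $ 2 $ 2) * of_int (Zhat_mod N (k $ 2 $ 2)))"
  proof (intro Zhat_cong_add)
    show "Zhat_cong N (of_int (\<gamma> $ 2 $ 1) * k $ 1 $ 2) 0"
      using z by (auto simp: Zhat_cong_def c mult.assoc)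
    show "Zhat_cong N (of_int (\<gamma> $ 2 $ 2) * k $ 2 $ 2) (of_int (\<gamma> $ 2 $ 2) * of_int (Zhat_mod N (k $ 2 $ 2)))"
      using z N0 by (intro Zhat_cong_mult Zhat_mod_cong Zhat_cong_refl) auto
  qed
  hence "Zhat_cong N ((int_mat \<gamma> ** k) $ 2 $ 2) (of_int (\<gamma> $ 2 $ 2 * Zhat_mod N (k $ 2 $ 2)))"
    by (simp add: matrix_mult_nth_2)
  hence "[Zhat_mod N ((int_mat \<gamma> ** k) $ 2 $ 2) = \<gamma> $ 2 $ 2 * Zhat_mod N (k $ 2 $ 2)] (mod int N)"
    using Zhat_cong_iff_mod[OF kz N0] by blast
  thus "xi_D L B (int_mat \<gamma> ** k) = chi_D L B (\<gamma> $ 2 $ 2) * xi_D L B k"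
    unfolding xi_D_def using chi_D_cong chi_D_mult[OF odd] by metis
  have "\<gamma> $ 1 $ 1 * \<gamma> $ 2 $ 2 - 1 = \<gamma> $ 1 $ 2 * \<gamma> $ 2 $ 1"
    using \<gamma> by (simp add: Gamma0_def SL2Z_carrier det_2)
  hence "[\<gamma> $ 2 $ 2 * \<gamma> $ 1 $ 1 = 1] (mod int N)" by (simp add: cong_iff_dvd_diff c mult.commute)
  hence "coprime (\<gamma> $ 2 $ 2) (int N)" using coprime_iff_invertible_int by blast
  thus "chi_D L B (\<gamma> $ 2 $ 2) * chi_D L B (\<gamma> $ 2 $ 2) = 1"
    using gauss_ratio_square gauss_sum_quotient_eq_jacobi[OF odd] by metis
qed

text \<open>Two decompositions differ by some \<open>\<gamma> \<in> \<Gamma>\<^sub>0(N)\<close>. It contributes \<open>\<chi>\<^sub>D(\<gamma>)\<close> both through \<open>\<xi>\<^sub>D\<close> and through \<open>f|\<gamma>\<close>, and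
  \<open>\<chi>\<^sub>D(\<gamma>)\<^sup>2 = 1\<close>.\<close>

lemma A_xi_eq:
  assumes odd: "odd N" and f: "f \<in> cusp_forms \<kappa> N (chi_D L B)"
    and q: "invertible q" and h: "h \<in> GL2_real_pos" and k: "k \<in> K0 N"
    and g: "g \<in> GL2_sq" "g = adele_matrix_of_rat q ** adele_matrix h k"
  shows "A_xi L B \<kappa> f g = xi_D L B k * (weight_factor \<kappa> h * f (moebius h \<i>))"
proof -
  have "(THE v. \<exists>q h k.
     invertible q \<and> h \<in> GL2_real_pos \<and> k \<in> K0 N \<and>
     g = adele_matrix_of_rat q ** adele_matrix h k \<and>
     v = xi_D L B k * of_real (det h powr (of_int \<kappa> / 2)) * j_factor h \<i> powi (- \<kappa>)
           * f (moebius h \<i>)) = xi_D L B k * (weight_factor \<kappa> h * f (moebius h \<i>))"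
  proof (rule the_equality)
    show "\<exists>q' h' k'. invertible q' \<and> h' \<in> GL2_real_pos \<and> k' \<in> K0 N \<and>
       g = adele_matrix_of_rat q' ** adele_matrix h' k' \<and>
       xi_D L B k * (weight_factor \<kappa> h * f (moebius h \<i>))
       = xi_D L B k' * of_real (det h' powr (of_int \<kappa> / 2)) * j_factor h' \<i> powi (- \<kappa>) * f (moebius h' \<i>)"
      using q h k g by (intro exI[of _ q] exI[of _ h] exI[of _ k]) (simp add: weight_factor_def mult.assoc)
  next
    fix v assume "\<exists>q h k. invertible q \<and> h \<in> GL2_real_pos \<and> k \<in> K0 N \<and>
       g = adele_matrix_of_rat q ** adele_matrix h k \<and>
       v = xi_D L B k * of_real (det h powr (of_int \<kappa> / 2)) * j_factor h \<i> powi (- \<kappa>) * f (moebius h \<i>)"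
    then obtain q' h' k' where *: "invertible q'" "h' \<in> GL2_real_pos" "k' \<in> K0 N"
      "g = adele_matrix_of_rat q' ** adele_matrix h' k'"
      "v = xi_D L B k' * (weight_factor \<kappa> h' * f (moebius h' \<i>))"
      by (auto simp: weight_factor_def mult.assoc)
    obtain \<gamma> where \<gamma>: "\<gamma> \<in> Gamma0 N" "h' = real_matrix \<gamma> ** h" "k' = int_mat \<gamma> ** k"
      using GL2_decomposition_unique[OF level_properties(1) h *(2) k *(3) q *(1)] g *(4) by metis
    have SL: "\<gamma> \<in> carrier SL2Z" using \<gamma>(1) by (simp add: Gamma0_def)
    have kZ: "k \<in> GL2_Zhat" using k by (simp add: K0_iff)
    have "slash \<kappa> f (real_matrix \<gamma>) (moebius h \<i>) = chi_D L B (\<gamma> $ 2 $ 2) * f (moebius h \<i>)"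
      using f \<gamma>(1) moebius_i_upper[OF h] by (simp add: cusp_forms_def)
    hence "v = (chi_D L B (\<gamma> $ 2 $ 2) * chi_D L B (\<gamma> $ 2 $ 2)) * (xi_D L B k * (weight_factor \<kappa> h * f (moebius h \<i>)))"
      using weight_factor_slash[OF h SL, of \<kappa> f] xi_D_Gamma0(1)[OF odd \<gamma>(1) kZ]
      by (simp add: *(5) \<gamma>(2,3) mult_ac)
    thus "v = xi_D L B k * (weight_factor \<kappa> h * f (moebius h \<i>))"
      by (simp add: xi_D_Gamma0(2)[OF odd \<gamma>(1) kZ])
  qed
  thus ?thesis using g(1) by (simp add: A_xi_def)
qed

text \<open>Injective because \<open>\<Gamma>\<close> meets \<open>\<K>\<^sub>0(N)\<close> in \<open>\<Gamma>\<^sub>0(N)\<close>, and surjective because every element of \<open>\<K>\<close> has a lift to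
  \<open>\<Gamma>\<close>. The translation by \<open>k\<^sub>0\<close> adapts the representatives to a point \<open>q (h \<times> k\<^sub>0)\<close>.\<close>

lemma coset_bijection:
  assumes k0: "k0 \<in> carrier calK"
  defines "\<Theta> \<equiv> \<lambda>\<gamma>. (inv\<^bsub>calK\<^esub> k0 \<otimes>\<^bsub>calK\<^esub> inv\<^bsub>calK\<^esub> (embK \<gamma>)) <#\<^bsub>calK\<^esub> calK0 N"
  shows "bij_betw (\<lambda>C. \<Theta> (SOME \<gamma>. \<gamma> \<in> C)) (rcosets\<^bsub>SL2Z\<^esub> (Gamma0 N)) (lcosets\<^bsub>calK\<^esub> (calK0 N))"
proof -
  interpret S: group SL2Z by (rule group_SL2Z)
  interpret K: group calK by (rule group_calK)
  interpret SG: subgroup "Gamma0 N" SL2Z by (rule subgroup_Gamma0)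
  interpret SK: subgroup "calK0 N" calK by (rule subgroup_calK0)
  note N0 = level_properties(1)
  define e where "e \<gamma> = inv\<^bsub>calK\<^esub> k0 \<otimes>\<^bsub>calK\<^esub> inv\<^bsub>calK\<^esub> (embK \<gamma>)" for \<gamma>
  have eK: "e \<gamma> \<in> carrier calK" if "\<gamma> \<in> carrier SL2Z" for \<gamma>
    unfolding e_def using that k0 embK_closed by blast
  have coset_eq: "x <#\<^bsub>calK\<^esub> calK0 N = y <#\<^bsub>calK\<^esub> calK0 N \<longleftrightarrow> inv\<^bsub>calK\<^esub> x \<otimes>\<^bsub>calK\<^esub> y \<in> calK0 N"
    if "x \<in> carrier calK" "y \<in> carrier calK" for x y
  proof
    assume "x <#\<^bsub>calK\<^esub> calK0 N = y <#\<^bsub>calK\<^esub> calK0 N"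
    hence "y \<in> x <#\<^bsub>calK\<^esub> calK0 N" using K.lcos_self[OF that(2) subgroup_calK0] by simp
    thus "inv\<^bsub>calK\<^esub> x \<otimes>\<^bsub>calK\<^esub> y \<in> calK0 N" using SK.lcos_module_imp[OF group_calK that(1)] by blast
  next
    assume *: "inv\<^bsub>calK\<^esub> x \<otimes>\<^bsub>calK\<^esub> y \<in> calK0 N"
    have "y = x \<otimes>\<^bsub>calK\<^esub> (inv\<^bsub>calK\<^esub> x \<otimes>\<^bsub>calK\<^esub> y)"
      using that K.inv_solve_left' by (metis K.inv_closed K.m_assoc K.r_inv K.l_one)
    hence "y \<in> x <#\<^bsub>calK\<^esub> calK0 N" unfolding l_coset_def using * by blast
    thus "x <#\<^bsub>calK\<^esub> calK0 N = y <#\<^bsub>calK\<^esub> calK0 N"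
      using K.l_repr_independence[OF _ that(1) subgroup_calK0] by blast
  qed
  have diff: "inv\<^bsub>calK\<^esub> (e \<gamma>) \<otimes>\<^bsub>calK\<^esub> e \<delta> = embK (\<gamma> \<otimes>\<^bsub>SL2Z\<^esub> inv\<^bsub>SL2Z\<^esub> \<delta>)"
    if "\<gamma> \<in> carrier SL2Z" "\<delta> \<in> carrier SL2Z" for \<gamma> \<delta>
  proof -
    have c: "embK \<gamma> \<in> carrier calK" "inv\<^bsub>calK\<^esub> (embK \<delta>) \<in> carrier calK" "inv\<^bsub>calK\<^esub> k0 \<in> carrier calK"
      using that embK_closed k0 by auto
    have "inv\<^bsub>calK\<^esub> (e \<gamma>) = embK \<gamma> \<otimes>\<^bsub>calK\<^esub> k0"
      unfolding e_def using c k0 K.inv_mult_group K.inv_inv K.inv_closed by presburger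
    hence "inv\<^bsub>calK\<^esub> (e \<gamma>) \<otimes>\<^bsub>calK\<^esub> e \<delta>
        = embK \<gamma> \<otimes>\<^bsub>calK\<^esub> (k0 \<otimes>\<^bsub>calK\<^esub> (inv\<^bsub>calK\<^esub> k0 \<otimes>\<^bsub>calK\<^esub> inv\<^bsub>calK\<^esub> (embK \<delta>)))"
      unfolding e_def using c k0 K.m_assoc K.m_closed by presburger
    also have "k0 \<otimes>\<^bsub>calK\<^esub> (inv\<^bsub>calK\<^esub> k0 \<otimes>\<^bsub>calK\<^esub> inv\<^bsub>calK\<^esub> (embK \<delta>)) = inv\<^bsub>calK\<^esub> (embK \<delta>)"
      using c k0 K.m_assoc K.r_inv K.l_one by metis
    finally show ?thesis using embK_inv[OF that(2)] embK_mult by simp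
  qed
  have \<Theta>_eq: "\<Theta> \<gamma> = \<Theta> \<delta> \<longleftrightarrow> \<gamma> \<otimes>\<^bsub>SL2Z\<^esub> inv\<^bsub>SL2Z\<^esub> \<delta> \<in> Gamma0 N"
    if "\<gamma> \<in> carrier SL2Z" "\<delta> \<in> carrier SL2Z" for \<gamma> \<delta>
  proof -
    have "\<gamma> \<otimes>\<^bsub>SL2Z\<^esub> inv\<^bsub>SL2Z\<^esub> \<delta> \<in> carrier SL2Z" using that by blast
    thus ?thesis
      unfolding \<Theta>_def e_def[symmetric] coset_eq[OF eK[OF that(1)] eK[OF that(2)]] diff[OF that]
      by (rule embK_calK0_iff[OF N0])
  qed
  have rc: "Gamma0 N #>\<^bsub>SL2Z\<^esub> \<gamma> = Gamma0 N #>\<^bsub>SL2Z\<^esub> \<delta> \<longleftrightarrow> \<gamma> \<otimes>\<^bsub>SL2Z\<^esub> inv\<^bsub>SL2Z\<^esub> \<delta> \<in> Gamma0 N"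
    if "\<gamma> \<in> carrier SL2Z" "\<delta> \<in> carrier SL2Z" for \<gamma> \<delta>
    using that S.repr_independence[OF _ that(2) subgroup_Gamma0] S.rcos_self[OF that(1) subgroup_Gamma0]
      SG.rcos_module[OF group_SL2Z that(2,1)] by blast
  note rep = SL2Z_rcoset_some
  show ?thesis
  proof (rule bij_betw_imageI)
    show "inj_on (\<lambda>C. \<Theta> (SOME \<gamma>. \<gamma> \<in> C)) (rcosets\<^bsub>SL2Z\<^esub> (Gamma0 N))"
      by (intro inj_onI) (metis rep rc \<Theta>_eq)
    show "(\<lambda>C. \<Theta> (SOME \<gamma>. \<gamma> \<in> C)) ` (rcosets\<^bsub>SL2Z\<^esub> (Gamma0 N)) = lcosets\<^bsub>calK\<^esub> (calK0 N)"
    proof (intro equalityI subsetI)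
      fix X assume "X \<in> (\<lambda>C. \<Theta> (SOME \<gamma>. \<gamma> \<in> C)) ` (rcosets\<^bsub>SL2Z\<^esub> (Gamma0 N))"
      then obtain C where C: "C \<in> rcosets\<^bsub>SL2Z\<^esub> (Gamma0 N)" "X = \<Theta> (SOME \<gamma>. \<gamma> \<in> C)" by blast
      thus "X \<in> lcosets\<^bsub>calK\<^esub> (calK0 N)"
        using eK[OF rep(1)[OF C(1)]] by (auto simp: LCOSETS_def \<Theta>_def e_def)
    next
      fix X assume "X \<in> lcosets\<^bsub>calK\<^esub> (calK0 N)"
      then obtain x where x: "x \<in> carrier calK" "X = x <#\<^bsub>calK\<^esub> calK0 N" by (auto simp: LCOSETS_def)
      define y where "y = k0 \<otimes>\<^bsub>calK\<^esub> x"
      have y: "y \<in> carrier calK" using k0 x unfolding y_def by blast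
      obtain \<delta> where \<delta>: "lifts y \<delta>" using lift_exists[OF y] by blast
      hence \<delta>S: "\<delta> \<in> carrier SL2Z" by (simp add: lifts_def)
      define \<gamma> where "\<gamma> = inv\<^bsub>SL2Z\<^esub> \<delta>"
      have \<gamma>S: "\<gamma> \<in> carrier SL2Z" using \<delta>S by (simp add: \<gamma>_def)
      have \<gamma>\<delta>: "\<gamma> ** \<delta> = mat 1" using S.l_inv[OF \<delta>S] by (simp add: \<gamma>_def)
      have "embK \<gamma> \<otimes>\<^bsub>calK\<^esub> y \<in> calK0 N"
      proof -
        have "embK \<gamma> \<otimes>\<^bsub>calK\<^esub> y \<in> carrier calK" using embK_closed[OF \<gamma>S] y by blast
        moreover have "Zhat_cong N (of_int (\<gamma> $ 2 $ 1) * fst y $ 1 $ 1 + of_int (\<gamma> $ 2 $ 2) * fst y $ 2 $ 1)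
            (of_int (\<gamma> $ 2 $ 1) * (snd y * of_int (\<delta> $ 1 $ 1)) + of_int (\<gamma> $ 2 $ 2) * (snd y * of_int (\<delta> $ 2 $ 1)))"
          using \<delta> calK_Zhat[OF y] by (intro Zhat_cong_add Zhat_cong_mult Zhat_cong_refl) (auto simp: lifts_def)
        moreover have "of_int (\<gamma> $ 2 $ 1) * (snd y * of_int (\<delta> $ 1 $ 1)) + of_int (\<gamma> $ 2 $ 2) * (snd y * of_int (\<delta> $ 2 $ 1))
            = snd y * of_int ((\<gamma> ** \<delta>) $ 2 $ 1)"
          by (simp add: matrix_mult_nth_2 algebra_simps)
        ultimately show ?thesis
          by (simp add: calK0_iff embK_def pair_mult_def matrix_mult_nth_2 \<gamma>\<delta> mat_1_eq_mat2)
      qed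
      moreover have "inv\<^bsub>calK\<^esub> (e \<gamma>) \<otimes>\<^bsub>calK\<^esub> x = embK \<gamma> \<otimes>\<^bsub>calK\<^esub> y"
      proof -
        have c: "embK \<gamma> \<in> carrier calK" "inv\<^bsub>calK\<^esub> k0 \<in> carrier calK"
          using \<gamma>S embK_closed k0 by auto
        have "inv\<^bsub>calK\<^esub> (e \<gamma>) = embK \<gamma> \<otimes>\<^bsub>calK\<^esub> k0"
          unfolding e_def using c k0 K.inv_mult_group K.inv_inv K.inv_closed by presburger
        thus ?thesis unfolding y_def using c k0 x K.m_assoc by presburger
      qed
      ultimately have "\<Theta> \<gamma> = X"
        unfolding \<Theta>_def e_def[symmetric] x(2) by (simp add: coset_eq[OF eK[OF \<gamma>S] x(1)])
      moreover define C where "C = Gamma0 N #>\<^bsub>SL2Z\<^esub> \<gamma>"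
      have C: "C \<in> rcosets\<^bsub>SL2Z\<^esub> (Gamma0 N)" using \<gamma>S by (auto simp: RCOSETS_def C_def)
      have "\<Theta> (SOME \<gamma>. \<gamma> \<in> C) = \<Theta> \<gamma>"
        using rep[OF C] rc[OF rep(1)[OF C] \<gamma>S] \<Theta>_eq[OF rep(1)[OF C] \<gamma>S] by (simp add: C_def)
      ultimately show "X \<in> (\<lambda>C. \<Theta> (SOME \<gamma>. \<gamma> \<in> C)) ` (rcosets\<^bsub>SL2Z\<^esub> (Gamma0 N))"
        using C by blast
    qed
  qed
qed

lemma calG_mult_GL2_sq:
  assumes g: "g \<in> calG" and k: "k \<in> carrier calK"
  shows "fst (pair_mult g (calG_inf_fin (mat 1) k)) \<in> GL2_sq"
proof -
  have u: "snd k dvd 1" using calK_Zhat(3)[OF k] by (auto simp: Zhat_units_iff intro: dvdI[OF sym])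
  have d: "det (fst k) = (snd k)\<^sup>2" using k by (cases k) (simp add: calK_iff)
  have "det (fst (pair_mult g (calG_inf_fin (mat 1) k))) = (snd g * Adele 1 (snd k))\<^sup>2"
    using g by (auto simp: calG_def pair_mult_def calG_inf_fin_def det_mul det_adele_matrix d
        power_mult_distrib) (simp add: power2_eq_square)
  moreover have "snd g * Adele 1 (snd k) dvd 1"
    using g u mult_dvd_mono[of "snd g" 1 "Adele 1 (snd k)" 1]
    by (auto simp: calG_def Adele_dvd_1_iff)
  ultimately show ?thesis
    unfolding GL2_sq_def invertible_2_iff mem_Collect_eq power2_eq_square
    by (metis mult_dvd_mono mult_1)
qed

lemma real_matrix_mult: "real_matrix (\<gamma> ** \<delta>) = real_matrix \<gamma> ** real_matrix \<delta>"
  by (simp add: vec_eq_iff matrix_mult_nth_2 real_matrix_def)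

lemma real_matrix_one: "real_matrix (mat 1) = mat 1"
  by (simp add: vec_eq_iff real_matrix_def mat_def)

text \<open>A representative \<open>k = k\<^sub>0\<^sup>-\<^sup>1 \<gamma>\<^sup>-\<^sup>1 x\<close> of the coset gives \<open>g k = q \<gamma>\<^sup>-\<^sup>1 (\<gamma> h \<times> x)\<close>. The character value at \<open>x\<close>
  enters twice, from the scalar form and from \<open>\<omega>\<^sub>f(x) \<phi>\<^sub>0\<close>, and squares to 1.\<close>

lemma L_omega_summand:
  assumes odd: "odd N" and f: "f \<in> cusp_forms \<kappa> N (chi_D L B)"
    and q: "q \<in> calG" and h: "h \<in> GL2_real_pos" and k0: "k0 \<in> carrier calK"
    and g: "g \<in> calG" "g = pair_mult (calG_of_rat q) (calG_inf_fin h k0)"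
    and \<gamma>: "\<gamma> \<in> carrier SL2Z"
    and k: "k \<in> (inv\<^bsub>calK\<^esub> k0 \<otimes>\<^bsub>calK\<^esub> inv\<^bsub>calK\<^esub> (embK \<gamma>)) <#\<^bsub>calK\<^esub> calK0 N"
  shows "A_xi L B \<kappa> f (fst (pair_mult g (calG_inf_fin (mat 1) k))) * om k (basis_vec L) \<mu>
       = (weight_factor \<kappa> h * slash \<kappa> f (real_matrix \<gamma>) (moebius h \<i>))
           * om (inv\<^bsub>calK\<^esub> k0) (\<rho> (inv\<^bsub>SL2Z\<^esub> \<gamma>) (basis_vec L)) \<mu>"
proof -
  interpret S: group SL2Z by (rule group_SL2Z)
  interpret K: group calK by (rule group_calK)
  define \<delta> where "\<delta> = inv\<^bsub>SL2Z\<^esub> \<gamma>"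
  have \<delta>: "\<delta> \<in> carrier SL2Z" using \<gamma> by (simp add: \<delta>_def)
  have \<delta>\<gamma>: "\<delta> ** \<gamma> = mat 1" using S.l_inv[OF \<gamma>] by (simp add: \<delta>_def)
  have e: "basis_vec L \<in> GA" using L_in_D by simp
  have i: "inv\<^bsub>calK\<^esub> k0 \<in> carrier calK" using k0 by simp
  have emb: "embK \<delta> \<in> carrier calK" "inv\<^bsub>calK\<^esub> (embK \<gamma>) = embK \<delta>"
    using embK_closed[OF \<delta>] embK_inv[OF \<gamma>] by (simp_all add: \<delta>_def)
  obtain x where x: "x \<in> calK0 N" "k = (inv\<^bsub>calK\<^esub> k0 \<otimes>\<^bsub>calK\<^esub> embK \<delta>) \<otimes>\<^bsub>calK\<^esub> x"
    using k unfolding emb(2) by (auto simp: l_coset_def)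
  have xK: "x \<in> carrier calK" using x(1) by (simp add: calK0_iff)
  have kK: "k \<in> carrier calK" unfolding x(2) using i emb xK by blast
  have "k0 \<otimes>\<^bsub>calK\<^esub> k = (k0 \<otimes>\<^bsub>calK\<^esub> inv\<^bsub>calK\<^esub> k0) \<otimes>\<^bsub>calK\<^esub> (embK \<delta> \<otimes>\<^bsub>calK\<^esub> x)"
    unfolding x(2) using k0 i emb(1) xK K.m_assoc K.m_closed by presburger
  hence "k0 \<otimes>\<^bsub>calK\<^esub> k = embK \<delta> \<otimes>\<^bsub>calK\<^esub> x"
    using K.r_inv[OF k0] K.l_one[OF K.m_closed[OF emb(1) xK]] by simp
  hence "fst (pair_mult k0 k) = fst (pair_mult (embK \<delta>) x)" by simp
  hence k0k: "fst k0 ** fst k = int_mat \<delta> ** fst x" by (simp add: pair_mult_def embK_def)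
  have "fst (pair_mult g (calG_inf_fin (mat 1) k))
      = adele_matrix_of_rat (fst q) ** (adele_matrix h (fst k0) ** adele_matrix (mat 1) (fst k))"
    by (simp add: g(2) pair_mult_def calG_of_rat_def calG_inf_fin_def matrix_mul_assoc)
  also have "adele_matrix h (fst k0) ** adele_matrix (mat 1) (fst k)
      = adele_matrix ((real_matrix \<delta> ** real_matrix \<gamma>) ** h) (int_mat \<delta> ** fst x)"
    by (simp add: adele_matrix_mult k0k \<delta>\<gamma> real_matrix_one flip: real_matrix_mult)
  also have "\<dots> = adele_matrix_of_rat (map_mat of_int \<delta>) ** adele_matrix (real_matrix \<gamma> ** h) (fst x)"
    by (simp add: adele_matrix_of_int adele_matrix_mult matrix_mul_assoc)
  also have "adele_matrix_of_rat (fst q) ** \<dots>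
      = adele_matrix_of_rat (fst q ** map_mat of_int \<delta>) ** adele_matrix (real_matrix \<gamma> ** h) (fst x)"
    by (simp add: adele_matrix_of_rat_mult matrix_mul_assoc)
  finally have dec: "fst (pair_mult g (calG_inf_fin (mat 1) k))
      = adele_matrix_of_rat (fst q ** map_mat of_int \<delta>) ** adele_matrix (real_matrix \<gamma> ** h) (fst x)" .
  have "det (map_mat rat_of_int \<delta>) = of_int (det \<delta>)" by (simp add: det_2)
  hence inv: "invertible (fst q ** map_mat rat_of_int \<delta>)"
    using q \<delta> by (intro invertible_mult) (auto simp: calG_def invertible_2_iff SL2Z_carrier)
  have "fst x \<in> K0 N" using x(1) by (auto simp: calK0_def)
  from A_xi_eq[OF odd f inv real_matrix_GL2_pos[OF \<gamma> h] this calG_mult_GL2_sq[OF g(1) kK] dec]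
  have A: "A_xi L B \<kappa> f (fst (pair_mult g (calG_inf_fin (mat 1) k)))
      = xi_D L B (fst x) * (weight_factor \<kappa> h * slash \<kappa> f (real_matrix \<gamma>) (moebius h \<i>))"
    by (simp only: weight_factor_slash[OF h \<gamma>])
  have \<delta>e: "\<rho> \<delta> (basis_vec L) \<in> GA" by (rule rho_GA[OF \<delta> e])
  have "om k (basis_vec L) = om (inv\<^bsub>calK\<^esub> k0) (om (embK \<delta>) (om x (basis_vec L)))"
    using omega_mult[OF _ xK e] omega_mult[OF i emb(1) omega_GA[OF xK e]] K.m_closed[OF i emb(1)]
    by (simp add: x(2))
  also have "om x (basis_vec L) = (\<lambda>\<mu>. xi_D L B (fst x) * basis_vec L \<mu>)"
    by (rule omega_calK0(1)[OF x(1) odd])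
  also have "om (embK \<delta>) \<dots> = (\<lambda>\<mu>. xi_D L B (fst x) * \<rho> \<delta> (basis_vec L) \<mu>)"
    by (simp only: omega_scale[OF emb(1) e] omega_embK[OF \<delta> e])
  also have "om (inv\<^bsub>calK\<^esub> k0) \<dots>
      = (\<lambda>\<mu>. xi_D L B (fst x) * om (inv\<^bsub>calK\<^esub> k0) (\<rho> \<delta> (basis_vec L)) \<mu>)"
    by (rule omega_scale[OF i \<delta>e])
  finally have O: "om k (basis_vec L)
      = (\<lambda>\<mu>. xi_D L B (fst x) * om (inv\<^bsub>calK\<^esub> k0) (\<rho> \<delta> (basis_vec L)) \<mu>)" .
  have "A_xi L B \<kappa> f (fst (pair_mult g (calG_inf_fin (mat 1) k))) * om k (basis_vec L) \<mu>
      = (xi_D L B (fst x) * xi_D L B (fst x)) *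
        ((weight_factor \<kappa> h * slash \<kappa> f (real_matrix \<gamma>) (moebius h \<i>))
           * om (inv\<^bsub>calK\<^esub> k0) (\<rho> \<delta> (basis_vec L)) \<mu>)"
    unfolding A O by (simp only: mult_ac)
  thus ?thesis by (simp add: omega_calK0(2)[OF x(1) odd] \<delta>_def)
qed

text \<open>The decomposition of \<open>g\<close> is arbitrary, so this also gives the uniqueness that the definite
  description in \<open>A_omega\<close> asks for.\<close>

lemma A_omega_value_eq_L_omega:
  assumes odd: "odd N" and f: "f \<in> cusp_forms \<kappa> N (chi_D L B)"
    and q: "q \<in> calG" and h: "h \<in> GL2_real_pos" and k0: "k0 \<in> carrier calK"
    and g: "g \<in> calG" "g = pair_mult (calG_of_rat q) (calG_inf_fin h k0)"
  shows "inv_into GA (om k0) (\<lambda>\<mu>. of_real (det h powr (of_int \<kappa> / 2)) * j_factor h \<i> powi (- \<kappa>)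
           * L_rho L B \<rho> \<kappa> f (moebius h \<i>) \<mu>)
       = L_omega L B \<rho> (A_xi L B \<kappa> f) g"
proof -
  interpret S: group SL2Z by (rule group_SL2Z)
  interpret K: group calK by (rule group_calK)
  define rp where "rp C = (SOME \<gamma>. \<gamma> \<in> C)" for C :: "(int^2^2) set"
  define a where "a C = weight_factor \<kappa> h * slash \<kappa> f (real_matrix (rp C)) (moebius h \<i>)" for C
  define w where "w C = \<rho> (inv\<^bsub>SL2Z\<^esub> (rp C)) (basis_vec L)" for C
  let ?R = "rcosets\<^bsub>SL2Z\<^esub> (Gamma0 N)"
  let ?\<Theta> = "\<lambda>\<gamma>. (inv\<^bsub>calK\<^esub> k0 \<otimes>\<^bsub>calK\<^esub> inv\<^bsub>calK\<^esub> (embK \<gamma>)) <#\<^bsub>calK\<^esub> calK0 N"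
  have e: "basis_vec L \<in> GA" using L_in_D by simp
  have rpS: "rp C \<in> carrier SL2Z" if "C \<in> ?R" for C
    unfolding rp_def using that by (rule SL2Z_rcoset_some)
  have wGA: "w C \<in> GA" if "C \<in> ?R" for C
    using rpS[OF that] e unfolding w_def by (intro rho_GA) auto
  have vec: "(\<lambda>\<mu>. of_real (det h powr (of_int \<kappa> / 2)) * j_factor h \<i> powi (- \<kappa>)
           * L_rho L B \<rho> \<kappa> f (moebius h \<i>) \<mu>) = (\<lambda>\<mu>. \<Sum>C\<in>?R. a C * w C \<mu>)"
  proof
    fix \<mu>
    have "L_rho L B \<rho> \<kappa> f (moebius h \<i>) \<mu>
        = (\<Sum>C\<in>?R. slash \<kappa> f (real_matrix (rp C)) (moebius h \<i>) * w C \<mu>)"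
      unfolding L_rho_def Let_def rp_def[symmetric]
      by (intro sum.cong refl) (simp add: rho_inv_into[OF rpS e] w_def)
    thus "of_real (det h powr (of_int \<kappa> / 2)) * j_factor h \<i> powi (- \<kappa>)
        * L_rho L B \<rho> \<kappa> f (moebius h \<i>) \<mu> = (\<Sum>C\<in>?R. a C * w C \<mu>)"
      by (simp add: a_def weight_factor_def sum_distrib_left mult.assoc)
  qed
  have "(\<lambda>\<mu>. \<Sum>C\<in>?R. a C * w C \<mu>) \<in> GA"
    using wGA by (auto simp: group_algebra_def intro!: sum.neutral)
  hence "inv_into GA (om k0) (\<lambda>\<mu>. \<Sum>C\<in>?R. a C * w C \<mu>)
      = (\<lambda>\<mu>. \<Sum>C\<in>?R. a C * om (inv\<^bsub>calK\<^esub> k0) (w C) \<mu>)"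
    using omega_inv_into[OF k0] omega_sum[OF K.inv_closed[OF k0] wGA] by simp
  also have "\<dots> = L_omega L B \<rho> (A_xi L B \<kappa> f) g"
  proof
    fix \<mu>
    let ?F = "\<lambda>X. A_xi L B \<kappa> f (fst (pair_mult g (calG_inf_fin (mat 1) (SOME k. k \<in> X))))
      * om (SOME k. k \<in> X) (basis_vec L) \<mu>"
    have "L_omega L B \<rho> (A_xi L B \<kappa> f) g \<mu> = (\<Sum>X\<in>lcosets\<^bsub>calK\<^esub> (calK0 N). ?F X)"
      using g(1) by (simp add: L_omega_def Let_def)
    also have "\<dots> = (\<Sum>C\<in>?R. ?F (?\<Theta> (rp C)))"
      unfolding rp_def by (rule sum.reindex_bij_betw[OF coset_bijection[OF k0], symmetric])
    also have "\<dots> = (\<Sum>C\<in>?R. a C * om (inv\<^bsub>calK\<^esub> k0) (w C) \<mu>)"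
    proof (rule sum.cong[OF refl])
      fix C assume C: "C \<in> ?R"
      have "inv\<^bsub>calK\<^esub> k0 \<otimes>\<^bsub>calK\<^esub> inv\<^bsub>calK\<^esub> (embK (rp C)) \<in> carrier calK"
        using k0 embK_closed[OF rpS[OF C]] by blast
      hence "\<exists>k. k \<in> ?\<Theta> (rp C)" using K.lcos_self[OF _ subgroup_calK0] by blast
      hence "(SOME k. k \<in> ?\<Theta> (rp C)) \<in> ?\<Theta> (rp C)" by (rule someI_ex)
      from L_omega_summand[OF odd f q h k0 g rpS[OF C] this]
      show "?F (?\<Theta> (rp C)) = a C * om (inv\<^bsub>calK\<^esub> k0) (w C) \<mu>"
        unfolding a_def w_def .
    qed
    finally show "(\<Sum>C\<in>?R. a C * om (inv\<^bsub>calK\<^esub> k0) (w C) \<mu>) = L_omega L B \<rho> (A_xi L B \<kappa> f) g \<mu>"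
      by (rule sym)
  qed
  finally show ?thesis unfolding vec .
qed

end

theorem theorem5p4:
  fixes L :: "'v::real_vector set"
    and B :: "'v \<Rightarrow> 'v \<Rightarrow> real"
    and \<rho> :: "int^2^2 \<Rightarrow> ('v set \<Rightarrow> complex) \<Rightarrow> ('v set \<Rightarrow> complex)"
    and \<kappa> :: int
  assumes "even_lattice L B"
    and "even (dim L)"
    and "odd (level L B)"
    and "weil_representation L B \<rho>"
  shows "\<forall>f \<in> cusp_forms \<kappa> (level L B) (chi_D L B).
           (A_omega L B \<rho> \<kappa> \<circ> L_rho L B \<rho> \<kappa>) f = (L_omega L B \<rho> \<circ> A_xi L B \<kappa>) f"
proof
  interpret weil_lattice L B \<rho> using assms by unfold_locales
  fix f assume f: "f \<in> cusp_forms \<kappa> (level L B) (chi_D L B)"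
  have "A_omega L B \<rho> \<kappa> (L_rho L B \<rho> \<kappa> f) g = L_omega L B \<rho> (A_xi L B \<kappa> f) g" for g
  proof (cases "g \<in> calG")
    case False
    thus ?thesis by (simp add: A_omega_def L_omega_def)
  next
    case True
    note value_eq = A_omega_value_eq_L_omega[OF assms(3) f _ _ _ True]
    have "(THE v. \<exists>q h k. q \<in> calG \<and> h \<in> GL2_real_pos \<and> k \<in> carrier calK \<and>
        g = pair_mult (calG_of_rat q) (calG_inf_fin h k) \<and>
        v = inv_into (group_algebra L B) (omega_f L B \<rho> k)
           (\<lambda>\<mu>. of_real (det h powr (of_int \<kappa> / 2)) * j_factor h \<i> powi (- \<kappa>)
                  * L_rho L B \<rho> \<kappa> f (moebius h \<i>) \<mu>)) = L_omega L B \<rho> (A_xi L B \<kappa> f) g"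
    proof (rule the_equality, goal_cases)
      case 1
      obtain q h k where "q \<in> calG" "h \<in> GL2_real_pos" "k \<in> carrier calK"
        "g = pair_mult (calG_of_rat q) (calG_inf_fin h k)"
        using calG_strong_approximation[OF True] .
      thus ?case using value_eq by metis
    next
      case (2 v)
      thus ?case using value_eq by blast
    qed
    thus ?thesis using True by (simp add: A_omega_def)
  qed
  thus "(A_omega L B \<rho> \<kappa> \<circ> L_rho L B \<rho> \<kappa>) f = (L_omega L B \<rho> \<circ> A_xi L B \<kappa>) f"
    by (simp add: fun_eq_iff)
qed

end
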